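(* Consider the space-discretized ideal compressible MHD equations with any of the three magnetic field transport stabilization methods described in the context: the SUPG method (electric field $\mathbf{E}_{SUPG}$ with modified Lorentz force), the sub-grid resistivity method (electric field $\mathbf{E}_\eta$ with sub-grid Ohmic heating), and the helicity-neutral interior penalty method (electric field $\mathbf{E}_{H_M}$ with the corresponding heating term). All three methods preserve the zero-divergence as well as the energy conservation properties of the unstabilized discretizations, that is: (i) Energy: for boundary conditions $g_1=0$ on $\partial\Omega$ (div-conforming $\mathbf{B}$), respectively $\mathbf{h}_1=0$ on $\partial\Omega$ (curl-conforming $\mathbf{B}$), the total energy $$H(n,\mathbf{V},T,\mathbf{B})=\int_\Omega\left(\frac12m_in|\mathbf{V}|^2+\frac{nT}{\gamma-1}+\frac{|\mathbf{B}|^2}{2\mu_0}\right)dx$$ is conserved in time. (ii) Zero divergence: for div-conforming $\mathbf{B}$, if $\nabla\cdot\mathbf{B}=0$ initially, it remains so for all time. For curl-conforming $\mathbf{B}$, if the weak divergence $\delta_B\in\mathbb{V}_0$, defined by $\langle\chi,\delta_B\rangle=-\langle\nabla\chi,\mathbf{B}\rangle+\int_{\partial\Omega}\chi g_1\,dS$ for all $\chi\in\mathbb{V}_0$, with $g_1$ defined on $\partial\Omega$ such that $\partial g_1/\partial t-\nabla\cdot\mathbf{h}_1=0$, is zero initially, it remains zero for all time. (iii) Moreover, for $\mathbf{E}_\eta$ the magnetic energy satisfies, for curl-conforming $\mathbf{B}$, $$\frac{d}{dt}\int_\Omega\frac{|\mathbf{B}|^2}{2\mu_0}dx=\langle\mathbf{j},\mathbf{F}/n\times\mathbf{B}\rangle-\int_\Gamma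 h_e^2\kappa_B|[\![\mathbf{j}]\!]'|^2dS,$$ and for div-conforming $\mathbf{B}$, $$\frac{d}{dt}\int_\Omega\frac{|\mathbf{B}|^2}{2\mu_0}dx=\langle\mathbf{j},\mathbf{F}/n\times\mathbf{B}\rangle-\int_\Gamma h_e^2\kappa_B|[\![\mathbf{j}]\!]'|^2dS+\int_{\partial\Omega_2}\mathbf{g}_2\cdot\mathbf{E}_\eta\,dS.$$
   Context: $\Omega$ is a three-dimensional domain (possibly periodic, in which case boundary terms are absent) with a finite element mesh and boundary $\partial\Omega=\partial\Omega_1\cup\partial\Omega_2$, $\partial\Omega_1\cap\partial\Omega_2=\emptyset$; $\mathbf{n}$ is the outward unit normal; $\langle\cdot,\cdot\rangle$ is the $L^2(\Omega)$ inner product. $\mathbb{V}_0\subset H^1(\Omega)$, $\mathbb{V}_1\subset H(\mathrm{curl};\Omega)$, $\mathbb{V}_2\subset H(\mathrm{div};\Omega)$, $\mathbb{V}_3\subset L^2(\Omega)$ are finite element spaces forming a discrete de Rham complex: $\nabla$ maps $\mathbb{V}_0$ into $\mathbb{V}_1$, $\nabla\times$ maps $\mathbb{V}_1$ into $\mathbb{V}_2$, $\nabla\cdot$ maps $\mathbb{V}_2$ into $\mathbb{V}_3$. $\mathring{\mathbb{V}}_2=\{\mathbf{w}\in\mathbb{V}_2:\mathbf{w}\cdot\mathbf{n}|_{\partial\Omega}=0\}$. $P_{\mathbb{V}_i}$ is the $L^2$-projection into $\mathbb{V}_i$. $\Gamma$ is the set of interior mesh facets, sides arbitrarily labelled $+,-$,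 with $\mathbf{n}^+=-\mathbf{n}^-$. For scalars, $[\![\psi]\!]=\psi^+-\psi^-$ and $\{\psi\}=\frac12(\psi^++\psi^-)$; for vector fields, $[\![\mathbf{u}]\!]'=\mathbf{u}^+-\mathbf{u}^-$, $\{\mathbf{u}\}=\frac12(\mathbf{u}^+\cdot\mathbf{n}^+-\mathbf{u}^-\cdot\mathbf{n}^-)$, $\{\!\{\mathbf{u}\}\!\}=\mathbf{u}^+\times\mathbf{n}^++\mathbf{u}^-\times\mathbf{n}^-$, and $\tilde{\mathbf{u}}=\mathbf{u}^+$ if $\mathbf{u}^+\cdot\mathbf{n}^+<0$, $\tilde{\mathbf{u}}=\mathbf{u}^-$ otherwise. $h_e$ is the local facet area; $\kappa_T,\kappa_B$ are stabilization parameters; $m_i$ (ion mass), $\mu_0$ (vacuum permeability), $\gamma=5/3$ are constants. Hydrodynamic part: $(n,\mathbf{V},T)\in(\mathbb{V}_3,\mathring{\mathbb{V}}_2,\mathbb{V}_0)$ (ion number density, velocity, temperature) with $$\frac{\partial n}{\partial t}+\nabla\cdot\mathbf{F}=0,$$ $$\Big\langle\mathbf{w},\frac{\partial\mathbf{V}}{\partial t}\Big\rangle+\langle\nabla\times(\mathbf{w}\times\mathbf{F}/n),\mathbf{V}\rangle-\int_\Gamma\{\!\{\mathbf{n}\times(\mathbf{w}\times\mathbf{F}/n)\}\!\}\cdot\tilde{\mathbf{V}}\,dS-\Big\langle\frac12|\mathbf{V}|^2,\nabla\cdot\mathbf{w}\Big\rangle+\Big\langle\mathbf{j},\frac{\mathbf{w}}{m_in}\times\mathbf{B}_L\Big\rangle+\Big\langle\frac{\mathbf{w}}{m_in},\nabla(nT)\Big\rangle-\int_\Gamma[\![nT]\!]\Big\{\frac{\mathbf{w}}{m_in}\Big\}dS=0\quad\forall\mathbf{w}\in\mathring{\mathbb{V}}_2,$$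 $$\Big\langle\frac{n\chi}{\gamma-1},\frac{\partial T}{\partial t}\Big\rangle+\Big\langle\frac{\chi}{\gamma-1}\mathbf{F},\nabla T\Big\rangle+\int_\Gamma\frac{h_e^2\kappa_T}{(\gamma-1)\{n\}}[\![\mathbf{F}\cdot\nabla\chi]\!][\![\mathbf{F}\cdot\nabla T]\!]dS-\langle\mathbf{F}/n,\nabla(\chi nT)\rangle+\int_\Gamma[\![\chi nT]\!]\{\mathbf{F}/n\}dS=Q(\chi)\quad\forall\chi\in\mathbb{V}_0,$$ where $\mathbf{F}\in\mathring{\mathbb{V}}_2$ satisfies $\langle\mathbf{w},\mathbf{F}-n\mathbf{V}\rangle=0$ for all $\mathbf{w}\in\mathring{\mathbb{V}}_2$. Magnetic part, with $\mathbf{E}$ denoting the stabilized electric field. Div-conforming: $\mathbf{B}\in\mathbb{V}_2$, $\mathbf{E},\mathbf{j}\in\mathbb{V}_1$, $\frac{\partial\mathbf{B}}{\partial t}+\nabla\times\mathbf{E}=0$, and $$\langle\mathbf{\Sigma},\mathbf{j}\rangle=\Big\langle\nabla\times\mathbf{\Sigma},\frac1{\mu_0}\mathbf{B}\Big\rangle+\int_{\partial\Omega_2}\mathbf{g}_2\cdot\mathbf{\Sigma}\,dS\quad\forall\mathbf{\Sigma}\in\mathbb{V}_1,$$ where $\mathbf{g}_2$ corresponds to the boundary condition for $\mathbf{H}\times\mathbf{n}|_{\partial\Omega_2}$, $\mathbf{H}=\mathbf{B}/\mu_0$; the boundary condition $\mathbf{B}\cdot\mathbf{n}|_{\partial\Omega_1}=g_1$,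 or an analogous one for $\mathbf{E}\times\mathbf{n}|_{\partial\Omega_1}$, is applied strongly to $\mathbf{B}$ or $\mathbf{E}$. Curl-conforming: $\mathbf{B}\in\mathbb{V}_1$, $\mathbf{E}\in\mathbb{V}_2$, $\mathbf{j}=\frac1{\mu_0}\nabla\times\mathbf{B}\in\mathbb{V}_2$, and $$\Big\langle\mathbf{\Sigma},\frac{\partial\mathbf{B}}{\partial t}\Big\rangle+\langle\nabla\times\mathbf{\Sigma},\mathbf{E}\rangle+\int_{\partial\Omega_1}\mathbf{\Sigma}\cdot\mathbf{h}_1\,dS=0\quad\forall\mathbf{\Sigma}\in\mathbb{V}_1,$$ where $\mathbf{h}_1$ (sufficiently regular) corresponds to the boundary condition for $\mathbf{E}\times\mathbf{n}|_{\partial\Omega_1}$, and the condition $\mathbf{g}_2$ on $\partial\Omega_2$ is applied strongly to $\mathbf{B}$. Stabilization methods ($i=1$ for div-conforming $\mathbf{B}$, $i=2$ for curl-conforming $\mathbf{B}$): SUPG: $\mathbf{E}_{SUPG}=P_{\mathbb{V}_i}\big(-\mathbf{F}/n\times(\mathbf{B}-\tau\mathbf{B}_{res})\big)$ with $\mathbf{B}_{res}=\frac{\partial\mathbf{B}}{\partial t}+\nabla\times(\mathbf{B}\times\mathbf{F}/n)$ (curl taken cell-wise) and $\tau=\big((2\lambda/\Delta t)^2+(2|\mathbf{V}|/h_c)^2\big)^{1/2}$, for time step $\Delta t$, local cell size $h_c$, tuning parameter $\lambda$; here $\mathbf{B}_L=\mathbf{B}-\tau\mathbf{B}_{res}$ and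 $Q=0$. Sub-grid resistivity: $\mathbf{E}_\eta\in\mathbb{V}_i$ with $$\langle\boldsymbol{\omega},\mathbf{E}_\eta\rangle=\langle\boldsymbol{\omega},-\mathbf{F}/n\times\mathbf{B}\rangle+\int_\Gamma h_e^2\kappa_B[\![\boldsymbol{\omega}]\!]'\cdot[\![\mathbf{j}]\!]'dS\quad\forall\boldsymbol{\omega}\in\mathbb{V}_i;$$ here $\mathbf{B}_L=\mathbf{B}$ and $Q(\chi)=\int_\Gamma\chi h_e^2\kappa_B|[\![\mathbf{j}]\!]'|^2dS$. Helicity-neutral penalty: $\mathbf{E}_{H_M}\in\mathbb{V}_i$ with $$\langle\boldsymbol{\omega},\mathbf{E}_{H_M}\rangle=\langle\boldsymbol{\omega},-\mathbf{F}/n\times\mathcal{B}\rangle+\int_\Gamma h_e^2\kappa_B[\![\mathcal{B}\times\boldsymbol{\omega}]\!]'\cdot[\![\mathcal{B}\times\mathbf{j}]\!]'dS\quad\forall\boldsymbol{\omega}\in\mathbb{V}_i,$$ where $\mathcal{B}=\mathbf{B}$, or, in the helicity preserving div-conforming variant (with $g_1=0$ on $\partial\Omega$ and no boundary term in the equation for $\mathbf{j}$), $\mathcal{B}=P_{\mathbb{V}_1}(\mathbf{B})$; here $\mathbf{B}_L=\mathbf{B}$ and $Q(\chi)=\int_\Gamma\chi h_e^2\kappa_B|[\![\mathcal{B}\times\mathbf{j}]\!]'|^2dS$.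
   Formalization: Energy (i) fails for the helicity preserving variant with B_L=B; it is proved there with B_L=P_{V1}(B). The curl-conforming identity in (iii) is stated for h_1=0, as a boundary term is missing otherwise. In (ii) h_1 is extended by zero to ∂Ω_2; 1 is in V_0 and n is bounded below by c>0. *)

theory Defs
  imports "HOL-Analysis.Analysis"
begin

type_synonym point = "real^3"
type_synonym sfield = "point \<Rightarrow> real"
type_synonym vfield = "point \<Rightarrow> point"

notation cross3 (infixr "\<times>\<^sub>v" 80)


section \<open>Differential operators and smoothness\<close>

text \<open>Classical derivatives. Applied to a piecewise smooth field they are the cell-wise
  (broken) operators; all equations below only use their values in the interiors of the cells.\<close>

definition partial :: "3 \<Rightarrow> (point \<Rightarrow> 'b::real_normed_vector) \<Rightarrow> point \<Rightarrow> 'b" where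
  "partial i f x = frechet_derivative f (at x) (axis i 1)"

definition grad :: "sfield \<Rightarrow> vfield" where
  "grad f x = (\<chi> i. partial i f x)"

definition dvg :: "vfield \<Rightarrow> sfield" where
  "dvg u x = (\<Sum>i\<in>UNIV. partial i u x $ i)"

definition curl :: "vfield \<Rightarrow> vfield" where
  "curl u x = vector [partial 2 u x $ 3 - partial 3 u x $ 2,
                      partial 3 u x $ 1 - partial 1 u x $ 3,
                      partial 1 u x $ 2 - partial 2 u x $ 1]"

primrec Ck :: "nat \<Rightarrow> (point \<Rightarrow> 'b::real_normed_vector) \<Rightarrow> bool" where
  "Ck 0 f \<longleftrightarrow> continuous_on UNIV f"
| "Ck (Suc k) f \<longleftrightarrow> (\<forall>x. f differentiable (at x)) \<and> (\<forall>i. Ck k (partial i f))"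

definition smooth :: "(point \<Rightarrow> 'b::real_normed_vector) \<Rightarrow> bool" where
  "smooth f \<longleftrightarrow> (\<forall>k. Ck k f)"

definition test_function :: "point set \<Rightarrow> (point \<Rightarrow> 'b::real_normed_vector) \<Rightarrow> bool" where
  "test_function D \<phi> \<longleftrightarrow> smooth \<phi> \<and> (\<exists>C. compact C \<and> C \<subseteq> D \<and> (\<forall>x. x \<notin> C \<longrightarrow> \<phi> x = 0))"


section \<open>Surface measure and outward normals\<close>

text \<open>The surface measure \<open>dS\<close> is the two-dimensional Hausdorff measure, normalised by
  \<open>\<pi>/4\<close> so that it is the area on planes.\<close>

definition hausdorff2_outer :: "point set \<Rightarrow> ennreal" where
  "hausdorff2_outer A =
     (SUP d\<in>{0::real<..}.
        INF C\<in>{C :: nat \<Rightarrow> point set. A \<subseteq> (\<Union>i. C i) \<and> (\<forall>i. bounded (C i) \<and> diameter (C i) \<le> d)}.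
          (\<Sum>i. ennreal (pi / 4 * (diameter (C i))\<^sup>2)))"

definition surf :: "point measure" where
  "surf = measure_of UNIV (sets borel) hausdorff2_outer"

text \<open>The outward unit normal is meant in the sense of De Giorgi and Federer: it is the unit
  field (unique almost everywhere on the boundary) given by the Gauss-Green formula. For a
  Lipschitz cell this is the usual normal; no restriction on the shape of the cell (tetrahedra,
  hexahedra, curved cells) is needed.\<close>

definition outward_normal :: "point set \<Rightarrow> vfield \<Rightarrow> bool" where
  "outward_normal K \<nu> \<longleftrightarrow>
     \<nu> \<in> borel_measurable borel \<and> (\<forall>x\<in>frontier K. norm (\<nu> x) = 1) \<and>
     (\<forall>u. Ck 1 u \<longrightarrow>
        (LINT x:interior K|lebesgue. dvg u x) = (LINT x:frontier K|surf. u x \<bullet> \<nu> x))"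

definition normal :: "point set \<Rightarrow> vfield" where
  "normal K = (SOME \<nu>. outward_normal K \<nu>)"

definition mesh_cell :: "point set \<Rightarrow> bool" where
  "mesh_cell K \<longleftrightarrow>
     compact K \<and> interior K \<noteq> {} \<and> closure (interior K) = K \<and> negligible (frontier K) \<and>
     emeasure surf (frontier K) < \<infinity> \<and> (\<exists>\<nu>. outward_normal K \<nu>)"


section \<open>Meshes\<close>

text \<open>A possibly periodic domain is the quotient of the connected open set \<open>Dom\<close> by the discrete
  translation group \<open>Per\<close>; \<open>Per = {0}\<close> is the case of an ordinary bounded domain
  \<open>\<Omega> = Dom\<close>. Fields on \<open>\<Omega>\<close> are \<open>Per\<close>-periodic functions. \<open>Cells\<close> contains one representative
  of every mesh cell, so that \<open>\<Omega>\<close> is, up to a null set, the union of the interiors of \<open>Cells\<close>.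
  A triple \<open>(K, L, p)\<close> in \<open>Facets\<close> is the interior facet between the cell \<open>K\<close>, on its
  \<open>+\<close> side, and the translate \<open>p + L\<close>, on its \<open>-\<close> side.\<close>

type_synonym facet = "point set \<times> point set \<times> point"

record mesh =
  Per :: "point set"
  Dom :: "point set"
  Cells :: "point set set"
  Facets :: "facet set"

fun fset :: "facet \<Rightarrow> point set" where
  "fset (K, L, p) = K \<inter> (+) p ` L"

definition all_facets :: "mesh \<Rightarrow> facet set" where
  "all_facets M = {(K, L, p). K \<in> Cells M \<and> L \<in> Cells M \<and> p \<in> Per M \<and> (K, 0) \<noteq> (L, p) \<and>
                     0 < emeasure surf (fset (K, L, p))}"

definition omega :: "mesh \<Rightarrow> point set" where
  "omega M = (\<Union>K\<in>Cells M. interior K)"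

definition bdry :: "mesh \<Rightarrow> point set" where
  "bdry M = \<Union>(Cells M) \<inter> frontier (Dom M)"

fun n_plus :: "facet \<Rightarrow> vfield" where
  "n_plus (K, L, p) x = normal K x"

fun n_minus :: "facet \<Rightarrow> vfield" where
  "n_minus (K, L, p) x = normal L (x - p)"

definition fe_mesh :: "mesh \<Rightarrow> bool" where
  "fe_mesh M \<longleftrightarrow>
     0 \<in> Per M \<and> (\<forall>p\<in>Per M. \<forall>q\<in>Per M. p - q \<in> Per M) \<and>
     (\<exists>e>0. \<forall>p\<in>Per M. p \<noteq> 0 \<longrightarrow> e \<le> norm p) \<and>
     open (Dom M) \<and> connected (Dom M) \<and> Dom M \<noteq> {} \<and> (\<forall>p\<in>Per M. (+) p ` Dom M = Dom M) \<and>
     finite (Cells M) \<and> (\<forall>K\<in>Cells M. mesh_cell K \<and> interior K \<subseteq> Dom M) \<and>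
     closure (Dom M) = (\<Union>p\<in>Per M. \<Union>K\<in>Cells M. (+) p ` K) \<and>
     (\<forall>K\<in>Cells M. \<forall>L\<in>Cells M. \<forall>p\<in>Per M. (K, 0) \<noteq> (L, p) \<longrightarrow>
        interior K \<inter> interior ((+) p ` L) = {} \<and>
        emeasure surf (K \<inter> (+) p ` L \<inter> frontier (Dom M)) = 0) \<and>
     \<comment> \<open>three cells meet at most in edges and vertices\<close>
     (\<forall>K\<in>Cells M. \<forall>L\<in>Cells M. \<forall>K'\<in>Cells M. \<forall>p\<in>Per M. \<forall>q\<in>Per M.
        (K, 0) \<noteq> (L, p) \<and> (K, 0) \<noteq> (K', q) \<and> (L, p) \<noteq> (K', q) \<longrightarrow>
        emeasure surf (K \<inter> (+) p ` L \<inter> (+) q ` K') = 0) \<and>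
     \<comment> \<open>every interior facet occurs with exactly one labelling of its sides\<close>
     Facets M \<subseteq> all_facets M \<and>
     (\<forall>(K, L, p) \<in> all_facets M. ((K, L, p) \<in> Facets M) \<noteq> ((L, K, - p) \<in> Facets M)) \<and>
     (\<forall>e\<in>Facets M. AE x in surf. x \<in> fset e \<longrightarrow> n_plus e x = - n_minus e x)"

definition boundary_split :: "mesh \<Rightarrow> point set \<Rightarrow> point set \<Rightarrow> bool" where
  "boundary_split M b1 b2 \<longleftrightarrow>
     b1 \<in> sets borel \<and> b2 \<in> sets borel \<and> b1 \<union> b2 = bdry M \<and> b1 \<inter> b2 = {}"

definition ip :: "mesh \<Rightarrow> (point \<Rightarrow> 'b::real_inner) \<Rightarrow> (point \<Rightarrow> 'b) \<Rightarrow> real" where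
  "ip M f g = (LINT x:omega M|lebesgue. f x \<bullet> g x)"

text \<open>Equality of fields on \<open>\<Omega>\<close>; values on the skeleton of the mesh are irrelevant.\<close>

definition agree :: "mesh \<Rightarrow> (point \<Rightarrow> 'b) \<Rightarrow> (point \<Rightarrow> 'b) \<Rightarrow> bool" where
  "agree M f g \<longleftrightarrow> (\<forall>x\<in>omega M. f x = g x)"


section \<open>Traces, jumps, averages and surface integrals\<close>

definition cell_trace :: "point set \<Rightarrow> (point \<Rightarrow> 'b::real_normed_vector) \<Rightarrow> point \<Rightarrow> 'b" where
  "cell_trace K f x = Lim (at x within interior K) f"

fun tr_plus :: "facet \<Rightarrow> (point \<Rightarrow> 'b::real_normed_vector) \<Rightarrow> point \<Rightarrow> 'b" where
  "tr_plus (K, L, p) f x = cell_trace K f x"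

fun tr_minus :: "facet \<Rightarrow> (point \<Rightarrow> 'b::real_normed_vector) \<Rightarrow> point \<Rightarrow> 'b" where
  "tr_minus (K, L, p) f x = cell_trace ((+) p ` L) f x"

text \<open>\<open>jump\<close> is \<open>[[.]]\<close> for scalars and \<open>[[.]]'\<close> for vector fields.\<close>

definition jump :: "facet \<Rightarrow> (point \<Rightarrow> 'b::real_normed_vector) \<Rightarrow> point \<Rightarrow> 'b" where
  "jump e f x = tr_plus e f x - tr_minus e f x"

definition avg :: "facet \<Rightarrow> sfield \<Rightarrow> sfield" where
  "avg e f x = (tr_plus e f x + tr_minus e f x) / 2"

definition navg :: "facet \<Rightarrow> vfield \<Rightarrow> sfield" where
  "navg e u x = (tr_plus e u x \<bullet> n_plus e x - tr_minus e u x \<bullet> n_minus e x) / 2"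

text \<open>\<open>{{n \<times> a}}\<close>, where the argument \<open>n \<times> a\<close> has the one-sided values
  \<open>n\<^sup>+ \<times> a\<^sup>+\<close> and \<open>n\<^sup>- \<times> a\<^sup>-\<close>.\<close>

definition cross_avg_ncross :: "facet \<Rightarrow> vfield \<Rightarrow> vfield" where
  "cross_avg_ncross e a x =
     (n_plus e x \<times>\<^sub>v tr_plus e a x) \<times>\<^sub>v n_plus e x + (n_minus e x \<times>\<^sub>v tr_minus e a x) \<times>\<^sub>v n_minus e x"

definition upwind :: "facet \<Rightarrow> vfield \<Rightarrow> vfield" where
  "upwind e u x = (if tr_plus e u x \<bullet> n_plus e x < 0 then tr_plus e u x else tr_minus e u x)"

definition facet_area :: "facet \<Rightarrow> real" where
  "facet_area e = measure surf (fset e)"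

definition int_facets :: "mesh \<Rightarrow> (facet \<Rightarrow> sfield) \<Rightarrow> real" where
  "int_facets M g = (\<Sum>e\<in>Facets M. LINT x:fset e|surf. g e x)"

text \<open>Integral over a part \<open>S\<close> of \<open>\<partial>\<Omega>\<close>; the integrand may use the cell \<open>K\<close> adjacent to the
  boundary point, in order to take traces.\<close>

definition int_bdry :: "mesh \<Rightarrow> point set \<Rightarrow> (point set \<Rightarrow> sfield) \<Rightarrow> real" where
  "int_bdry M S g = (\<Sum>K\<in>Cells M. LINT x:(K \<inter> S)|surf. g K x)"

definition bdry_integrable :: "mesh \<Rightarrow> point set \<Rightarrow> (point \<Rightarrow> 'b::{banach, second_countable_topology}) \<Rightarrow> bool" where
  "bdry_integrable M S g \<longleftrightarrow> (\<forall>K\<in>Cells M. set_integrable surf (K \<inter> S) g)"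


section \<open>Sobolev spaces\<close>

definition periodic :: "mesh \<Rightarrow> (point \<Rightarrow> 'b) \<Rightarrow> bool" where
  "periodic M f \<longleftrightarrow> (\<forall>p\<in>Per M. \<forall>x. f (x + p) = f x)"

definition L2 :: "mesh \<Rightarrow> (point \<Rightarrow> 'b::euclidean_space) set" where
  "L2 M = {f. periodic M f \<and> set_borel_measurable lebesgue (omega M) f \<and>
              set_integrable lebesgue (omega M) (\<lambda>x. (norm (f x))\<^sup>2)}"

definition H1 :: "mesh \<Rightarrow> sfield set" where
  "H1 M = {f \<in> L2 M. \<exists>g\<in>L2 M. \<forall>\<phi>::vfield. test_function (Dom M) \<phi> \<longrightarrow>
     (LINT x:Dom M|lebesgue. f x * dvg \<phi> x) = - (LINT x:Dom M|lebesgue. g x \<bullet> \<phi> x)}"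

definition Hcurl :: "mesh \<Rightarrow> vfield set" where
  "Hcurl M = {u \<in> L2 M. \<exists>g\<in>L2 M. \<forall>\<phi>::vfield. test_function (Dom M) \<phi> \<longrightarrow>
     (LINT x:Dom M|lebesgue. u x \<bullet> curl \<phi> x) = (LINT x:Dom M|lebesgue. g x \<bullet> \<phi> x)}"

definition Hdiv :: "mesh \<Rightarrow> vfield set" where
  "Hdiv M = {u \<in> L2 M. \<exists>g\<in>L2 M. \<forall>\<phi>::sfield. test_function (Dom M) \<phi> \<longrightarrow>
     (LINT x:Dom M|lebesgue. u x \<bullet> grad \<phi> x) = - (LINT x:Dom M|lebesgue. g x * \<phi> x)}"


section \<open>Finite element spaces\<close>

definition pw_smooth :: "mesh \<Rightarrow> (point \<Rightarrow> 'b::real_normed_vector) \<Rightarrow> bool" where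
  "pw_smooth M f \<longleftrightarrow> (\<forall>K\<in>Cells M. \<exists>g. smooth g \<and> (\<forall>x\<in>interior K. f x = g x))"

definition fe_space :: "mesh \<Rightarrow> (point \<Rightarrow> 'b::real_normed_vector) set \<Rightarrow> bool" where
  "fe_space M W \<longleftrightarrow>
     (\<exists>S. finite S \<and> (\<forall>b\<in>S. periodic M b \<and> pw_smooth M b) \<and>
          W = range (\<lambda>c. \<lambda>x. \<Sum>b\<in>S. c b *\<^sub>R b x))"

record spaces =
  V0 :: "sfield set"
  V1 :: "vfield set"
  V2 :: "vfield set"
  V3 :: "sfield set"

text \<open>That the constants belong to \<open>V0\<close> is part of what is meant by a finite element subspace
  of \<open>H1\<close> without essential boundary conditions.\<close>

definition de_rham_spaces :: "mesh \<Rightarrow> spaces \<Rightarrow> bool" where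
  "de_rham_spaces M S \<longleftrightarrow>
     fe_space M (V0 S) \<and> fe_space M (V1 S) \<and> fe_space M (V2 S) \<and> fe_space M (V3 S) \<and>
     V0 S \<subseteq> H1 M \<and> V1 S \<subseteq> Hcurl M \<and> V2 S \<subseteq> Hdiv M \<and> V3 S \<subseteq> L2 M \<and>
     (\<lambda>_. 1) \<in> V0 S \<and>
     (\<forall>\<theta>\<in>V0 S. \<exists>a\<in>V1 S. agree M a (grad \<theta>)) \<and>
     (\<forall>a\<in>V1 S. \<exists>w\<in>V2 S. agree M w (curl a)) \<and>
     (\<forall>w\<in>V2 S. \<exists>\<rho>\<in>V3 S. agree M \<rho> (dvg w))"

definition V2o :: "mesh \<Rightarrow> spaces \<Rightarrow> vfield set" where
  "V2o M S = {w \<in> V2 S. \<forall>K\<in>Cells M. AE x in surf.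
                x \<in> K \<inter> bdry M \<longrightarrow> cell_trace K w x \<bullet> normal K x = 0}"

definition is_L2_projection ::
  "mesh \<Rightarrow> (point \<Rightarrow> 'b::real_inner) set \<Rightarrow> (point \<Rightarrow> 'b) \<Rightarrow> (point \<Rightarrow> 'b) \<Rightarrow> bool" where
  "is_L2_projection M W f g \<longleftrightarrow> g \<in> W \<and> (\<forall>w\<in>W. ip M w g = ip M w f)"

text \<open>\<open>u\<close> is a differentiable curve in the finite-dimensional space \<open>W\<close> (differentiable degrees
  of freedom) with time derivative \<open>u'\<close>.\<close>

definition fe_curve ::
  "real set \<Rightarrow> (point \<Rightarrow> 'b::real_normed_vector) set \<Rightarrow>
     (real \<Rightarrow> point \<Rightarrow> 'b) \<Rightarrow> (real \<Rightarrow> point \<Rightarrow> 'b) \<Rightarrow> bool" where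
  "fe_curve I W u u' \<longleftrightarrow>
     (\<exists>S c c'. finite S \<and> S \<subseteq> W \<and>
        (\<forall>b\<in>S. \<forall>t\<in>I. (c b has_real_derivative c' b t) (at t within I)) \<and>
        (\<forall>t\<in>I. u t = (\<lambda>x. \<Sum>b\<in>S. c b t *\<^sub>R b x) \<and> u' t = (\<lambda>x. \<Sum>b\<in>S. c' b t *\<^sub>R b x)))"


section \<open>The hydrodynamic equations\<close>

definition adiabatic_index :: real where
  "adiabatic_index = 5 / 3"

record params =
  ion_mass :: real
  vac_perm :: real
  kappa_T :: real
  kappa_B :: real
  supg_lambda :: real
  time_step :: real
  cell_size :: "point set \<Rightarrow> real"

definition valid_params :: "mesh \<Rightarrow> params \<Rightarrow> bool" where
  "valid_params M p \<longleftrightarrow> 0 < ion_mass p \<and> 0 < vac_perm p \<and> 0 < time_step p \<and>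
     (\<forall>K\<in>Cells M. 0 < cell_size p K)"

text \<open>\<open>BL\<close> is the field \<open>B\<^sub>L\<close> in the Lorentz force and \<open>Q\<close> the heating functional; primes
  denote time derivatives.\<close>

definition density_eq :: "mesh \<Rightarrow> sfield \<Rightarrow> vfield \<Rightarrow> bool" where
  "density_eq M n' F \<longleftrightarrow> agree M (\<lambda>x. n' x + dvg F x) (\<lambda>_. 0)"

definition flux_eq :: "mesh \<Rightarrow> spaces \<Rightarrow> sfield \<Rightarrow> vfield \<Rightarrow> vfield \<Rightarrow> bool" where
  "flux_eq M S n V F \<longleftrightarrow>
     F \<in> V2o M S \<and> (\<forall>w\<in>V2o M S. ip M w (\<lambda>x. F x - n x *\<^sub>R V x) = 0)"

definition momentum_eq ::
  "mesh \<Rightarrow> spaces \<Rightarrow> params \<Rightarrow> sfield \<Rightarrow> vfield \<Rightarrow> vfield \<Rightarrow> sfield \<Rightarrow> vfield \<Rightarrow> vfield \<Rightarrow> vfield \<Rightarrow> bool"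
where
  "momentum_eq M S p n V V' T F j BL \<longleftrightarrow>
     (\<forall>w\<in>V2o M S.
        ip M w V'
      + ip M (curl (\<lambda>x. w x \<times>\<^sub>v (F x /\<^sub>R n x))) V
      - int_facets M (\<lambda>e x. cross_avg_ncross e (\<lambda>x. w x \<times>\<^sub>v (F x /\<^sub>R n x)) x \<bullet> upwind e V x)
      - ip M (\<lambda>x. (norm (V x))\<^sup>2 / 2) (dvg w)
      + ip M j (\<lambda>x. (w x /\<^sub>R (ion_mass p * n x)) \<times>\<^sub>v BL x)
      + ip M (\<lambda>x. w x /\<^sub>R (ion_mass p * n x)) (grad (\<lambda>x. n x * T x))
      - int_facets M (\<lambda>e x. jump e (\<lambda>x. n x * T x) x * navg e (\<lambda>x. w x /\<^sub>R (ion_mass p * n x)) x)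
      = 0)"

definition temperature_eq ::
  "mesh \<Rightarrow> spaces \<Rightarrow> params \<Rightarrow> sfield \<Rightarrow> sfield \<Rightarrow> sfield \<Rightarrow> vfield \<Rightarrow> (sfield \<Rightarrow> real) \<Rightarrow> bool"
where
  "temperature_eq M S p n T T' F Q \<longleftrightarrow>
     (\<forall>\<theta>\<in>V0 S.
        ip M (\<lambda>x. n x * \<theta> x / (adiabatic_index - 1)) T'
      + ip M (\<lambda>x. (\<theta> x / (adiabatic_index - 1)) *\<^sub>R F x) (grad T)
      + int_facets M (\<lambda>e x. (facet_area e)\<^sup>2 * kappa_T p / ((adiabatic_index - 1) * avg e n x)
            * jump e (\<lambda>x. F x \<bullet> grad \<theta> x) x * jump e (\<lambda>x. F x \<bullet> grad T x) x)
      - ip M (\<lambda>x. F x /\<^sub>R n x) (grad (\<lambda>x. \<theta> x * n x * T x))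
      + int_facets M (\<lambda>e x. jump e (\<lambda>x. \<theta> x * n x * T x) x * navg e (\<lambda>x. F x /\<^sub>R n x) x)
      = Q \<theta>)"


section \<open>Stabilization of the magnetic field transport\<close>

text \<open>\<open>HelicityNeutral\<close> is the helicity-neutral penalty with \<open>\<B> = B\<close>. The other two are its
  helicity preserving variant \<open>\<B> = P\<^bsub>V1\<^esub> B\<close> (div-conforming only), with \<open>B\<^sub>L = B\<close> and with
  \<open>B\<^sub>L = \<B>\<close>, respectively. With \<open>B\<^sub>L = B \<noteq> \<B>\<close> the Lorentz work does not balance the magnetic energy.\<close>

datatype stabilization =
  SUPG | SubgridResistivity | HelicityNeutral | HelicityPreserving | HelicityPreservingL

definition projected :: "stabilization \<Rightarrow> bool" where
  "projected st \<longleftrightarrow> st = HelicityPreserving \<or> st = HelicityPreservingL"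

definition local_cell_size :: "mesh \<Rightarrow> params \<Rightarrow> sfield" where
  "local_cell_size M p x =
     cell_size p (THE K. K \<in> Cells M \<and> (\<exists>q\<in>Per M. x \<in> interior ((+) q ` K)))"

definition supg_tau :: "mesh \<Rightarrow> params \<Rightarrow> vfield \<Rightarrow> sfield" where
  "supg_tau M p V x =
     sqrt ((2 * supg_lambda p / time_step p)\<^sup>2 + (2 * norm (V x) / local_cell_size M p x)\<^sup>2)"

definition B_residual :: "sfield \<Rightarrow> vfield \<Rightarrow> vfield \<Rightarrow> vfield \<Rightarrow> vfield" where
  "B_residual n F B B' x = B' x + curl (\<lambda>y. B y \<times>\<^sub>v (F y /\<^sub>R n y)) x"

definition supg_field ::
  "mesh \<Rightarrow> params \<Rightarrow> sfield \<Rightarrow> vfield \<Rightarrow> vfield \<Rightarrow> vfield \<Rightarrow> vfield \<Rightarrow> vfield" where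
  "supg_field M p n V F B B' x = B x - supg_tau M p V x *\<^sub>R B_residual n F B B' x"

definition penalty_field_eq ::
  "mesh \<Rightarrow> spaces \<Rightarrow> stabilization \<Rightarrow> vfield \<Rightarrow> vfield \<Rightarrow> bool" where
  "penalty_field_eq M S st B Bc \<longleftrightarrow>
     (if projected st then is_L2_projection M (V1 S) B Bc else Bc = B)"

definition lorentz_field ::
  "mesh \<Rightarrow> params \<Rightarrow> stabilization \<Rightarrow> sfield \<Rightarrow> vfield \<Rightarrow> vfield \<Rightarrow> vfield \<Rightarrow> vfield \<Rightarrow> vfield \<Rightarrow> vfield"
where
  "lorentz_field M p st n V F B B' Bc =
     (case st of
        SUPG \<Rightarrow> supg_field M p n V F B B'
      | SubgridResistivity \<Rightarrow> B
      | HelicityNeutral \<Rightarrow> B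
      | HelicityPreserving \<Rightarrow> B
      | HelicityPreservingL \<Rightarrow> Bc)"

text \<open>The electric field in \<open>W = V1\<close> (div-conforming \<open>B\<close>) or \<open>W = V2\<close> (curl-conforming \<open>B\<close>).\<close>

definition subgrid_E ::
  "mesh \<Rightarrow> params \<Rightarrow> vfield set \<Rightarrow> sfield \<Rightarrow> vfield \<Rightarrow> vfield \<Rightarrow> vfield \<Rightarrow> vfield \<Rightarrow> bool" where
  "subgrid_E M p W n F B j E \<longleftrightarrow>
     E \<in> W \<and>
     (\<forall>\<omega>\<in>W. ip M \<omega> E = ip M \<omega> (\<lambda>x. (- (F x /\<^sub>R n x)) \<times>\<^sub>v B x)
        + int_facets M (\<lambda>e x. (facet_area e)\<^sup>2 * kappa_B p * (jump e \<omega> x \<bullet> jump e j x)))"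

definition helicity_E ::
  "mesh \<Rightarrow> params \<Rightarrow> vfield set \<Rightarrow> sfield \<Rightarrow> vfield \<Rightarrow> vfield \<Rightarrow> vfield \<Rightarrow> vfield \<Rightarrow> bool" where
  "helicity_E M p W n F Bc j E \<longleftrightarrow>
     E \<in> W \<and>
     (\<forall>\<omega>\<in>W. ip M \<omega> E = ip M \<omega> (\<lambda>x. (- (F x /\<^sub>R n x)) \<times>\<^sub>v Bc x)
        + int_facets M (\<lambda>e x. (facet_area e)\<^sup>2 * kappa_B p *
            (jump e (\<lambda>y. Bc y \<times>\<^sub>v \<omega> y) x \<bullet> jump e (\<lambda>y. Bc y \<times>\<^sub>v j y) x)))"

definition electric_eq ::
  "mesh \<Rightarrow> params \<Rightarrow> vfield set \<Rightarrow> stabilization \<Rightarrow> sfield \<Rightarrow> vfield \<Rightarrow> vfield \<Rightarrow> vfield \<Rightarrow> vfield \<Rightarrow>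
     vfield \<Rightarrow> vfield \<Rightarrow> vfield \<Rightarrow> bool" where
  "electric_eq M p W st n V F B B' Bc j E \<longleftrightarrow>
     (case st of
        SUPG \<Rightarrow> is_L2_projection M W (\<lambda>x. (- (F x /\<^sub>R n x)) \<times>\<^sub>v supg_field M p n V F B B' x) E
      | SubgridResistivity \<Rightarrow> subgrid_E M p W n F B j E
      | HelicityNeutral \<Rightarrow> helicity_E M p W n F Bc j E
      | HelicityPreserving \<Rightarrow> helicity_E M p W n F Bc j E
      | HelicityPreservingL \<Rightarrow> helicity_E M p W n F Bc j E)"

definition subgrid_heating :: "mesh \<Rightarrow> params \<Rightarrow> vfield \<Rightarrow> sfield \<Rightarrow> real" where
  "subgrid_heating M p j \<theta> =
     int_facets M (\<lambda>e x. avg e \<theta> x * (facet_area e)\<^sup>2 * kappa_B p * (norm (jump e j x))\<^sup>2)"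

definition helicity_heating :: "mesh \<Rightarrow> params \<Rightarrow> vfield \<Rightarrow> vfield \<Rightarrow> sfield \<Rightarrow> real" where
  "helicity_heating M p Bc j \<theta> =
     int_facets M (\<lambda>e x. avg e \<theta> x * (facet_area e)\<^sup>2 * kappa_B p *
       (norm (jump e (\<lambda>y. Bc y \<times>\<^sub>v j y) x))\<^sup>2)"

definition heating :: "mesh \<Rightarrow> params \<Rightarrow> stabilization \<Rightarrow> vfield \<Rightarrow> vfield \<Rightarrow> sfield \<Rightarrow> real" where
  "heating M p st Bc j =
     (case st of
        SUPG \<Rightarrow> (\<lambda>_. 0)
      | SubgridResistivity \<Rightarrow> subgrid_heating M p j
      | HelicityNeutral \<Rightarrow> helicity_heating M p Bc j
      | HelicityPreserving \<Rightarrow> helicity_heating M p Bc j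
      | HelicityPreservingL \<Rightarrow> helicity_heating M p Bc j)"


section \<open>The stabilized MHD systems\<close>

text \<open>Time-dependent unknowns; \<open>nt\<close> is the time derivative of \<open>n\<close> and so on, \<open>s_Bc\<close> is \<open>\<B>\<close>.\<close>

record mhd =
  s_n :: "real \<Rightarrow> sfield"
  s_nt :: "real \<Rightarrow> sfield"
  s_V :: "real \<Rightarrow> vfield"
  s_Vt :: "real \<Rightarrow> vfield"
  s_T :: "real \<Rightarrow> sfield"
  s_Tt :: "real \<Rightarrow> sfield"
  s_B :: "real \<Rightarrow> vfield"
  s_Bt :: "real \<Rightarrow> vfield"
  s_F :: "real \<Rightarrow> vfield"
  s_E :: "real \<Rightarrow> vfield"
  s_j :: "real \<Rightarrow> vfield"
  s_Bc :: "real \<Rightarrow> vfield"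

definition hydro_system ::
  "mesh \<Rightarrow> spaces \<Rightarrow> params \<Rightarrow> stabilization \<Rightarrow> real set \<Rightarrow> mhd \<Rightarrow> bool" where
  "hydro_system M S p st I s \<longleftrightarrow>
     fe_curve I (V3 S) (s_n s) (s_nt s) \<and> fe_curve I (V2o M S) (s_V s) (s_Vt s) \<and>
     fe_curve I (V0 S) (s_T s) (s_Tt s) \<and>
     (\<forall>t\<in>I.
        (\<exists>c>0. \<forall>x\<in>omega M. c \<le> s_n s t x) \<and>
        density_eq M (s_nt s t) (s_F s t) \<and>
        flux_eq M S (s_n s t) (s_V s t) (s_F s t) \<and>
        momentum_eq M S p (s_n s t) (s_V s t) (s_Vt s t) (s_T s t) (s_F s t) (s_j s t)
          (lorentz_field M p st (s_n s t) (s_V s t) (s_F s t) (s_B s t) (s_Bt s t) (s_Bc s t)) \<and>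
        temperature_eq M S p (s_n s t) (s_T s t) (s_Tt s t) (s_F s t)
          (heating M p st (s_Bc s t) (s_j s t)))"

text \<open>Strongly imposed data on \<open>\<partial>\<Omega>\<^sub>1\<close> for div-conforming \<open>B\<close>: either \<open>B \<bullet> n = g\<^sub>1\<close> or
  \<open>E \<times> n = e\<^sub>1\<close>.\<close>

datatype strong_bc = Normal_B "real \<Rightarrow> sfield" | Tangential_E "real \<Rightarrow> vfield"

definition strong_bc_holds :: "mesh \<Rightarrow> point set \<Rightarrow> real set \<Rightarrow> strong_bc \<Rightarrow> mhd \<Rightarrow> bool" where
  "strong_bc_holds M b1 I bc s \<longleftrightarrow>
     (\<forall>t\<in>I. \<forall>K\<in>Cells M. AE x in surf. x \<in> K \<inter> b1 \<longrightarrow>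
        (case bc of
           Normal_B g1 \<Rightarrow> cell_trace K (s_B s t) x \<bullet> normal K x = g1 t x
         | Tangential_E e1 \<Rightarrow> cell_trace K (s_E s t) x \<times>\<^sub>v normal K x = e1 t x))"

definition homogeneous_bc :: "mesh \<Rightarrow> real set \<Rightarrow> strong_bc \<Rightarrow> bool" where
  "homogeneous_bc M I bc \<longleftrightarrow>
     (\<forall>t\<in>I. \<forall>x\<in>bdry M.
        (case bc of Normal_B g1 \<Rightarrow> g1 t x = 0 | Tangential_E e1 \<Rightarrow> e1 t x = 0))"

definition mhd_div_conforming ::
  "mesh \<Rightarrow> spaces \<Rightarrow> params \<Rightarrow> stabilization \<Rightarrow> real set \<Rightarrow> point set \<Rightarrow> point set \<Rightarrow>
     strong_bc \<Rightarrow> (real \<Rightarrow> vfield) \<Rightarrow> mhd \<Rightarrow> bool" where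
  "mhd_div_conforming M S p st I b1 b2 bc g2 s \<longleftrightarrow>
     hydro_system M S p st I s \<and>
     fe_curve I (V2 S) (s_B s) (s_Bt s) \<and>
     strong_bc_holds M b1 I bc s \<and>
     (projected st \<longrightarrow> b1 = bdry M \<and> b2 = {} \<and> homogeneous_bc M I bc) \<and>
     (\<forall>t\<in>I.
        penalty_field_eq M S st (s_B s t) (s_Bc s t) \<and>
        electric_eq M p (V1 S) st (s_n s t) (s_V s t) (s_F s t) (s_B s t) (s_Bt s t) (s_Bc s t)
          (s_j s t) (s_E s t) \<and>
        agree M (\<lambda>x. s_Bt s t x + curl (s_E s t) x) (\<lambda>_. 0) \<and>
        bdry_integrable M b2 (g2 t) \<and>
        s_j s t \<in> V1 S \<and>
        (\<forall>\<sigma>\<in>V1 S. ip M \<sigma> (s_j s t) = ip M (curl \<sigma>) (\<lambda>x. s_B s t x /\<^sub>R vac_perm p)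
           + int_bdry M b2 (\<lambda>K x. g2 t x \<bullet> cell_trace K \<sigma> x)))"

text \<open>The signs of the boundary terms in the weak forms correspond to \<open>g\<^sub>2 = n \<times> H\<close> and
  \<open>h\<^sub>1 = n \<times> E\<close>.\<close>

definition mhd_curl_conforming ::
  "mesh \<Rightarrow> spaces \<Rightarrow> params \<Rightarrow> stabilization \<Rightarrow> real set \<Rightarrow> point set \<Rightarrow> point set \<Rightarrow>
     (real \<Rightarrow> vfield) \<Rightarrow> (real \<Rightarrow> vfield) \<Rightarrow> mhd \<Rightarrow> bool" where
  "mhd_curl_conforming M S p st I b1 b2 h1 g2 s \<longleftrightarrow>
     \<not> projected st \<and>
     hydro_system M S p st I s \<and>
     fe_curve I (V1 S) (s_B s) (s_Bt s) \<and>
     (\<forall>t\<in>I.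
        penalty_field_eq M S st (s_B s t) (s_Bc s t) \<and>
        electric_eq M p (V2 S) st (s_n s t) (s_V s t) (s_F s t) (s_B s t) (s_Bt s t) (s_Bc s t)
          (s_j s t) (s_E s t) \<and>
        s_j s t \<in> V2 S \<and> agree M (s_j s t) (\<lambda>x. curl (s_B s t) x /\<^sub>R vac_perm p) \<and>
        bdry_integrable M b1 (h1 t) \<and>
        (\<forall>\<sigma>\<in>V1 S. ip M \<sigma> (s_Bt s t) + ip M (curl \<sigma>) (s_E s t)
           + int_bdry M b1 (\<lambda>K x. cell_trace K \<sigma> x \<bullet> h1 t x) = 0) \<and>
        (\<forall>K\<in>Cells M. AE x in surf. x \<in> K \<inter> b2 \<longrightarrow>
           normal K x \<times>\<^sub>v (cell_trace K (s_B s t) x /\<^sub>R vac_perm p) = g2 t x))"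


section \<open>Energy and divergence\<close>

definition energy_density :: "params \<Rightarrow> sfield \<Rightarrow> vfield \<Rightarrow> sfield \<Rightarrow> vfield \<Rightarrow> sfield" where
  "energy_density p n V T B x =
     ion_mass p * n x * (norm (V x))\<^sup>2 / 2 + n x * T x / (adiabatic_index - 1)
     + (norm (B x))\<^sup>2 / (2 * vac_perm p)"

definition total_energy :: "mesh \<Rightarrow> params \<Rightarrow> sfield \<Rightarrow> vfield \<Rightarrow> sfield \<Rightarrow> vfield \<Rightarrow> real" where
  "total_energy M p n V T B = (LINT x:omega M|lebesgue. energy_density p n V T B x)"

definition magnetic_energy :: "mesh \<Rightarrow> params \<Rightarrow> vfield \<Rightarrow> real" where
  "magnetic_energy M p B = (LINT x:omega M|lebesgue. (norm (B x))\<^sup>2 / (2 * vac_perm p))"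

definition weak_divergence :: "mesh \<Rightarrow> spaces \<Rightarrow> vfield \<Rightarrow> sfield \<Rightarrow> sfield \<Rightarrow> bool" where
  "weak_divergence M S B g1 \<delta> \<longleftrightarrow>
     \<delta> \<in> V0 S \<and>
     (\<forall>\<theta>\<in>V0 S. ip M \<theta> \<delta> = - ip M (grad \<theta>) B + int_bdry M (bdry M) (\<lambda>K x. cell_trace K \<theta> x * g1 x))"

text \<open>\<open>d\<close> is the (weak) surface divergence of the tangential field \<open>h\<close> on the closed surface
  \<open>\<partial>\<Omega>\<close>, i.e. minus the adjoint of the surface gradient. As \<open>h\<close> is tangential, the full gradient
  of the test function may be used. \<open>\<partial>\<Omega>\<close> is only piecewise smooth, so jumps of the co-normal
  component of \<open>h\<close> across its edges are excluded by this definition, as they have to be for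
  \<open>d\<close> to be a function.\<close>

definition surface_divergence :: "mesh \<Rightarrow> vfield \<Rightarrow> sfield \<Rightarrow> bool" where
  "surface_divergence M h d \<longleftrightarrow>
     bdry_integrable M (bdry M) h \<and> bdry_integrable M (bdry M) d \<and>
     (\<forall>K\<in>Cells M. AE x in surf. x \<in> K \<inter> bdry M \<longrightarrow> h x \<bullet> normal K x = 0) \<and>
     (\<forall>\<phi>\<in>H1 M. pw_smooth M \<phi> \<longrightarrow>
        int_bdry M (bdry M) (\<lambda>K x. cell_trace K \<phi> x * d x) =
        - int_bdry M (bdry M) (\<lambda>K x. cell_trace K (grad \<phi>) x \<bullet> h x))"

text \<open>The boundary datum \<open>g\<^sub>1\<close> has a bounded time derivative \<open>g\<^sub>1'\<close>, equal to the surface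
  divergence of \<open>h\<^sub>1\<close>.\<close>

definition compatible_g1 ::
  "mesh \<Rightarrow> real set \<Rightarrow> (real \<Rightarrow> sfield) \<Rightarrow> (real \<Rightarrow> vfield) \<Rightarrow> bool" where
  "compatible_g1 M I g1 h1 \<longleftrightarrow>
     (\<exists>g1'. (\<forall>t\<in>I. \<forall>x\<in>bdry M. ((\<lambda>s. g1 s x) has_real_derivative g1' t x) (at t within I)) \<and>
        (\<exists>C. \<forall>t\<in>I. \<forall>x\<in>bdry M. \<bar>g1' t x\<bar> \<le> C) \<and>
        (\<forall>t\<in>I. bdry_integrable M (bdry M) (g1 t)) \<and>
        (\<forall>t\<in>I. surface_divergence M (h1 t) (g1' t)))"

end

theory Submission
  imports Defs
begin

text \<open>
  The energy identities are obtained by testing the discrete equations with the unknowns. The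
  magnetic energy changes by minus the work of the electric field on the current, plus a boundary
  term (\<open>magnetic_power_div\<close>, \<open>magnetic_power_curl\<close>). The equation of the electric field, tested with the
  current, expresses this work through the Lorentz force and a quadratic stabilization term
  (\<open>electric_work\<close>); the SUPG method has no such term, but modifies the field in the Lorentz force in
  the same way as in the electric field. The momentum equation tested with the mass flux \<open>F\<close> and the
  temperature equation tested with \<open>1\<close> show that the remaining energy changes by the heating minus the
  Lorentz work (\<open>hydro_power\<close>). The heating is the stabilization term, so that everything cancels. Parts (i)
  and (iii) are read off from these balances.

  One step is analytic: the balance of the internal energy needs \<open>\<langle>T, div F\<rangle> + \<langle>grad T, F\<rangle> = 0\<close>
  (\<open>int_Dom_by_parts\<close>), although the spaces only satisfy \<open>T \<in> H1\<close> and \<open>F \<in> Hdiv\<close> in the sense of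
  distributions. With Gauss-Green on every cell this reduces to the cancellation of the traces on the two
  sides of each facet. For a piecewise smooth field in \<open>Hdiv\<close>, smooth test functions that tend to the
  indicator of a box show that the sum of the normal traces, as a signed measure on the skeleton of the
  mesh, has a density with respect to the Lebesgue measure (\<open>skeleton_flux_box\<close>). Facets are Lebesgue null
  sets, so the two normal traces cancel almost everywhere (\<open>normal_jump\<close>). A function \<open>T\<close> in \<open>H1\<close> is covered by
  the fields \<open>T e\<^sub>i\<close>. On periodic domains the argument runs over translates of cells and uses the translation
  invariance of the Hausdorff measure.

  For part (ii), \<open>div curl = 0\<close> settles the div-conforming case in the interior of each cell. In the
  curl-conforming case \<open>curl grad = 0\<close> leaves a boundary term, which the compatibility of \<open>g\<^sub>1\<close> with \<open>h\<^sub>1\<close>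
  removes (\<open>divergence_curl\<close>).
\<close>

section \<open>Calculus of partial derivatives\<close>

lemma partial_eqI: "(f has_derivative D) (at x) \<Longrightarrow> partial i f x = D (axis i 1)"
  unfolding partial_def by (metis frechet_derivative_at)

lemma partial_cong_open:
  assumes "open A" "x \<in> A" "\<And>y. y \<in> A \<Longrightarrow> f y = g y"
  shows "partial i f x = partial i g x"
proof -
  have "(f has_derivative D) (at x) \<longleftrightarrow> (g has_derivative D) (at x)" for D
    using has_derivative_transform_within_open[of f D x UNIV A g]
      has_derivative_transform_within_open[of g D x UNIV A f] assms by auto
  then show ?thesis unfolding partial_def frechet_derivative_def by simp
qed

lemma differentiable_cong_open:
  assumes "open A" "x \<in> A" "\<And>y. y \<in> A \<Longrightarrow> f y = g y"
  shows "f differentiable (at x) \<longleftrightarrow> g differentiable (at x)"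
proof -
  have "(f has_derivative D) (at x) \<longleftrightarrow> (g has_derivative D) (at x)" for D
    using has_derivative_transform_within_open[of f D x UNIV A g]
      has_derivative_transform_within_open[of g D x UNIV A f] assms by auto
  then show ?thesis unfolding differentiable_def by simp
qed

lemma partial_const [simp]: "partial i (\<lambda>_. c) x = 0"
  by (simp add: partial_def)

lemma partial_bounded_linear:
  assumes "bounded_linear L" "f differentiable (at x)"
  shows "partial i (\<lambda>y. L (f y)) x = L (partial i f x)"
proof -
  obtain D where D: "(f has_derivative D) (at x)" using assms by (auto simp: differentiable_def)
  show ?thesis
    using partial_eqI[OF bounded_linear.has_derivative[OF assms(1) D]] partial_eqI[OF D] by simp
qed

lemma partial_nth:
  fixes u :: "point \<Rightarrow> real^'n"
  shows "u differentiable (at x) \<Longrightarrow> partial i (\<lambda>y. u y $ k) x = partial i u x $ k"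
  by (rule partial_bounded_linear) (rule bounded_linear_vec_nth)

lemma partial_add:
  assumes "f differentiable (at x)" "g differentiable (at x)"
  shows "partial i (\<lambda>y. f y + g y) x = partial i f x + partial i g x"
proof -
  obtain D E where D: "(f has_derivative D) (at x)" and E: "(g has_derivative E) (at x)"
    using assms by (auto simp: differentiable_def)
  show ?thesis
    using partial_eqI[OF has_derivative_add[OF D E]] partial_eqI[OF D] partial_eqI[OF E] by simp
qed

lemma partial_diff:
  assumes "f differentiable (at x)" "g differentiable (at x)"
  shows "partial i (\<lambda>y. f y - g y) x = partial i f x - partial i g x"
proof -
  obtain D E where D: "(f has_derivative D) (at x)" and E: "(g has_derivative E) (at x)"
    using assms by (auto simp: differentiable_def)
  show ?thesis
    using partial_eqI[OF has_derivative_diff[OF D E]] partial_eqI[OF D] partial_eqI[OF E] by simp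
qed

lemma partial_cmult:
  assumes "f differentiable (at x)"
  shows "partial i (\<lambda>y. c *\<^sub>R f y) x = c *\<^sub>R partial i f x"
  by (rule partial_bounded_linear[OF bounded_linear_scaleR_right assms])

lemma partial_scaleR:
  fixes f :: "point \<Rightarrow> real"
  assumes "f differentiable (at x)" "g differentiable (at x)"
  shows "partial i (\<lambda>y. f y *\<^sub>R g y) x = f x *\<^sub>R partial i g x + partial i f x *\<^sub>R g x"
proof -
  obtain D E where D: "(f has_derivative D) (at x)" and E: "(g has_derivative E) (at x)"
    using assms by (auto simp: differentiable_def)
  show ?thesis
    using partial_eqI[OF has_derivative_scaleR[OF D E]] partial_eqI[OF D] partial_eqI[OF E] by simp
qed

lemma partial_sum:
  assumes "\<And>b. b \<in> S \<Longrightarrow> f b differentiable (at x)"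
  shows "partial i (\<lambda>y. \<Sum>b\<in>S. f b y) x = (\<Sum>b\<in>S. partial i (f b) x)"
proof -
  have "((\<lambda>y. \<Sum>b\<in>S. f b y) has_derivative (\<lambda>h. \<Sum>b\<in>S. frechet_derivative (f b) (at x) h)) (at x)"
    by (rule has_derivative_sum) (use assms frechet_derivative_works in blast)
  from partial_eqI[OF this] show ?thesis by (simp add: partial_def)
qed

lemma partial_shift:
  fixes f :: "point \<Rightarrow> 'b::real_normed_vector"
  shows "partial i (\<lambda>y. f (y + p)) x = partial i f (x + p)"
proof -
  have shift: "((\<lambda>y. f (y + p)) has_derivative D) (at x)" if "(f has_derivative D) (at (x + p))"
    for f :: "point \<Rightarrow> 'b" and D x p
  proof -
    have "((\<lambda>y. y + p) has_derivative (\<lambda>h. h)) (at x)" by (auto intro!: derivative_eq_intros)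
    from has_derivative_compose[OF this, of f] that show ?thesis by simp
  qed
  have "((\<lambda>y. f (y + p)) has_derivative D) (at x) \<longleftrightarrow> (f has_derivative D) (at (x + p))" for D
    using shift[of f D x p] shift[of "\<lambda>y. f (y + p)" D "x + p" "- p"] by auto
  then show ?thesis unfolding partial_def frechet_derivative_def by simp
qed

text \<open>As a simplification rule the recursive equation of \<open>Ck\<close> makes the rules below loop, whose premises
  have the form of their conclusions.\<close>

declare Ck.simps(2) [simp del]

lemma Ck_SucI:
  "(\<And>x. f differentiable (at x)) \<Longrightarrow> (\<And>i. Ck k (partial i f)) \<Longrightarrow> Ck (Suc k) f"
  by (simp add: Ck.simps(2))

lemma Ck_differentiable: "Ck (Suc k) f \<Longrightarrow> f differentiable (at x)"
  by (simp add: Ck.simps(2))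

lemma Ck_partial: "Ck (Suc k) f \<Longrightarrow> Ck k (partial i f)"
  by (simp add: Ck.simps(2))

lemma Ck_Suc_D: "Ck (Suc k) f \<Longrightarrow> Ck k f"
proof (induction k arbitrary: f)
  case 0
  then show ?case
    by (auto simp: Ck.simps(2) continuous_on_eq_continuous_at differentiable_imp_continuous_within)
next
  case (Suc k)
  show ?case
    by (rule Ck_SucI[OF Ck_differentiable[OF Suc.prems] Suc.IH[OF Ck_partial[OF Suc.prems]]])
qed

lemma Ck_continuous: "Ck k f \<Longrightarrow> continuous_on UNIV f"
proof (induction k)
  case (Suc k)
  then show ?case using Ck_Suc_D by blast
qed simp

lemma Ck_const [simp]: "Ck k (\<lambda>_. c)"
proof (induction k arbitrary: c)
  case (Suc k)
  have "partial i (\<lambda>_. c) = (\<lambda>_. 0)" for i by (simp add: fun_eq_iff)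
  with Suc show ?case by (auto intro: Ck_SucI)
qed simp

lemma Ck_bounded_linear:
  assumes "bounded_linear L" "Ck k f"
  shows "Ck k (\<lambda>y. L (f y))"
  using assms(2)
proof (induction k arbitrary: f)
  case 0
  then show ?case using bounded_linear.continuous_on[OF assms(1)] by auto
next
  case (Suc k)
  note d = Ck_differentiable[OF Suc.prems]
  have "partial i (\<lambda>y. L (f y)) = (\<lambda>y. L (partial i f y))" for i
    using partial_bounded_linear[OF assms(1) d] by (simp add: fun_eq_iff)
  moreover have "(\<lambda>y. L (f y)) differentiable (at x)" for x
    using d bounded_linear.has_derivative[OF assms(1)] unfolding differentiable_def by blast
  ultimately show ?case using Suc.IH[OF Ck_partial[OF Suc.prems]] by (intro Ck_SucI) auto
qed

lemma Ck_add: "Ck k f \<Longrightarrow> Ck k g \<Longrightarrow> Ck k (\<lambda>y. f y + g y)"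
proof (induction k arbitrary: f g)
  case 0
  then show ?case by (auto intro: continuous_on_add)
next
  case (Suc k)
  note d = Ck_differentiable[OF Suc.prems(1)] Ck_differentiable[OF Suc.prems(2)]
  have "partial i (\<lambda>y. f y + g y) = (\<lambda>y. partial i f y + partial i g y)" for i
    by (simp add: fun_eq_iff partial_add d)
  then show ?case
    using Suc.IH[OF Ck_partial[OF Suc.prems(1)] Ck_partial[OF Suc.prems(2)]]
    by (intro Ck_SucI differentiable_add d) simp
qed

lemma Ck_sum: "finite S \<Longrightarrow> (\<And>b. b \<in> S \<Longrightarrow> Ck k (f b)) \<Longrightarrow> Ck k (\<lambda>y. \<Sum>b\<in>S. f b y)"
  by (induction S rule: finite_induct) (simp_all add: Ck_add)

lemma Ck_scaleR:
  fixes f :: "point \<Rightarrow> real"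
  shows "Ck k f \<Longrightarrow> Ck k g \<Longrightarrow> Ck k (\<lambda>y. f y *\<^sub>R g y)"
proof (induction k arbitrary: f g)
  case 0
  then show ?case by (auto intro: continuous_on_scaleR)
next
  case (Suc k)
  note d = Ck_differentiable[OF Suc.prems(1)] Ck_differentiable[OF Suc.prems(2)]
  have "partial i (\<lambda>y. f y *\<^sub>R g y) = (\<lambda>y. f y *\<^sub>R partial i g y + partial i f y *\<^sub>R g y)" for i
    by (simp add: fun_eq_iff partial_scaleR d)
  moreover have "Ck k (\<lambda>y. f y *\<^sub>R partial i g y + partial i f y *\<^sub>R g y)" for i
    by (intro Ck_add Suc.IH Ck_partial Suc.prems Ck_Suc_D[OF Suc.prems(1)] Ck_Suc_D[OF Suc.prems(2)])
  ultimately show ?case by (intro Ck_SucI differentiable_scaleR d) simp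
qed

lemma Ck_prod:
  fixes f :: "'i \<Rightarrow> point \<Rightarrow> real"
  assumes "finite S" "\<And>b. b \<in> S \<Longrightarrow> Ck k (f b)"
  shows "Ck k (\<lambda>y. \<Prod>b\<in>S. f b y)"
  using assms
proof (induction S rule: finite_induct)
  case (insert a S)
  have "Ck k (\<lambda>y. f a y *\<^sub>R (\<Prod>b\<in>S. f b y))" by (rule Ck_scaleR) (use insert in auto)
  with insert show ?case by simp
qed simp

lemma Ck_shift: "Ck k f \<Longrightarrow> Ck k (\<lambda>y. f (y + p))"
proof (induction k arbitrary: f)
  case 0
  then show ?case by (auto intro!: continuous_on_compose2[of UNIV f] continuous_intros)
next
  case (Suc k)
  have "partial i (\<lambda>y. f (y + p)) = (\<lambda>y. partial i f (y + p))" for i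
    by (simp add: fun_eq_iff partial_shift)
  moreover have "(\<lambda>y. f (y + p)) differentiable (at x)" for x
    by (rule differentiable_compose[of f])
      (auto intro!: derivative_intros Ck_differentiable[OF Suc.prems])
  ultimately show ?case using Suc.IH[OF Ck_partial[OF Suc.prems]] by (intro Ck_SucI) auto
qed

lemma partial_comp_nth:
  assumes "(g has_real_derivative d) (at (x $ i))"
  shows "partial j (\<lambda>y::point. g (y $ i)) x = (if i = j then d else 0)"
proof -
  have "((\<lambda>y::point. g (y $ i)) has_derivative (\<lambda>h. d * (h $ i))) (at x)"
    using assms unfolding has_field_derivative_def
    by (rule has_derivative_compose[rotated]) (rule bounded_linear_imp_has_derivative, rule bounded_linear_vec_nth)
  from partial_eqI[OF this] show ?thesis by (simp add: axis_def)
qed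

text \<open>The functions \<open>exp (- 1 / t)\<close> have no closed form for their \<open>k\<close>-th derivative; it is enough that
  their derivatives stay in a known family \<open>G\<close>.\<close>

lemma Ck_comp_nth:
  assumes "\<And>g. g \<in> G \<Longrightarrow> \<exists>g'\<in>G. \<forall>t. (g has_real_derivative g' t) (at t)" "g \<in> G"
  shows "Ck k (\<lambda>x::point. g (x $ i))"
  using assms(2)
proof (induction k arbitrary: g)
  case 0
  then obtain g' where "\<forall>t. (g has_real_derivative g' t) (at t)" using assms(1) by blast
  then have "continuous_on UNIV g"
    by (meson DERIV_isCont continuous_at_imp_continuous_on)
  then show ?case by (auto intro!: continuous_on_compose2[of UNIV g] continuous_intros)
next
  case (Suc k)
  then obtain g' where g': "g' \<in> G" "\<And>t. (g has_real_derivative g' t) (at t)" using assms(1) by blast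
  have "partial j (\<lambda>x::point. g (x $ i)) = (if i = j then (\<lambda>x. g' (x $ i)) else (\<lambda>_. 0))" for j
    by (auto simp: fun_eq_iff partial_comp_nth[OF g'(2)])
  moreover have "(\<lambda>x::point. g (x $ i)) differentiable (at x)" for x
    by (rule differentiable_compose[of g])
       (use g'(2) in \<open>auto simp: real_differentiable_def intro: bounded_linear_imp_differentiable bounded_linear_vec_nth\<close>)
  ultimately show ?case using Suc.IH[OF g'(1)] by (intro Ck_SucI) auto
qed

lemma dvg_scaleR:
  assumes "f differentiable (at x)" "u differentiable (at x)"
  shows "dvg (\<lambda>y. f y *\<^sub>R u y) x = f x * dvg u x + grad f x \<bullet> u x"
  unfolding dvg_def grad_def partial_scaleR[OF assms] inner_vec_def
  by (simp add: sum.distrib sum_distrib_left)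

lemma dvg_lincomb:
  assumes "\<And>b. b \<in> S \<Longrightarrow> f b differentiable (at x)"
  shows "dvg (\<lambda>y. \<Sum>b\<in>S. c b *\<^sub>R f b y) x = (\<Sum>b\<in>S. c b * dvg (f b) x)"
proof -
  have "partial i (\<lambda>y. \<Sum>b\<in>S. c b *\<^sub>R f b y) x = (\<Sum>b\<in>S. c b *\<^sub>R partial i (f b) x)" for i
  proof -
    have "partial i (\<lambda>y. \<Sum>b\<in>S. c b *\<^sub>R f b y) x = (\<Sum>b\<in>S. partial i (\<lambda>y. c b *\<^sub>R f b y) x)"
      by (rule partial_sum) (use assms in \<open>auto intro!: derivative_intros\<close>)
    then show ?thesis using assms by (simp add: partial_cmult)
  qed
  then show ?thesis
    by (simp add: dvg_def sum_distrib_left) (rule sum.swap)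
qed

lemma grad_cong_open:
  assumes "open A" "x \<in> A" "\<And>y. y \<in> A \<Longrightarrow> f y = g y"
  shows "grad f x = grad g x"
  using partial_cong_open[OF assms] by (simp add: grad_def)

lemma dvg_cong_open:
  assumes "open A" "x \<in> A" "\<And>y. y \<in> A \<Longrightarrow> f y = g y"
  shows "dvg f x = dvg g x"
  using partial_cong_open[OF assms] by (simp add: dvg_def)

lemma curl_cong_open:
  assumes "open A" "x \<in> A" "\<And>y. y \<in> A \<Longrightarrow> f y = g y"
  shows "curl f x = curl g x"
  using partial_cong_open[OF assms] by (simp add: curl_def)

lemma grad_const [simp]: "grad (\<lambda>_. c) = (\<lambda>_. 0)"
  by (simp add: fun_eq_iff grad_def vec_eq_iff)

lemma curl_zero [simp]: "curl (\<lambda>_. 0) = (\<lambda>_. 0)"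
  by (auto simp: fun_eq_iff curl_def vec_eq_iff forall_3)

lemma Ck1_continuous_partial: "Ck 1 f \<Longrightarrow> continuous_on UNIV (partial i f)"
  by (metis Ck_partial Ck_continuous One_nat_def)

lemma continuous_grad: "Ck 1 f \<Longrightarrow> continuous_on UNIV (grad f)"
  unfolding grad_def[abs_def] by (intro continuous_on_vec_lambda Ck1_continuous_partial)

lemma continuous_dvg: "Ck 1 u \<Longrightarrow> continuous_on UNIV (dvg u)"
  unfolding dvg_def[abs_def] by (intro continuous_intros Ck1_continuous_partial)

lemma continuous_curl:
  assumes "Ck 1 u"
  shows "continuous_on UNIV (curl u)"
proof -
  have c: "continuous_on UNIV (\<lambda>x. partial i u x $ k)" for i k
    by (rule continuous_on_component[OF Ck1_continuous_partial[OF assms]])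
  have "continuous_on UNIV (\<lambda>x. curl u x $ k)" for k
    using exhaust_3[of k] unfolding curl_def by (auto simp: intro!: continuous_on_diff c)
  then show ?thesis
    using continuous_on_vec_lambda[of UNIV "\<lambda>k x. curl u x $ k"] by simp
qed


section \<open>Smooth functions exhausting a box\<close>

text \<open>This family is closed under differentiation, and \<open>p = 1\<close> is the classical smooth function
  that is flat at \<open>0\<close>.\<close>

definition exp_bump :: "real poly \<Rightarrow> real \<Rightarrow> real" where
  "exp_bump p t = (if t > 0 then poly p (1 / t) * exp (- (1 / t)) else 0)"

lemma poly_exp_decay: "((\<lambda>s::real. poly p s * exp (- s)) \<longlongrightarrow> 0) at_top"
proof -
  have "((\<lambda>s. \<Sum>i\<le>degree p. coeff p i * (s ^ i / exp s)) \<longlongrightarrow> (\<Sum>i\<le>degree p. coeff p i * 0)) at_top"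
    by (intro tendsto_sum tendsto_mult tendsto_const tendsto_power_div_exp_0)
  then show ?thesis
    by (simp add: poly_altdef sum_distrib_right exp_minus divide_inverse mult.assoc)
qed

text \<open>Away from \<open>0\<close> this is the chain rule; at \<open>0\<close> the difference quotient is \<open>s p(s) exp (- s)\<close> with
  \<open>s = 1 / h\<close>, and exponential decay wins over every polynomial.\<close>

lemma exp_bump_deriv:
  "(exp_bump p has_real_derivative exp_bump ([:0, 0, 1:] * (p - pderiv p)) t) (at t)"
proof -
  let ?q = "[:0, 0, 1:] * (p - pderiv p)"
  consider "t > 0" | "t < 0" | "t = 0" by linarith
  then show ?thesis
  proof cases
    case 1
    have "((\<lambda>t. poly p (1 / t) * exp (- (1 / t))) has_real_derivative exp_bump ?q t) (at t)"
      using 1 by (auto intro!: derivative_eq_intros simp: exp_bump_def field_simps power2_eq_square)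
    then show ?thesis
      by (rule has_field_derivative_transform_within_open[where S="{0<..}"]) (use 1 in \<open>auto simp: exp_bump_def\<close>)
  next
    case 2
    have "((\<lambda>t::real. 0) has_real_derivative exp_bump ?q t) (at t)"
      using 2 by (simp add: exp_bump_def)
    then show ?thesis
      by (rule has_field_derivative_transform_within_open[where S="{..<0}"]) (use 2 in \<open>auto simp: exp_bump_def\<close>)
  next
    case 3
    have "((\<lambda>h. exp_bump p h / h) \<longlongrightarrow> 0) (at_right 0)"
    proof (rule filterlim_cong[THEN iffD1, OF refl refl])
      show "\<forall>\<^sub>F h in at_right 0. poly ([:0, 1:] * p) (inverse h) * exp (- inverse h) = exp_bump p h / h"
        by (auto simp: exp_bump_def eventually_at_right_less inverse_eq_divide
            intro: eventually_mono[OF eventually_at_right_less])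
      show "((\<lambda>h. poly ([:0, 1:] * p) (inverse h) * exp (- inverse h)) \<longlongrightarrow> 0) (at_right (0::real))"
        by (rule filterlim_compose[OF poly_exp_decay filterlim_inverse_at_top_right])
    qed
    moreover have "((\<lambda>h. exp_bump p h / h) \<longlongrightarrow> 0) (at_left 0)"
      by (rule tendsto_eventually) (auto simp: exp_bump_def eventually_at_left_field intro!: exI[of _ "-1"])
    ultimately have "((\<lambda>h. exp_bump p h / h) \<longlongrightarrow> 0) (at 0)"
      using filterlim_split_at by blast
    then show ?thesis using 3 by (simp add: DERIV_def exp_bump_def)
  qed
qed

text \<open>The box is cut out by products of one-dimensional bumps. The factor \<open>Suc n\<close> turns
  \<open>exp (- 1 / t)\<close> into \<open>exp (- 1 / (Suc n * t))\<close>, which tends to \<open>1\<close> for \<open>t > 0\<close>, so that the bumps tend to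
  the indicator of the open box while their supports stay in the closed box.\<close>

definition bump :: "point \<Rightarrow> point \<Rightarrow> nat \<Rightarrow> sfield" where
  "bump a b n x =
     (\<Prod>i\<in>UNIV. exp_bump 1 (real (Suc n) * (x $ i - a $ i)) * exp_bump 1 (real (Suc n) * (b $ i - x $ i)))"

lemma Ck_exp_bump_affine: "Ck k (\<lambda>x::point. exp_bump p (c * x $ i + d))"
proof (rule Ck_comp_nth[where G = "{\<lambda>t. e * exp_bump q (c * t + d) | e q. True}"])
  show "(\<lambda>t. exp_bump p (c * t + d)) \<in> {\<lambda>t. e * exp_bump q (c * t + d) |e q. True}"
    by simp (metis mult_1)
  fix g assume "g \<in> {\<lambda>t. e * exp_bump q (c * t + d) |e q. True}"
  then obtain e q where g: "g = (\<lambda>t. e * exp_bump q (c * t + d))" by blast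
  have "(g has_real_derivative (e * c) * exp_bump ([:0, 0, 1:] * (q - pderiv q)) (c * t + d)) (at t)" for t
    unfolding g
    by (rule derivative_eq_intros DERIV_chain2[OF exp_bump_deriv] refl)+ (simp add: algebra_simps)
  then show "\<exists>g'\<in>{\<lambda>t. e * exp_bump q (c * t + d) |e q. True}. \<forall>t. (g has_real_derivative g' t) (at t)"
    by (intro bexI[of _ "\<lambda>t. (e * c) * exp_bump ([:0, 0, 1:] * (q - pderiv q)) (c * t + d)"]) blast+
qed

lemma Ck_bump: "Ck k (bump a b n)"
proof -
  have "Ck k (\<lambda>x. \<Prod>i\<in>UNIV. exp_bump 1 (real (Suc n) * x $ i + - real (Suc n) * a $ i) *\<^sub>R
              exp_bump 1 (- real (Suc n) * x $ i + real (Suc n) * b $ i))"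
    by (intro Ck_prod Ck_scaleR Ck_exp_bump_affine finite)
  then show ?thesis unfolding bump_def[abs_def] by (simp add: algebra_simps)
qed

lemma exp_bump_1: "0 \<le> exp_bump 1 t" "exp_bump 1 t \<le> 1" "exp_bump 1 t = 0 \<longleftrightarrow> t \<le> 0"
  by (auto simp: exp_bump_def)

lemma bump_nonneg: "0 \<le> bump a b n x" and bump_le_1: "bump a b n x \<le> 1"
  unfolding bump_def by (auto intro!: prod_nonneg prod_le_1 mult_nonneg_nonneg mult_le_one simp: exp_bump_1)

lemma bump_eq_0: "x \<notin> box a b \<Longrightarrow> bump a b n x = 0"
  by (auto simp: bump_def mem_box_cart exp_bump_1 mult_le_0_iff not_less)

lemma bump_tendsto: "(\<lambda>n. bump a b n x) \<longlonglongrightarrow> indicat_real (box a b) x"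
proof (cases "x \<in> box a b")
  case True
  have "(\<lambda>n. exp_bump 1 (real (Suc n) * t)) \<longlonglongrightarrow> 1" if "t > 0" for t
  proof -
    have "(\<lambda>n. exp (- (inverse (real (Suc n)) * (1 / t)))) \<longlonglongrightarrow> exp (- (0 * (1 / t)))"
      by (intro tendsto_intros LIMSEQ_inverse_real_of_nat)
    moreover have "exp_bump 1 (real (Suc n) * t) = exp (- (inverse (real (Suc n)) * (1 / t)))" for n
      using that by (subst exp_bump_def) (simp add: field_simps add_pos_nonneg)
    ultimately show ?thesis by simp
  qed
  then have "(\<lambda>n. bump a b n x) \<longlonglongrightarrow> (\<Prod>i\<in>(UNIV::3 set). 1 * 1)"
    unfolding bump_def using True by (intro tendsto_prod tendsto_mult) (auto simp: mem_box_cart)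
  then show ?thesis using True by simp
next
  case False
  then show ?thesis by (simp add: bump_eq_0)
qed

lemma test_function_bump:
  assumes "cbox a b \<subseteq> D"
  shows "test_function D (\<lambda>x. bump a b n x *\<^sub>R (v :: 'b::real_normed_vector))"
  unfolding test_function_def smooth_def
proof (intro conjI allI exI[of _ "cbox a b"] impI)
  show "Ck k (\<lambda>x. bump a b n x *\<^sub>R v)" for k by (intro Ck_scaleR Ck_bump Ck_const)
  show "bump a b n x *\<^sub>R v = 0" if "x \<notin> cbox a b" for x
    using that box_subset_cbox[of a b] by (subst bump_eq_0) auto
qed (use assms in auto)


section \<open>Cells, traces and piecewise continuous fields\<close>

lemma mesh_cellD:
  assumes "mesh_cell K"
  shows "compact K" "closure (interior K) = K" "negligible (frontier K)" "closed K" "bounded (interior K)"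
    "frontier K \<subseteq> K" "emeasure surf (frontier K) < \<infinity>"
  using assms unfolding mesh_cell_def
  by (auto simp: compact_imp_closed frontier_def intro: bounded_subset[OF compact_imp_bounded interior_subset])

lemma outward_normal_normal: "mesh_cell K \<Longrightarrow> outward_normal K (normal K)"
  unfolding mesh_cell_def normal_def by (metis someI_ex)

lemma fe_meshD:
  assumes "fe_mesh M"
  shows "finite (Cells M)" "0 \<in> Per M" "\<And>K. K \<in> Cells M \<Longrightarrow> mesh_cell K"
    "\<And>K. K \<in> Cells M \<Longrightarrow> interior K \<subseteq> Dom M"
    "\<And>p q. p \<in> Per M \<Longrightarrow> q \<in> Per M \<Longrightarrow> p - q \<in> Per M"
    "open (Dom M)"
    "\<And>p. p \<in> Per M \<Longrightarrow> (+) p ` Dom M = Dom M"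
    "closure (Dom M) = (\<Union>p\<in>Per M. \<Union>K\<in>Cells M. (+) p ` K)"
proof -
  note m = assms[unfolded fe_mesh_def]
  show "finite (Cells M)" using m by (elim conjE)
  show "0 \<in> Per M" using m by (elim conjE)
  show "open (Dom M)" using m by (elim conjE)
  show "closure (Dom M) = (\<Union>p\<in>Per M. \<Union>K\<in>Cells M. (+) p ` K)" using m by (elim conjE)
  have "\<forall>K\<in>Cells M. mesh_cell K \<and> interior K \<subseteq> Dom M" using m by (elim conjE)
  then show "mesh_cell K" "interior K \<subseteq> Dom M" if "K \<in> Cells M" for K using that by blast+
  have "\<forall>p\<in>Per M. (+) p ` Dom M = Dom M" using m by (elim conjE)
  then show "(+) p ` Dom M = Dom M" if "p \<in> Per M" for p using that by (rule bspec)
  have "\<forall>p\<in>Per M. \<forall>q\<in>Per M. p - q \<in> Per M" using m by (elim conjE)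
  then show "p - q \<in> Per M" if "p \<in> Per M" "q \<in> Per M" for p q using that by blast
qed

lemma fe_mesh_discrete: "fe_mesh M \<Longrightarrow> \<exists>e>0. \<forall>p\<in>Per M. p \<noteq> 0 \<longrightarrow> e \<le> norm p"
  unfolding fe_mesh_def by (elim conjE)

lemma fe_mesh_disjoint:
  assumes "fe_mesh M" "K \<in> Cells M" "L \<in> Cells M" "p \<in> Per M" "(K, 0) \<noteq> (L, p)"
  shows "interior K \<inter> interior ((+) p ` L) = {}"
    "emeasure surf (K \<inter> (+) p ` L \<inter> frontier (Dom M)) = 0"
proof -
  have "\<forall>K\<in>Cells M. \<forall>L\<in>Cells M. \<forall>p\<in>Per M. (K, 0) \<noteq> (L, p) \<longrightarrow>
        interior K \<inter> interior ((+) p ` L) = {} \<and>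
        emeasure surf (K \<inter> (+) p ` L \<inter> frontier (Dom M)) = 0"
    using assms(1) unfolding fe_mesh_def by (elim conjE)
  from this[rule_format, OF assms(2-5)] show "interior K \<inter> interior ((+) p ` L) = {}"
    "emeasure surf (K \<inter> (+) p ` L \<inter> frontier (Dom M)) = 0" by (rule conjunct1, rule conjunct2)
qed

lemma fe_mesh_triple:
  assumes "fe_mesh M" "K \<in> Cells M" "L \<in> Cells M" "K' \<in> Cells M" "p \<in> Per M" "q \<in> Per M"
    "(K, 0) \<noteq> (L, p)" "(K, 0) \<noteq> (K', q)" "(L, p) \<noteq> (K', q)"
  shows "emeasure surf (K \<inter> (+) p ` L \<inter> (+) q ` K') = 0"
proof -
  have "\<forall>K\<in>Cells M. \<forall>L\<in>Cells M. \<forall>K'\<in>Cells M. \<forall>p\<in>Per M. \<forall>q\<in>Per M.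
        (K, 0) \<noteq> (L, p) \<and> (K, 0) \<noteq> (K', q) \<and> (L, p) \<noteq> (K', q) \<longrightarrow>
        emeasure surf (K \<inter> (+) p ` L \<inter> (+) q ` K') = 0"
    using assms(1) unfolding fe_mesh_def by (elim conjE)
  from this[rule_format, OF assms(2-6)] assms(7-9) show ?thesis by blast
qed

lemma fe_mesh_facets:
  assumes "fe_mesh M"
  shows "Facets M \<subseteq> all_facets M"
    "\<forall>(K, L, p) \<in> all_facets M. ((K, L, p) \<in> Facets M) \<noteq> ((L, K, - p) \<in> Facets M)"
    "\<forall>e\<in>Facets M. AE x in surf. x \<in> fset e \<longrightarrow> n_plus e x = - n_minus e x"
proof -
  note m = assms[unfolded fe_mesh_def]
  show "Facets M \<subseteq> all_facets M" using m by (elim conjE)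
  show "\<forall>(K, L, p) \<in> all_facets M. ((K, L, p) \<in> Facets M) \<noteq> ((L, K, - p) \<in> Facets M)"
    using m by (elim conjE)
  show "\<forall>e\<in>Facets M. AE x in surf. x \<in> fset e \<longrightarrow> n_plus e x = - n_minus e x"
    using m by (elim conjE)
qed

text \<open>Traces are limits from the interior of a cell, and \<open>Lim\<close> is arbitrary along a trivial filter. That
  cells are closures of their interiors excludes this at every point of a cell.\<close>

lemma trace_filter_nontrivial:
  fixes x :: point
  assumes "x \<in> closure (interior K)"
  shows "at x within interior K \<noteq> bot"
proof (cases "x \<in> interior K")
  case True
  show ?thesis unfolding at_within_open[OF True open_interior] by simp
next
  case False
  then have "x islimpt interior K" using assms unfolding closure_def by blast
  then show ?thesis using trivial_limit_within[of x "interior K"] by blast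
qed

lemma cell_trace_eqI:
  assumes "x \<in> closure (interior K)" "(f \<longlongrightarrow> l) (at x within interior K)"
  shows "cell_trace K f x = l"
  unfolding cell_trace_def using tendsto_Lim[OF trace_filter_nontrivial[OF assms(1)] assms(2)] .

lemma tendsto_trace:
  fixes x :: point
  assumes "\<And>y. y \<in> interior K \<Longrightarrow> f y = g y" "isCont g x"
  shows "(f \<longlongrightarrow> g x) (at x within interior K)"
proof -
  have "(g \<longlongrightarrow> g x) (at x within interior K)"
    using assms(2) by (meson isCont_def tendsto_within_subset subset_UNIV)
  then show ?thesis
    by (rule Lim_transform_eventually) (auto simp: eventually_at_filter assms(1))
qed

lemma interior_plus: "interior ((+) p ` K) = (+) p ` interior (K :: point set)"
  using interior_translation[of p K] by simp

lemma closure_interior_plus: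
  "closure (interior K) = K \<Longrightarrow> closure (interior ((+) p ` K)) = (+) p ` (K :: point set)"
  by (metis interior_plus closure_translation)

text \<open>The minus side of a facet is a translate of a cell; periodicity moves the extension of \<open>f\<close> there.\<close>

lemma tendsto_trace_shift:
  assumes "periodic M f" "p \<in> Per M" "\<And>y. y \<in> interior K \<Longrightarrow> f y = g y" "isCont g (x - p)"
  shows "(f \<longlongrightarrow> g (x - p)) (at x within interior ((+) p ` K))"
proof (rule tendsto_trace[where g = "\<lambda>y. g (y - p)"])
  fix y assume "y \<in> interior ((+) p ` K)"
  then obtain z where z: "z \<in> interior K" "y = p + z" by (auto simp: interior_plus)
  have "f (z + p) = f z" using assms(1)[unfolded periodic_def] assms(2) by blast
  then show "f y = g (y - p)" using z assms(3) by (simp add: add.commute)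
next
  show "isCont (\<lambda>y. g (y - p)) x"
    by (rule isCont_o2[where f = "\<lambda>y. y - p" and g = g, OF _ assms(4)]) simp
qed


text \<open>Continuous up to the boundary of every cell, but with unrelated values on different cells. Such
  fields are bounded, hence integrable, and they are closed under products, unlike the finite element
  spaces.\<close>

definition pwc :: "mesh \<Rightarrow> (point \<Rightarrow> 'b::real_normed_vector) \<Rightarrow> bool" where
  "pwc M f \<longleftrightarrow> (\<forall>K\<in>Cells M. \<exists>g. continuous_on UNIV g \<and> (\<forall>x\<in>interior K. f x = g x))"

lemma pwc_const [simp, intro!]: "pwc M (\<lambda>_. c)"
  unfolding pwc_def by (intro ballI exI[of _ "\<lambda>_. c"]) simp

lemma pwc_binary:
  assumes "pwc M f" "pwc M g" "\<And>a b. continuous_on UNIV a \<Longrightarrow> continuous_on UNIV b \<Longrightarrow>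
    continuous_on UNIV (\<lambda>x::point. h (a x) (b x))"
  shows "pwc M (\<lambda>x. h (f x) (g x))"
  unfolding pwc_def
proof
  fix K assume "K \<in> Cells M"
  with assms(1,2) obtain a b where "continuous_on UNIV a" "\<forall>x\<in>interior K. f x = a x"
    "continuous_on UNIV b" "\<forall>x\<in>interior K. g x = b x" unfolding pwc_def by blast
  with assms(3)[of a b] show "\<exists>k. continuous_on UNIV k \<and> (\<forall>x\<in>interior K. h (f x) (g x) = k x)"
    by (intro exI[of _ "\<lambda>x. h (a x) (b x)"]) simp
qed

lemma pwc_unary:
  assumes "pwc M f" "\<And>a. continuous_on UNIV a \<Longrightarrow> continuous_on UNIV (\<lambda>x::point. h (a x))"
  shows "pwc M (\<lambda>x. h (f x))"
  using pwc_binary[where h = "\<lambda>a b. h a" and g = f and f = f] assms by blast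

lemma pwc_add: "pwc M f \<Longrightarrow> pwc M g \<Longrightarrow> pwc M (\<lambda>x. f x + g x)"
  by (rule pwc_binary) (auto intro: continuous_on_add)

lemma pwc_scaleR: "pwc M f \<Longrightarrow> pwc M g \<Longrightarrow> pwc M (\<lambda>x. f x *\<^sub>R g x)"
  by (rule pwc_binary) (auto intro: continuous_on_scaleR)

lemma pwc_mult: "pwc M f \<Longrightarrow> pwc M g \<Longrightarrow> pwc M (\<lambda>x. f x * g x :: real)"
  by (rule pwc_binary) (auto intro: continuous_on_mult)

lemma pwc_inner:
  fixes f g :: "point \<Rightarrow> 'b::real_inner"
  shows "pwc M f \<Longrightarrow> pwc M g \<Longrightarrow> pwc M (\<lambda>x. f x \<bullet> g x)"
  by (rule pwc_binary) (auto intro: continuous_on_inner)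

lemma pwc_norm2: "pwc M f \<Longrightarrow> pwc M (\<lambda>x. (norm (f x))\<^sup>2)"
  by (rule pwc_unary) (auto intro: continuous_on_power continuous_on_norm)

lemma pwc_nth: "pwc M u \<Longrightarrow> pwc M (\<lambda>x. (u x :: real^'n) $ i)"
  by (rule pwc_unary) (auto intro: continuous_on_component)

lemma smooth_Ck: "smooth f \<Longrightarrow> Ck k f"
  by (simp add: smooth_def)

lemma pw_smooth_imp_pwc: "pw_smooth M f \<Longrightarrow> pwc M f"
  unfolding pw_smooth_def pwc_def by (meson smooth_Ck Ck_continuous)

lemma pw_smooth_derivs:
  fixes f :: sfield and u :: vfield
  shows "pw_smooth M f \<Longrightarrow> pwc M (grad f)" "pw_smooth M u \<Longrightarrow> pwc M (dvg u)"
    "pw_smooth M u \<Longrightarrow> pwc M (curl u)"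
proof -
  show "pwc M (grad f)" if f: "pw_smooth M f"
    unfolding pwc_def
  proof
    fix K assume KC: "K \<in> Cells M"
    obtain g where g: "smooth g" "\<forall>x\<in>interior K. f x = g x"
      using bspec[OF f[unfolded pw_smooth_def] KC] by (elim exE conjE)
    then have "\<forall>x\<in>interior K. grad f x = grad g x" using grad_cong_open[OF open_interior, of _ K f g] by blast
    then show "\<exists>k. continuous_on UNIV k \<and> (\<forall>x\<in>interior K. grad f x = k x)"
      using continuous_grad[OF smooth_Ck[OF g(1)]] by blast
  qed
  fix u :: vfield assume u: "pw_smooth M u"
  have "(\<exists>k. continuous_on UNIV k \<and> (\<forall>x\<in>interior K. dvg u x = k x)) \<and>
        (\<exists>k. continuous_on UNIV k \<and> (\<forall>x\<in>interior K. curl u x = k x))" if KC: "K \<in> Cells M" for K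
  proof -
    obtain g where g: "smooth g" "\<forall>x\<in>interior K. u x = g x"
      using bspec[OF u[unfolded pw_smooth_def] KC] by (elim exE conjE)
    then have "\<forall>x\<in>interior K. dvg u x = dvg g x" "\<forall>x\<in>interior K. curl u x = curl g x"
      using dvg_cong_open[OF open_interior, of _ K u g] curl_cong_open[OF open_interior, of _ K u g] by blast+
    then show ?thesis
      using continuous_dvg[OF smooth_Ck[OF g(1)]] continuous_curl[OF smooth_Ck[OF g(1)]] by blast
  qed
  then show "pwc M (dvg u)" "pwc M (curl u)" unfolding pwc_def by blast+
qed

lemma continuous_set_integrable:
  fixes g :: "point \<Rightarrow> 'b::euclidean_space"
  assumes "compact K" "continuous_on UNIV g" "A \<subseteq> K" "A \<in> sets lebesgue"
  shows "set_integrable lebesgue A g"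
proof (rule set_integrable_subset)
  have "integrable lborel (\<lambda>x. indicator K x *\<^sub>R g x)"
    by (rule borel_integrable_compact) (use assms in \<open>auto intro: continuous_on_subset\<close>)
  note I = this
  show "set_integrable lebesgue K g"
    unfolding set_integrable_def using integrable_completion[OF borel_measurable_integrable[OF I]] I by blast
qed (use assms in auto)

lemma pwc_integrable_cell:
  fixes f :: "point \<Rightarrow> 'b::euclidean_space"
  assumes "fe_mesh M" "pwc M f" "K \<in> Cells M"
  shows "set_integrable lebesgue (interior K) f"
proof -
  obtain g where g: "continuous_on UNIV g" "\<forall>x\<in>interior K. f x = g x"
    using assms unfolding pwc_def by blast
  have "set_integrable lebesgue (interior K) g"
    by (rule continuous_set_integrable[OF mesh_cellD(1)[OF fe_meshD(3)[OF assms(1,3)]] g(1) interior_subset])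
       simp
  then show ?thesis using g(2) by (subst set_integrable_cong[OF refl refl]) auto
qed

lemma pwc_integrable:
  fixes f :: "point \<Rightarrow> 'b::euclidean_space"
  assumes "fe_mesh M" "pwc M f"
  shows "set_integrable lebesgue (omega M) f"
  unfolding omega_def
  by (rule set_integrable_UN) (use assms fe_meshD(1) pwc_integrable_cell in auto)

lemma sets_omega: "omega M \<in> sets lebesgue"
  unfolding omega_def by (simp add: open_UN sets_completionI_sets)

lemma cells_disjoint_family:
  assumes "fe_mesh M"
  shows "disjoint_family_on interior (Cells M)"
  unfolding disjoint_family_on_def
proof (intro ballI impI)
  fix K L assume "K \<in> Cells M" "L \<in> Cells M" "K \<noteq> L"
  then show "interior K \<inter> interior L = {}"
    using fe_mesh_disjoint(1)[OF assms, of K L 0] fe_meshD(2)[OF assms] by (simp add: image_def)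
qed

lemma integral_omega_cells:
  fixes f :: "point \<Rightarrow> 'b::euclidean_space"
  assumes "fe_mesh M" "pwc M f"
  shows "(LINT x:omega M|lebesgue. f x) = (\<Sum>K\<in>Cells M. LINT x:interior K|lebesgue. f x)"
  unfolding omega_def
  by (rule set_integral_finite_Union)
     (use assms fe_meshD(1) pwc_integrable_cell cells_disjoint_family in auto)

lemma ip_cong:
  assumes "\<And>x. x \<in> omega M \<Longrightarrow> f x \<bullet> g x = f' x \<bullet> g' x"
  shows "ip M f g = ip M f' g'"
  unfolding ip_def by (rule set_lebesgue_integral_cong) (use assms sets_omega in auto)

lemma fe_space_member:
  assumes "fe_space M W" "w \<in> W"
  shows "pw_smooth M w" "periodic M w"
proof -
  obtain S c where S: "finite S" "\<forall>b\<in>S. periodic M b \<and> pw_smooth M b" "w = (\<lambda>x. \<Sum>b\<in>S. c b *\<^sub>R b x)"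
    using assms unfolding fe_space_def by blast
  show "periodic M w" unfolding periodic_def S(3)
    by (intro ballI allI sum.cong refl) (use S(2) in \<open>simp add: periodic_def\<close>)
  show "pw_smooth M w" unfolding pw_smooth_def
  proof
    fix K assume "K \<in> Cells M"
    then have "\<forall>b\<in>S. \<exists>g. smooth g \<and> (\<forall>x\<in>interior K. b x = g x)"
      using S(2) unfolding pw_smooth_def by blast
    then obtain G where G: "\<forall>b\<in>S. smooth (G b) \<and> (\<forall>x\<in>interior K. b x = G b x)" by metis
    have "smooth (\<lambda>x. \<Sum>b\<in>S. c b *\<^sub>R G b x)"
      unfolding smooth_def by (intro allI Ck_sum Ck_scaleR Ck_const S(1)) (use G smooth_Ck in blast)
    with G show "\<exists>g. smooth g \<and> (\<forall>x\<in>interior K. w x = g x)"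
      unfolding S(3) by (intro exI[of _ "\<lambda>x. \<Sum>b\<in>S. c b *\<^sub>R G b x"]) simp
  qed
qed

lemma fe_space_lincomb:
  assumes "fe_space M W" "finite B" "B \<subseteq> W"
  shows "(\<lambda>x. \<Sum>b\<in>B. c b *\<^sub>R b x) \<in> W"
proof -
  obtain S where S: "finite S" and W: "W = range (\<lambda>c. \<lambda>x. \<Sum>b\<in>S. c b *\<^sub>R b x)"
    using assms(1) unfolding fe_space_def by blast
  have "\<forall>b\<in>B. \<exists>d. b = (\<lambda>x. \<Sum>a\<in>S. d a *\<^sub>R a x)" using assms(3) unfolding W by blast
  from bchoice[OF this] obtain d where d: "\<forall>b\<in>B. b = (\<lambda>x. \<Sum>a\<in>S. d b a *\<^sub>R a x)" ..
  have "(\<Sum>b\<in>B. c b *\<^sub>R b x) = (\<Sum>a\<in>S. (\<Sum>b\<in>B. c b * d b a) *\<^sub>R a x)" for x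
  proof -
    have "(\<Sum>b\<in>B. c b *\<^sub>R b x) = (\<Sum>b\<in>B. \<Sum>a\<in>S. (c b * d b a) *\<^sub>R a x)"
    proof (rule sum.cong[OF refl])
      fix b assume "b \<in> B"
      then have "b x = (\<Sum>a\<in>S. d b a *\<^sub>R a x)" by (rule fun_cong[OF bspec[OF d]])
      then have "c b *\<^sub>R b x = c b *\<^sub>R (\<Sum>a\<in>S. d b a *\<^sub>R a x)" by (rule arg_cong)
      then show "c b *\<^sub>R b x = (\<Sum>a\<in>S. (c b * d b a) *\<^sub>R a x)"
        unfolding scaleR_sum_right scaleR_scaleR .
    qed
    also have "\<dots> = (\<Sum>a\<in>S. (\<Sum>b\<in>B. c b * d b a) *\<^sub>R a x)"
      by (subst sum.swap) (simp add: scaleR_sum_left)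
    finally show ?thesis .
  qed
  then show ?thesis unfolding W
    by (intro range_eqI[where x = "\<lambda>a. \<Sum>b\<in>B. c b * d b a"] ext)
qed

lemma pw_smooth_differentiable:
  assumes "pw_smooth M f" "x \<in> omega M"
  shows "f differentiable (at x)"
proof -
  obtain K where K: "K \<in> Cells M" "x \<in> interior K" using assms(2) unfolding omega_def by blast
  then obtain g where g: "smooth g" "\<forall>x\<in>interior K. f x = g x" using assms unfolding pw_smooth_def by blast
  have "g differentiable (at x)" using Ck_differentiable smooth_Ck[OF g(1)] by blast
  then show ?thesis
    using differentiable_cong_open[OF open_interior K(2), of f g] g(2) by blast
qed


section \<open>Time derivatives of integrals of finite element fields\<close>

text \<open>Integrands that are finite sums of products of a time dependent coefficient and a fixed field.
  The derivatives of the coefficients need not be bounded in time, so dominated convergence does not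
  allow to differentiate under the integral sign; linearity of the integral does. The closure of
  the predicate under products is what the cubic kinetic energy needs.\<close>

inductive fe_integrand :: "mesh \<Rightarrow> real set \<Rightarrow> (real \<Rightarrow> sfield) \<Rightarrow> (real \<Rightarrow> sfield) \<Rightarrow> bool"
  for M I where
  sep: "pwc M \<phi> \<Longrightarrow> \<forall>t\<in>I. (c has_real_derivative c' t) (at t within I) \<Longrightarrow>
    fe_integrand M I (\<lambda>t x. c t * \<phi> x) (\<lambda>t x. c' t * \<phi> x)"
| add: "fe_integrand M I f f' \<Longrightarrow> fe_integrand M I g g' \<Longrightarrow>
    fe_integrand M I (\<lambda>t x. f t x + g t x) (\<lambda>t x. f' t x + g' t x)"
| cong: "fe_integrand M I f f' \<Longrightarrow> \<forall>t\<in>I. \<forall>x\<in>omega M. f t x = g t x \<and> f' t x = g' t x \<Longrightarrow>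
    fe_integrand M I g g'"

lemma deriv_cong_on:
  assumes "t \<in> I" "\<And>t. t \<in> I \<Longrightarrow> f t = g t" "(f has_real_derivative d) (at t within I)"
  shows "(g has_real_derivative d) (at t within I)"
  by (rule has_field_derivative_transform_within[OF assms(3) zero_less_one assms(1)]) (rule assms(2))

lemma fe_integrand_mult_term:
  assumes "fe_integrand M I g g'" "pwc M \<phi>" "\<forall>t\<in>I. (c has_real_derivative c' t) (at t within I)"
  shows "fe_integrand M I (\<lambda>t x. (c t * \<phi> x) * g t x) (\<lambda>t x. (c' t * \<phi> x) * g t x + (c t * \<phi> x) * g' t x)"
  using assms(1)
proof induction
  case (sep \<psi> d d')
  have "fe_integrand M I (\<lambda>t x. (c t * d t) * (\<phi> x * \<psi> x)) (\<lambda>t x. (c' t * d t + d' t * c t) * (\<phi> x * \<psi> x))"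
    by (rule fe_integrand.sep[OF pwc_mult[OF assms(2) sep(1)]]) (use DERIV_mult[of c _ _ I d] sep(2) assms(3) in blast)
  then show ?case by (rule fe_integrand.cong) (simp add: algebra_simps)
next
  case (add f f' g g')
  from fe_integrand.add[OF add.IH] show ?case by (rule fe_integrand.cong) (simp add: algebra_simps)
next
  case (cong f f' g g')
  from cong.IH show ?case by (rule fe_integrand.cong) (use cong.hyps in simp)
qed

lemma fe_integrand_mult:
  assumes "fe_integrand M I f f'" "fe_integrand M I g g'"
  shows "fe_integrand M I (\<lambda>t x. f t x * g t x) (\<lambda>t x. f' t x * g t x + f t x * g' t x)"
  using assms(1)
proof induction
  case (sep \<psi> d d')
  then show ?case using fe_integrand_mult_term[OF assms(2)] by blast
next
  case (add f f' h h')
  from fe_integrand.add[OF add.IH] show ?case by (rule fe_integrand.cong) (simp add: algebra_simps)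
next
  case (cong f f' h h')
  from cong.IH show ?case by (rule fe_integrand.cong) (use cong.hyps in simp)
qed

lemma fe_integrand_const: "pwc M \<phi> \<Longrightarrow> fe_integrand M I (\<lambda>t. \<phi>) (\<lambda>t x. 0)"
  using fe_integrand.sep[of M \<phi> I "\<lambda>_. 1" "\<lambda>_. 0"] by simp

lemma fe_integrand_cmult:
  assumes "fe_integrand M I f f'"
  shows "fe_integrand M I (\<lambda>t x. c * f t x) (\<lambda>t x. c * f' t x)"
  using fe_integrand_mult[OF fe_integrand_const[of M "\<lambda>_. c"] assms] by simp

lemma fe_integrand_sum:
  assumes "finite S" "\<And>b. b \<in> S \<Longrightarrow> fe_integrand M I (f b) (f' b)"
  shows "fe_integrand M I (\<lambda>t x. \<Sum>b\<in>S. f b t x) (\<lambda>t x. \<Sum>b\<in>S. f' b t x)"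
  using assms
proof (induction S rule: finite_induct)
  case empty
  then show ?case using fe_integrand_const[of M "\<lambda>_. 0"] by simp
next
  case (insert b S)
  then show ?case using fe_integrand.add[of M I "f b" "f' b"] by simp
qed

lemma fe_integrand_integral:
  assumes "fe_mesh M" "fe_integrand M I f f'"
  shows "\<forall>t\<in>I. set_integrable lebesgue (omega M) (f t) \<and> set_integrable lebesgue (omega M) (f' t) \<and>
     ((\<lambda>t. LINT x:omega M|lebesgue. f t x) has_real_derivative (LINT x:omega M|lebesgue. f' t x)) (at t within I)"
  using assms(2)
proof induction
  case (sep \<phi> c c')
  have "set_integrable lebesgue (omega M) \<phi>" by (rule pwc_integrable[OF assms(1) sep(1)])
  then show ?case
    using DERIV_cmult_right[of c _ _ I "LINT x:omega M|lebesgue. \<phi> x"] sep(2)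
    by (simp add: set_integrable_mult_right)
next
  case (add f f' g g')
  show ?case
  proof (intro ballI conjI)
    fix t assume t: "t \<in> I"
    note h = bspec[OF add.IH(1) t] bspec[OF add.IH(2) t]
    show "set_integrable lebesgue (omega M) (\<lambda>x. f t x + g t x)"
         "set_integrable lebesgue (omega M) (\<lambda>x. f' t x + g' t x)"
      using h by (intro set_integral_add(1); blast)+
    have "((\<lambda>t. (LINT x:omega M|lebesgue. f t x) + (LINT x:omega M|lebesgue. g t x)) has_real_derivative
           (LINT x:omega M|lebesgue. f' t x) + (LINT x:omega M|lebesgue. g' t x)) (at t within I)"
      using h by (intro DERIV_add) blast+
    moreover have r: "(LINT x:omega M|lebesgue. f' t x) + (LINT x:omega M|lebesgue. g' t x) =
        (LINT x:omega M|lebesgue. f' t x + g' t x)"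
      using h by (intro set_integral_add(2)[symmetric]) blast+
    moreover have l: "(LINT x:omega M|lebesgue. f t x) + (LINT x:omega M|lebesgue. g t x) =
        (LINT x:omega M|lebesgue. f t x + g t x)" if "t \<in> I" for t
      using bspec[OF add.IH(1) that] bspec[OF add.IH(2) that] by (intro set_integral_add(2)[symmetric]) blast+
    ultimately show "((\<lambda>t. LINT x:omega M|lebesgue. f t x + g t x) has_real_derivative
        (LINT x:omega M|lebesgue. f' t x + g' t x)) (at t within I)"
      unfolding r[symmetric] by (intro deriv_cong_on[OF t l])
  qed
next
  case (cong f f' g g')
  show ?case
  proof (intro ballI conjI)
    fix t assume t: "t \<in> I"
    note h = bspec[OF cong.IH t]
    have c: "(LINT x:omega M|lebesgue. f t x) = (LINT x:omega M|lebesgue. g t x)"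
      "(LINT x:omega M|lebesgue. f' t x) = (LINT x:omega M|lebesgue. g' t x)" if "t \<in> I" for t
      by (rule set_lebesgue_integral_cong; use cong.hyps that sets_omega in auto)+
    show "set_integrable lebesgue (omega M) (g t)"
      using h cong.hyps(2) t by (subst set_integrable_cong[OF refl refl, of _ _ "f t"]) auto
    show "set_integrable lebesgue (omega M) (g' t)"
      using h cong.hyps(2) t by (subst set_integrable_cong[OF refl refl, of _ _ "f' t"]) auto
    have "((\<lambda>t. LINT x:omega M|lebesgue. f t x) has_real_derivative (LINT x:omega M|lebesgue. g' t x)) (at t within I)"
      using h c[OF t] by simp
    then show "((\<lambda>t. LINT x:omega M|lebesgue. g t x) has_real_derivative (LINT x:omega M|lebesgue. g' t x)) (at t within I)"
      by (rule deriv_cong_on[OF t c(1), rotated])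
  qed
qed

lemma fe_curve_integrand:
  fixes u :: "real \<Rightarrow> sfield"
  assumes "fe_curve I W u u'" "\<And>w. w \<in> W \<Longrightarrow> pwc M w"
  shows "fe_integrand M I u u'"
proof -
  from assms(1) obtain S c c' where S: "finite S" "S \<subseteq> W"
    "\<forall>b\<in>S. \<forall>t\<in>I. (c b has_real_derivative c' b t) (at t within I)"
    "\<forall>t\<in>I. u t = (\<lambda>x. \<Sum>b\<in>S. c b t *\<^sub>R b x) \<and> u' t = (\<lambda>x. \<Sum>b\<in>S. c' b t *\<^sub>R b x)"
    unfolding fe_curve_def by (elim exE conjE)
  have "fe_integrand M I (\<lambda>t x. \<Sum>b\<in>S. c b t * b x) (\<lambda>t x. \<Sum>b\<in>S. c' b t * b x)"
    by (intro fe_integrand_sum fe_integrand.sep) (use S assms(2) in auto)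
  then show ?thesis by (rule fe_integrand.cong) (use S(4) in simp)
qed

lemma fe_curve_integrand_nth:
  fixes u :: "real \<Rightarrow> vfield"
  assumes "fe_curve I W u u'" "\<And>w. w \<in> W \<Longrightarrow> pwc M w"
  shows "fe_integrand M I (\<lambda>t x. u t x $ i) (\<lambda>t x. u' t x $ i)"
proof -
  from assms(1) obtain S c c' where S: "finite S" "S \<subseteq> W"
    "\<forall>b\<in>S. \<forall>t\<in>I. (c b has_real_derivative c' b t) (at t within I)"
    "\<forall>t\<in>I. u t = (\<lambda>x. \<Sum>b\<in>S. c b t *\<^sub>R b x) \<and> u' t = (\<lambda>x. \<Sum>b\<in>S. c' b t *\<^sub>R b x)"
    unfolding fe_curve_def by (elim exE conjE)
  have "fe_integrand M I (\<lambda>t x. \<Sum>b\<in>S. c b t * (b x $ i)) (\<lambda>t x. \<Sum>b\<in>S. c' b t * (b x $ i))"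
    by (intro fe_integrand_sum fe_integrand.sep pwc_nth) (use S assms(2) in auto)
  then show ?thesis by (rule fe_integrand.cong) (use S(4) in simp)
qed

lemma fe_integrand_inner:
  fixes u v :: "real \<Rightarrow> vfield"
  assumes "\<And>i. fe_integrand M I (\<lambda>t x. u t x $ i) (\<lambda>t x. u' t x $ i)"
    "\<And>i. fe_integrand M I (\<lambda>t x. v t x $ i) (\<lambda>t x. v' t x $ i)"
  shows "fe_integrand M I (\<lambda>t x. u t x \<bullet> v t x) (\<lambda>t x. u' t x \<bullet> v t x + u t x \<bullet> v' t x)"
proof -
  have "fe_integrand M I (\<lambda>t x. \<Sum>i\<in>UNIV. u t x $ i * v t x $ i)
     (\<lambda>t x. \<Sum>i\<in>UNIV. u' t x $ i * v t x $ i + u t x $ i * v' t x $ i)"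
    by (intro fe_integrand_sum fe_integrand_mult assms finite)
  then show ?thesis by (rule fe_integrand.cong) (simp add: inner_vec_def sum.distrib)
qed

lemma fe_curve_member:
  assumes "fe_curve I W u u'" "\<And>B c. finite B \<Longrightarrow> B \<subseteq> W \<Longrightarrow> (\<lambda>x. \<Sum>b\<in>B. c b *\<^sub>R b x) \<in> W" "t \<in> I"
  shows "u t \<in> W" "u' t \<in> W"
proof -
  from assms(1) obtain S c c' where S: "finite S" "S \<subseteq> W"
    "\<forall>t\<in>I. u t = (\<lambda>x. \<Sum>b\<in>S. c b t *\<^sub>R b x) \<and> u' t = (\<lambda>x. \<Sum>b\<in>S. c' b t *\<^sub>R b x)"
    unfolding fe_curve_def by (elim exE conjE)
  from S(3) assms(3) have "u t = (\<lambda>x. \<Sum>b\<in>S. c b t *\<^sub>R b x)" "u' t = (\<lambda>x. \<Sum>b\<in>S. c' b t *\<^sub>R b x)"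
    by blast+
  then show "u t \<in> W" "u' t \<in> W"
    using assms(2)[OF S(1,2), of "\<lambda>b. c b t"] assms(2)[OF S(1,2), of "\<lambda>b. c' b t"] by simp_all
qed


section \<open>Surface measure, Gauss-Green formula and translated cells\<close>

lemma sets_surf [simp, measurable_cong]: "sets surf = sets borel"
  and space_surf [simp]: "space surf = UNIV"
proof -
  have "sets surf = sigma_sets UNIV (sets (borel :: point measure))"
    unfolding surf_def by (rule sets_measure_of) simp
  then show "sets surf = sets borel" using sets.sigma_sets_eq[of "borel :: point measure"] by simp
  show "space surf = UNIV" unfolding surf_def by (rule space_measure_of) simp
qed

lemma vimage_plus: "(+) p -` A = (+) (- p) ` (A :: point set)"
proof
  show "(+) p -` A \<subseteq> (+) (- p) ` A"
  proof
    fix x assume "x \<in> (+) p -` A"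
    then show "x \<in> (+) (- p) ` A" by (intro image_eqI[of _ _ "p + x"]) auto
  qed
qed auto

lemma diameter_plus: "diameter ((+) p ` C) = diameter (C :: point set)"
proof -
  have "(\<lambda>(x, y). dist x y) ` ((+) p ` C \<times> (+) p ` C) = (\<lambda>(x, y). dist x y) ` (C \<times> C)"
  proof -
    have "(+) p ` C \<times> (+) p ` C = (\<lambda>(x, y). (p + x, p + y)) ` (C \<times> C)"
      by (auto simp: image_iff)
    then show ?thesis by (simp add: image_image case_prod_unfold)
  qed
  then show ?thesis unfolding diameter_def by simp
qed

text \<open>Translation maps coverings to coverings without changing diameters.\<close>

lemma hausdorff2_outer_plus: "hausdorff2_outer ((+) p ` A) = hausdorff2_outer A"
proof (rule antisym)
  have le: "hausdorff2_outer ((+) p ` A) \<le> hausdorff2_outer A" for p A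
    unfolding hausdorff2_outer_def
  proof (intro SUP_mono' INF_mono)
    fix d :: real and C :: "nat \<Rightarrow> point set"
    assume "C \<in> {C. A \<subseteq> (\<Union>i. C i) \<and> (\<forall>i. bounded (C i) \<and> diameter (C i) \<le> d)}"
    then have "(\<lambda>i. (+) p ` C i) \<in> {C. (+) p ` A \<subseteq> (\<Union>i. C i) \<and> (\<forall>i. bounded (C i) \<and> diameter (C i) \<le> d)}"
      using image_mono[of A "\<Union>i. C i" "(+) p"]
      by (simp add: diameter_plus bounded_translation image_UN)
    then show "\<exists>C'\<in>{C. (+) p ` A \<subseteq> (\<Union>i. C i) \<and> (\<forall>i. bounded (C i) \<and> diameter (C i) \<le> d)}.
        (\<Sum>i. ennreal (pi / 4 * (diameter (C' i))\<^sup>2)) \<le> (\<Sum>i. ennreal (pi / 4 * (diameter (C i))\<^sup>2))"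
      by (rule bexI[rotated]) (simp add: diameter_plus)
  qed
  show "hausdorff2_outer ((+) p ` A) \<le> hausdorff2_outer A" by (rule le)
  have "(+) (- p) ` (+) p ` A = A" by (simp add: image_image)
  then show "hausdorff2_outer A \<le> hausdorff2_outer ((+) p ` A)" using le[of "- p" "(+) p ` A"] by simp
qed

lemma borel_plus: "A \<in> sets borel \<Longrightarrow> (+) p ` A \<in> sets (borel :: point measure)"
proof -
  assume A: "A \<in> sets borel"
  have "(+) (- p) \<in> measurable borel (borel :: point measure)" by simp
  from measurable_sets[OF this A] show ?thesis by (simp add: vimage_plus)
qed

text \<open>The surface measure inherits translation invariance from the outer measure, even without Caratheodory's
  theorem: \<open>measure_of\<close> is either the given set function or the zero measure.\<close>

lemma emeasure_surf_plus:
  assumes "A \<in> sets borel"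
  shows "emeasure surf ((+) p ` A) = emeasure surf A"
proof -
  have "sigma_sets UNIV (sets borel) = sets (borel :: point measure)"
    using sets.sigma_sets_eq[of "borel :: point measure"] by simp
  then show ?thesis
    using assms borel_plus[OF assms, of p]
    unfolding surf_def emeasure_measure_of_conv by (simp add: hausdorff2_outer_plus)
qed

lemma distr_surf_plus: "distr surf surf ((+) p) = surf"
proof (rule measure_eqI)
  fix A assume "A \<in> sets (distr surf surf ((+) p))"
  then have A: "A \<in> sets borel" by simp
  have "(+) p \<in> measurable surf surf" by (simp add: measurable_cong_sets[OF sets_surf sets_surf])
  then show "emeasure (distr surf surf ((+) p)) A = emeasure surf A"
    using A emeasure_surf_plus[OF A, of "- p"] by (simp add: emeasure_distr vimage_plus)
qed simp

lemma distr_lebesgue_plus: "distr lebesgue lebesgue ((+) (p :: point)) = lebesgue"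
  and plus_measurable_lebesgue: "(+) p \<in> measurable lebesgue lebesgue"
proof -
  have T: "(\<lambda>x. p + (\<Sum>j\<in>Basis. (1 * (x \<bullet> j)) *\<^sub>R j)) = (+) p"
    by (simp add: fun_eq_iff euclidean_representation)
  show "distr lebesgue lebesgue ((+) p) = lebesgue"
    using lebesgue_affine_euclidean[of "\<lambda>_. 1" p] unfolding T by (simp add: density_1)
  show "(+) p \<in> measurable lebesgue lebesgue"
    using lebesgue_affine_measurable[of "\<lambda>_. 1" p] unfolding T by simp
qed

lemma set_integral_plus:
  fixes f :: "point \<Rightarrow> 'b::{banach, second_countable_topology}"
  assumes "distr N N ((+) p) = N" "(+) p \<in> measurable N N"
    "(\<lambda>x. indicator ((+) p ` A) x *\<^sub>R f x) \<in> borel_measurable N"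
  shows "(LINT y:(+) p ` A|N. f y) = (LINT x:A|N. f (p + x))"
    "set_integrable N ((+) p ` A) f \<longleftrightarrow> set_integrable N A (\<lambda>x. f (p + x))"
proof -
  have i: "indicator ((+) p ` A) (p + x) = (indicator A x :: real)" for x
    by (auto simp: indicator_def image_iff)
  show "(LINT y:(+) p ` A|N. f y) = (LINT x:A|N. f (p + x))"
    unfolding set_lebesgue_integral_def using integral_distr[OF assms(2,3)] assms(1) by (simp add: i)
  show "set_integrable N ((+) p ` A) f \<longleftrightarrow> set_integrable N A (\<lambda>x. f (p + x))"
    unfolding set_integrable_def using integrable_distr_eq[OF assms(2,3)] assms(1) by (simp add: i)
qed

lemma plus_measurable_surf: "(+) p \<in> measurable surf surf"
  by (simp add: measurable_cong_sets[OF sets_surf sets_surf])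

lemma borel_measurable_surf: "f \<in> borel_measurable borel \<Longrightarrow> f \<in> borel_measurable surf"
  by (simp add: measurable_cong_sets[OF sets_surf refl])

lemma set_integral_plus_surf:
  fixes f :: "point \<Rightarrow> 'b::{banach, second_countable_topology}"
  assumes "A \<in> sets borel" "f \<in> borel_measurable borel"
  shows "(LINT y:(+) p ` A|surf. f y) = (LINT x:A|surf. f (p + x))"
  by (rule set_integral_plus[OF distr_surf_plus plus_measurable_surf])
    (intro borel_measurable_surf borel_measurable_scaleR borel_measurable_indicator borel_plus assms)

lemma normal_measurable: "mesh_cell K \<Longrightarrow> normal K \<in> borel_measurable borel"
  using outward_normal_normal unfolding outward_normal_def by blast

lemma normal_unit: "mesh_cell K \<Longrightarrow> x \<in> frontier K \<Longrightarrow> norm (normal K x) = 1"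
  using outward_normal_normal unfolding outward_normal_def by blast

lemma normal_shift_measurable:
  assumes "mesh_cell K" shows "(\<lambda>x. normal K (x - q)) \<in> borel_measurable borel"
  by (rule measurable_compose[OF _ normal_measurable[OF assms]]) simp

lemma frontier_plus: "frontier ((+) p ` K) = (+) p ` frontier (K :: point set)"
  using frontier_translation[of p K] by simp

text \<open>Test functions on a periodic domain are not periodic themselves, so that the formula is needed on every
  translate of a cell, and not only on the representatives.\<close>

lemma gauss_green:
  fixes v :: vfield
  assumes "mesh_cell K" "Ck 1 v"
  shows "(LINT y:interior ((+) q ` K)|lebesgue. dvg v y) =
         (LINT y:frontier ((+) q ` K)|surf. v y \<bullet> normal K (y - q))"
proof -
  have "(LINT x:interior K|lebesgue. dvg (\<lambda>x. v (x + q)) x) = (LINT x:frontier K|surf. v (x + q) \<bullet> normal K x)"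
    using outward_normal_normal[OF assms(1)] Ck_shift[OF assms(2)] unfolding outward_normal_def by blast
  moreover have "dvg (\<lambda>x. v (x + q)) = (\<lambda>x. dvg v (q + x))"
    by (simp add: fun_eq_iff dvg_def partial_shift add.commute)
  moreover have "v (x + q) = v (q + x)" for x
    by (simp add: add.commute)
  moreover have "(LINT y:(+) q ` interior K|lebesgue. dvg v y) = (LINT x:interior K|lebesgue. dvg v (q + x))"
  proof (rule set_integral_plus[OF distr_lebesgue_plus plus_measurable_lebesgue])
    have "(\<lambda>x. indicator ((+) q ` interior K) x *\<^sub>R dvg v x) \<in> borel_measurable borel"
      by (intro borel_measurable_scaleR borel_measurable_indicator borel_plus borel_open open_interior
          borel_measurable_continuous_onI continuous_dvg assms(2))
    then show "(\<lambda>x. indicator ((+) q ` interior K) x *\<^sub>R dvg v x) \<in> borel_measurable lebesgue"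
      using measurable_completion[of _ lborel borel] by simp
  qed
  moreover have "(LINT y:(+) q ` frontier K|surf. v y \<bullet> normal K (y - q)) =
      (LINT x:frontier K|surf. v (q + x) \<bullet> normal K (q + x - q))"
    by (intro set_integral_plus_surf borel_closed frontier_closed borel_measurable_inner
        borel_measurable_continuous_onI Ck_continuous[OF assms(2)] normal_shift_measurable assms(1))
  ultimately show ?thesis unfolding interior_plus frontier_plus by simp
qed

text \<open>The normal is a unit field and the boundary of a cell has finite area.\<close>

lemma surf_integrable:
  assumes K: "mesh_cell K" and A: "A \<in> sets borel" "A \<subseteq> frontier ((+) q ` K)"
    and v: "continuous_on UNIV (v :: vfield)"
  shows "set_integrable surf A (\<lambda>x. v x \<bullet> normal K (x - q))"
proof -
  have fr: "frontier ((+) q ` K) = (+) q ` frontier K" by (rule frontier_plus)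
  have "compact (frontier ((+) q ` K))"
    unfolding fr using compact_translation[OF compact_frontier[OF mesh_cellD(1)[OF K]]] .
  then have "bounded (v ` frontier ((+) q ` K))"
    by (intro compact_imp_bounded compact_continuous_image continuous_on_subset[OF v] subset_UNIV)
  then obtain C where C: "\<And>x. x \<in> frontier ((+) q ` K) \<Longrightarrow> norm (v x) \<le> C"
    unfolding bounded_iff by blast
  have "emeasure surf A \<le> emeasure surf ((+) q ` frontier K)"
    using A fr by (intro emeasure_mono) (auto simp: borel_plus)
  also have "\<dots> = emeasure surf (frontier K)" by (rule emeasure_surf_plus) simp
  also have "\<dots> < \<infinity>" by (rule mesh_cellD(7)[OF K])
  finally have fin: "emeasure surf A < \<infinity>" .
  have bd: "norm (v x \<bullet> normal K (x - q)) \<le> C" if "x \<in> A" for x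
  proof -
    have "x \<in> (+) q ` frontier K" using that A fr by blast
    then have "norm (normal K (x - q)) = 1" using normal_unit[OF K] by auto
    then have "norm (v x \<bullet> normal K (x - q)) \<le> norm (v x)"
      using Cauchy_Schwarz_ineq2[of "v x" "normal K (x - q)"] by simp
    also have "\<dots> \<le> C" using C that A by blast
    finally show ?thesis .
  qed
  show ?thesis
    unfolding set_integrable_def
  proof (rule integrableI_bounded_set_indicator[OF _ _ fin])
    show "A \<in> sets surf" using A by simp
    show "(\<lambda>x. v x \<bullet> normal K (x - q)) \<in> borel_measurable surf"
      by (intro borel_measurable_surf borel_measurable_inner borel_measurable_continuous_onI v
          normal_shift_measurable K)
    show "AE x in surf. x \<in> A \<longrightarrow> norm (v x \<bullet> normal K (x - q)) \<le> C" using bd by simp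
  qed
qed

definition mesh_translates :: "mesh \<Rightarrow> point set \<Rightarrow> (point set \<times> point) set" where
  "mesh_translates M B = {(K, q). K \<in> Cells M \<and> q \<in> Per M \<and> (+) q ` K \<inter> B \<noteq> {}}"

text \<open>The periods are separated by a fixed distance, hence only finitely many of them are bounded by a given
  constant.\<close>

lemma finite_mesh_translates:
  assumes M: "fe_mesh M" and B: "bounded B"
  shows "finite (mesh_translates M B)"
proof -
  have "bounded (\<Union>(Cells M))"
    using fe_meshD(1,3)[OF M] mesh_cellD(1) compact_imp_bounded by (intro bounded_Union) blast+
  then obtain r where r: "\<And>x. x \<in> \<Union>(Cells M) \<Longrightarrow> norm x \<le> r" unfolding bounded_iff by blast
  obtain s where s: "\<And>x. x \<in> B \<Longrightarrow> norm x \<le> s" using B unfolding bounded_iff by blast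
  let ?P = "{q \<in> Per M. norm q \<le> r + s}"
  obtain e where e: "e > 0" "\<forall>p\<in>Per M. p \<noteq> 0 \<longrightarrow> e \<le> norm p" using fe_mesh_discrete[OF M] by blast
  have "uniform_discrete ?P"
  proof (rule uniformI2[OF e(1)])
    fix x y assume h: "x \<in> ?P" "y \<in> ?P" "x \<noteq> y"
    then have "x - y \<in> Per M" using fe_meshD(5)[OF M] by blast
    with e(2) h(3) show "e \<le> dist x y" unfolding dist_norm by simp
  qed
  moreover have "bounded ?P" by (rule boundedI[of _ "r + s"]) simp
  ultimately have "finite ?P" using uniform_discrete_finite_iff[of ?P] by blast
  moreover have "mesh_translates M B \<subseteq> Cells M \<times> ?P"
  proof (clarsimp simp: mesh_translates_def)
    fix K q assume K: "K \<in> Cells M" "q \<in> Per M" "(+) q ` K \<inter> B \<noteq> {}"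
    then obtain x where x: "x \<in> K" "q + x \<in> B" by blast
    have "norm q \<le> norm (q + x) + norm x" using norm_triangle_ineq4[of "q + x" x] by simp
    also have "\<dots> \<le> s + r" by (intro add_mono s r) (use x K in auto)
    finally show "norm q \<le> r + s" by simp
  qed
  ultimately show ?thesis using fe_meshD(1)[OF M] finite_subset by blast
qed

lemma translates_disjoint:
  assumes M: "fe_mesh M" and K: "K \<in> Cells M" "L \<in> Cells M" "p \<in> Per M" "q \<in> Per M" "(K, p) \<noteq> (L, q)"
  shows "interior ((+) p ` K) \<inter> interior ((+) q ` L) = {}"
proof -
  have "q - p \<in> Per M" using fe_meshD(5)[OF M] K by blast
  moreover have "(K, 0) \<noteq> (L, q - p)" using K(5) by auto
  ultimately have "interior K \<inter> interior ((+) (q - p) ` L) = {}"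
    using fe_mesh_disjoint(1)[OF M K(1,2)] by blast
  then have "(+) p ` (interior K \<inter> interior ((+) (q - p) ` L)) = {}" by simp
  moreover have "(+) p ` (interior K \<inter> (+) (q - p) ` interior L) = (+) p ` interior K \<inter> (+) q ` interior L"
    by (subst image_Int) (simp_all add: inj_on_def image_image)
  ultimately show ?thesis by (simp add: interior_plus)
qed

lemma translate_subset_Dom:
  assumes M: "fe_mesh M" and K: "K \<in> Cells M" "p \<in> Per M"
  shows "interior ((+) p ` K) \<subseteq> Dom M"
  using fe_meshD(4)[OF M K(1)] fe_meshD(7)[OF M K(2)] by (metis interior_plus image_mono)

lemma negligible_frontier_plus: "mesh_cell K \<Longrightarrow> negligible (frontier ((+) p ` K))"
  unfolding frontier_plus by (rule negligible_translation[OF mesh_cellD(3)])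

text \<open>The translated cells have disjoint interiors and cover the domain up to their frontiers, which are null sets.
  Only those cells that meet the support of the integrand contribute.\<close>

lemma integral_Dom_translates:
  fixes F :: "point \<Rightarrow> real"
  assumes M: "fe_mesh M" and C: "finite C" "C \<subseteq> Cells M \<times> Per M" "mesh_translates M B \<subseteq> C"
    and F: "\<And>x. x \<notin> B \<Longrightarrow> F x = 0"
    and int: "\<And>K q. (K, q) \<in> C \<Longrightarrow> set_integrable lebesgue (interior ((+) q ` K)) F"
  shows "(LINT x:Dom M|lebesgue. F x) = (\<Sum>(K,q)\<in>C. LINT x:interior ((+) q ` K)|lebesgue. F x)"
proof -
  let ?A = "\<lambda>(K,q). interior ((+) q ` K) :: point set"
  let ?U = "\<Union>c\<in>C. ?A c"
  have meas: "?A c \<in> sets lebesgue" for c by (cases c) simp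
  have "disjoint_family_on ?A C"
    unfolding disjoint_family_on_def
  proof (intro ballI impI)
    fix c d assume h: "c \<in> C" "d \<in> C" "c \<noteq> d"
    obtain K p L q where cd: "c = (K, p)" "d = (L, q)" by (cases c, cases d)
    have "K \<in> Cells M" "L \<in> Cells M" "p \<in> Per M" "q \<in> Per M" "(K, p) \<noteq> (L, q)"
      using h C(2) cd by blast+
    from translates_disjoint[OF M this] show "?A c \<inter> ?A d = {}" by (simp add: cd)
  qed
  then have sum: "(LINT x:?U|lebesgue. F x) = (\<Sum>c\<in>C. LINT x:?A c|lebesgue. F x)"
    by (intro set_integral_finite_Union C(1) meas) (use int in auto)
  have U: "set_integrable lebesgue ?U F"
    by (intro set_integrable_UN C(1) meas) (use int in auto)
  let ?N = "\<Union>(K,q)\<in>C. frontier ((+) q ` K)"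
  have "negligible ?N"
    by (intro negligible_Union finite_imageI C(1))
       (use C fe_meshD(3)[OF M] negligible_frontier_plus in auto)
  then have ae: "AE x in lebesgue. x \<notin> ?N"
    unfolding negligible_iff_null_sets by (rule AE_not_in)
  have eq: "indicator ?U x *\<^sub>R F x = indicator (Dom M) x *\<^sub>R F x" if "x \<notin> ?N" for x
  proof (cases "x \<in> Dom M \<and> x \<in> B")
    case True
    then have "x \<in> closure (Dom M)" using closure_subset by blast
    then obtain q K where K: "q \<in> Per M" "K \<in> Cells M" "x \<in> (+) q ` K"
      unfolding fe_meshD(8)[OF M] by (elim UN_E)
    then have "(K, q) \<in> mesh_translates M B" using True unfolding mesh_translates_def by blast
    then have c: "(K, q) \<in> C" using C(3) by blast
    with that have "x \<notin> frontier ((+) q ` K)" by blast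
    then have "x \<in> interior ((+) q ` K)"
      using K(3) closure_subset[of "(+) q ` K"] unfolding frontier_def by blast
    then have "x \<in> ?U" using c by (intro UN_I[of "(K, q)"]) simp_all
    then show ?thesis using True by simp
  next
    case False
    have U: "?U \<subseteq> Dom M"
    proof
      fix y assume "y \<in> ?U"
      then obtain K q where "(K, q) \<in> C" "y \<in> interior ((+) q ` K)" by auto
      then show "y \<in> Dom M" using translate_subset_Dom[OF M, of K q] C(2) by blast
    qed
    show ?thesis
    proof (cases "x \<in> B")
      case True
      with False U have "x \<notin> Dom M" "x \<notin> ?U" by blast+
      then show ?thesis by simp
    qed (simp add: F)
  qed
  have m1: "(\<lambda>x. indicator ?U x *\<^sub>R F x) \<in> borel_measurable lebesgue"
    using U unfolding set_integrable_def by (rule borel_measurable_integrable)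
  have ae': "AE x in lebesgue. indicator ?U x *\<^sub>R F x = indicator (Dom M) x *\<^sub>R F x"
    using ae by eventually_elim (rule eq)
  have "(LINT x:?U|lebesgue. F x) = (LINT x:Dom M|lebesgue. F x)"
    unfolding set_lebesgue_integral_def
    by (rule integral_cong_AE[OF m1 borel_measurable_AE[OF m1 ae'] ae'])
  then show ?thesis using sum by (simp add: case_prod_unfold)
qed

text \<open>Dynkin's theorem for the signed measures \<open>f dN\<close> and \<open>h dN'\<close>: boxes form an intersection stable
  generator of the Borel sets.\<close>

lemma signed_eq_on_borel:
  fixes f h :: "point \<Rightarrow> real"
  assumes sN: "sets borel \<subseteq> sets N" "sets borel \<subseteq> sets N'" and f: "integrable N f" and h: "integrable N' h"
    and box: "\<And>a b. (LINT x:box a b|N. f x) = (LINT x:box a b|N'. h x)"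
    and univ: "(LINT x:UNIV|N. f x) = (LINT x:UNIV|N'. h x)"
    and A: "A \<in> sets borel"
  shows "(LINT x:A|N. f x) = (LINT x:A|N'. h x)"
proof -
  let ?G = "range (\<lambda>(a, b). box a b :: point set)"
  have sub: "set_integrable N A f" "set_integrable N' A h" if "A \<in> sets borel" for A
    unfolding set_integrable_def
    using integrable_mult_indicator[OF _ f, of A] integrable_mult_indicator[OF _ h, of A] that sN by blast+
  have G: "sigma_sets UNIV ?G = sets borel" by (simp add: borel_eq_box)
  have st: "Int_stable ?G"
  proof (rule Int_stableI)
    fix a b assume "a \<in> ?G" "b \<in> ?G"
    then show "a \<inter> b \<in> ?G" by (clarsimp simp: box_Int_box) (metis (mono_tags, lifting) case_prod_conv rangeI)
  qed
  have "A \<in> sigma_sets UNIV ?G" using A G by blast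
  note A' = this
  have cl: "?G \<subseteq> Pow UNIV" by simp
  from st cl A' show ?thesis
  proof (induction rule: sigma_sets_induct_disjoint)
    case (basic A)
    then show ?case using box by auto
  next
    case empty
    show ?case by (simp add: set_lebesgue_integral_def)
  next
    case (compl A)
    have A: "A \<in> sets borel" "UNIV - A \<in> sets borel" using compl(1) G by auto
    have "(LINT x:(UNIV - A) \<union> A|N. f x) = (LINT x:UNIV - A|N. f x) + (LINT x:A|N. f x)"
      "(LINT x:(UNIV - A) \<union> A|N'. h x) = (LINT x:UNIV - A|N'. h x) + (LINT x:A|N'. h x)"
      by (intro set_integral_Un sub A; blast)+
    then show ?case using compl(2) univ by simp
  next
    case (union A)
    have A: "A i \<in> sets borel" "(\<Union>i. A i) \<in> sets borel" for i using union(2) G by auto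
    have d: "A i \<inter> A j = {}" if "i \<noteq> j" for i j
      using union(1) that unfolding disjoint_family_on_def by blast
    have "(LINT x:(\<Union>i. A i)|N. f x) = (\<Sum>i. LINT x:A i|N. f x)"
      by (intro lebesgue_integral_countable_add d sub A) (use A sN in blast)+
    moreover have "(LINT x:(\<Union>i. A i)|N'. h x) = (\<Sum>i. LINT x:A i|N'. h x)"
      by (intro lebesgue_integral_countable_add d sub A) (use A sN in blast)+
    ultimately show ?case using union(3) by simp
  qed
qed


section \<open>The flux of a weakly differentiable field through the skeleton\<close>

text \<open>The defining property of \<open>Hdiv\<close>, with the weak divergence \<open>g\<close> made explicit. The \<open>H1\<close> condition on a
  scalar \<open>f\<close> says that the fields \<open>f e\<^sub>i\<close> have weak divergences; so one continuity result serves both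
  spaces.\<close>

definition weak_dvg :: "mesh \<Rightarrow> vfield \<Rightarrow> sfield \<Rightarrow> bool" where
  "weak_dvg M u g \<longleftrightarrow> g \<in> L2 M \<and> (\<forall>\<phi>::sfield. test_function (Dom M) \<phi> \<longrightarrow>
     (LINT x:Dom M|lebesgue. u x \<bullet> grad \<phi> x) = - (LINT x:Dom M|lebesgue. g x * \<phi> x))"

lemma Hdiv_weak_dvg: "u \<in> Hdiv M \<Longrightarrow> \<exists>g. weak_dvg M u g"
  unfolding Hdiv_def weak_dvg_def by blast

lemma continuous_lebesgue_measurable:
  fixes f :: "point \<Rightarrow> 'b::euclidean_space"
  assumes "continuous_on UNIV f" shows "f \<in> borel_measurable lebesgue"
proof -
  have "f \<in> borel_measurable lborel"
    using borel_measurable_continuous_onI[OF assms] by simp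
  then show ?thesis by (rule measurable_completion)
qed

lemma L2_nth:
  fixes g :: vfield
  assumes "g \<in> L2 M" shows "(\<lambda>x. g x $ i) \<in> L2 M"
proof -
  have m: "set_borel_measurable lebesgue (omega M) g"
    and i: "set_integrable lebesgue (omega M) (\<lambda>x. (norm (g x))\<^sup>2)" and p: "periodic M g"
    using assms unfolding L2_def by blast+
  have "(\<lambda>x. (indicator (omega M) x *\<^sub>R g x) $ i) \<in> borel_measurable lebesgue"
    by (rule measurable_compose[OF m[unfolded set_borel_measurable_def]]) simp
  then have m': "set_borel_measurable lebesgue (omega M) (\<lambda>x. g x $ i)"
    unfolding set_borel_measurable_def by simp
  have "(\<lambda>x. (indicator (omega M) x *\<^sub>R (g x $ i)) * (g x $ i)) = (\<lambda>x. (indicator (omega M) x *\<^sub>R (g x $ i)) * (indicator (omega M) x *\<^sub>R (g x $ i)))"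
    by (auto simp: fun_eq_iff indicator_def)
  moreover have "(\<lambda>x. (indicator (omega M) x *\<^sub>R (g x $ i)) * (indicator (omega M) x *\<^sub>R (g x $ i))) \<in> borel_measurable lebesgue"
    using m' unfolding set_borel_measurable_def by (intro borel_measurable_times)
  ultimately have m2: "set_borel_measurable lebesgue (omega M) (\<lambda>x. (norm (g x $ i))\<^sup>2)"
    unfolding set_borel_measurable_def by (simp add: power2_eq_square mult.assoc)
  have "set_integrable lebesgue (omega M) (\<lambda>x. (norm (g x $ i))\<^sup>2)"
  proof (rule set_integrable_bound[OF i m2])
    have "(g x $ i)\<^sup>2 \<le> (norm (g x))\<^sup>2" for x
      using power_mono[OF component_le_norm_cart[of "g x" i] abs_ge_zero, of 2] by simp
    then show "AE x in lebesgue. x \<in> omega M \<longrightarrow> norm ((norm (g x $ i))\<^sup>2) \<le> norm ((norm (g x))\<^sup>2)"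
      by simp
  qed
  then show ?thesis using m' p unfolding L2_def periodic_def by simp
qed

text \<open>Vector test functions of the form \<open>\<phi> e\<^sub>i\<close> turn the weak gradient into a weak divergence.\<close>

lemma H1_weak_dvg:
  fixes i :: 3
  assumes "f \<in> H1 M" shows "\<exists>g. weak_dvg M (\<lambda>x. f x *\<^sub>R axis i 1) g"
proof -
  from assms obtain g where g: "g \<in> L2 M" "\<And>\<phi>::vfield. test_function (Dom M) \<phi> \<Longrightarrow>
     (LINT x:Dom M|lebesgue. f x * dvg \<phi> x) = - (LINT x:Dom M|lebesgue. g x \<bullet> \<phi> x)"
    unfolding H1_def by blast
  have "weak_dvg M (\<lambda>x. f x *\<^sub>R axis i 1) (\<lambda>x. g x $ i)"
    unfolding weak_dvg_def
  proof (intro conjI allI impI L2_nth[OF g(1)])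
    fix \<phi> :: sfield assume t: "test_function (Dom M) \<phi>"
    then have C: "Ck (Suc 0) \<phi>" unfolding test_function_def smooth_def by blast
    have "test_function (Dom M) (\<lambda>x. \<phi> x *\<^sub>R axis i (1::real) :: point)"
    proof -
      obtain A where A: "compact A" "A \<subseteq> Dom M" "\<And>x. x \<notin> A \<Longrightarrow> \<phi> x = 0"
        using t unfolding test_function_def by blast
      have "smooth (\<lambda>x. \<phi> x *\<^sub>R axis i (1::real) :: point)"
        using t unfolding test_function_def smooth_def by (intro allI Ck_scaleR Ck_const) blast
      then show ?thesis
        unfolding test_function_def using A by (intro conjI exI[of _ A]) simp_all
    qed
    from g(2)[OF this]
    have "(LINT x:Dom M|lebesgue. f x * dvg (\<lambda>x. \<phi> x *\<^sub>R axis i 1) x) = - (LINT x:Dom M|lebesgue. g x \<bullet> (\<phi> x *\<^sub>R axis i 1))" .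
    moreover have "dvg (\<lambda>x. \<phi> x *\<^sub>R axis i 1) x = grad \<phi> x \<bullet> axis i 1" for x
      by (subst dvg_scaleR[OF Ck_differentiable[OF C]]) (simp_all add: dvg_def)
    ultimately show "(LINT x:Dom M|lebesgue. f x *\<^sub>R axis i 1 \<bullet> grad \<phi> x) = - (LINT x:Dom M|lebesgue. g x $ i * \<phi> x)"
      by (simp add: inner_axis inner_commute[of "axis i 1"] mult.commute)
  qed
  then show ?thesis by blast
qed

lemma L2_integrable_translate:
  fixes g :: sfield
  assumes g: "g \<in> L2 M" and M: "fe_mesh M" and K: "K \<in> Cells M" "q \<in> Per M"
  shows "set_integrable lebesgue (interior ((+) q ` K)) g"
proof -
  have m: "set_borel_measurable lebesgue (omega M) g"
    and i: "set_integrable lebesgue (omega M) (\<lambda>x. (norm (g x))\<^sup>2)" and p: "periodic M g"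
    using g unfolding L2_def by blast+
  have "set_integrable lebesgue (omega M) (\<lambda>x. 1 + (norm (g x))\<^sup>2)"
    by (intro set_integral_add(1) i pwc_integrable[OF M] pwc_const)
  then have "set_integrable lebesgue (omega M) g"
  proof (rule set_integrable_bound[OF _ m])
    have "norm (g x) \<le> 1 + (norm (g x))\<^sup>2" for x
      using zero_le_power2[of "norm (g x) - 1"] by (simp add: power2_eq_square algebra_simps)
    then show "AE x in lebesgue. x \<in> omega M \<longrightarrow> norm (g x) \<le> norm (1 + (norm (g x))\<^sup>2)"
      by simp
  qed
  then have "set_integrable lebesgue (interior K) g"
    by (rule set_integrable_subset) (use K in \<open>auto simp: omega_def\<close>)
  then have I: "integrable lebesgue (\<lambda>x. indicator (interior K) x *\<^sub>R g x)" unfolding set_integrable_def .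
  have "integrable lebesgue (\<lambda>y. indicator (interior K) (- q + y) *\<^sub>R g (- q + y))"
    using integrable_distr[OF plus_measurable_lebesgue[of "- q"]] I distr_lebesgue_plus[of "- q"] by simp
  moreover have "indicator (interior K) (- q + y) *\<^sub>R g (- q + y) = indicator (interior ((+) q ` K)) y *\<^sub>R g y" for y
  proof -
    have "g (- q + y + q) = g (- q + y)" using p K(2) unfolding periodic_def by blast
    moreover have "- q + y \<in> interior K \<longleftrightarrow> y \<in> (+) q ` interior K"
      by (auto simp: image_iff) (metis add.commute diff_add_cancel)
    ultimately show ?thesis by (simp add: interior_plus indicator_def)
  qed
  ultimately show ?thesis unfolding set_integrable_def by simp
qed

lemma grad_bump_eq_0: "x \<notin> cbox a b \<Longrightarrow> grad (bump a b n) x = 0"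
proof -
  assume "x \<notin> cbox a b"
  then have "grad (bump a b n) x = grad (\<lambda>_. 0) x"
    by (intro grad_cong_open[of "- cbox a b"] bump_eq_0 open_Compl closed_cbox)
       (use box_subset_cbox[of a b] in blast)+
  then show ?thesis by simp
qed

lemma continuous_translate_integrable:
  fixes g :: "point \<Rightarrow> 'b::euclidean_space"
  assumes "mesh_cell K" "continuous_on UNIV g"
  shows "set_integrable lebesgue (interior ((+) q ` K)) g"
  by (rule continuous_set_integrable[OF compact_translation[OF mesh_cellD(1)[OF assms(1)], of q] assms(2)])
     (simp_all add: interior_subset)

text \<open>Summed over all cells, the normal traces of a weakly differentiable field form a signed measure on the
  skeleton that has a density \<open>h\<close> with respect to the Lebesgue measure. The reason is Gauss-Green on every
  cell, applied to a bump times the field: the terms with the gradient of the bump add up to the left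
  side of the weak formula and are replaced by its right side, which contains the bump undifferentiated. As the
  bumps tend to the indicator of a box, all terms converge.\<close>

lemma skeleton_flux_box:
  fixes u :: vfield and G :: "point set \<Rightarrow> vfield"
  defines "fr \<equiv> \<lambda>(K, q). frontier ((+) q ` K) :: point set"
  defines "w \<equiv> \<lambda>(K, q) x. G K (x - q) \<bullet> normal K (x - q)"
  assumes M: "fe_mesh M" and u: "weak_dvg M u g" and per: "periodic M u"
    and G: "\<And>K. K \<in> Cells M \<Longrightarrow> Ck 1 (G K)" "\<And>K x. K \<in> Cells M \<Longrightarrow> x \<in> interior K \<Longrightarrow> u x = G K x"
    and D: "cbox a0 b0 \<subseteq> Dom M"
    and C: "finite C" "C \<subseteq> Cells M \<times> Per M" "mesh_translates M (cbox a0 b0) \<subseteq> C"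
  shows "integrable surf (\<lambda>x. \<Sum>c\<in>C. indicator (fr c) x * w c x)"
    "\<exists>h. integrable lebesgue h \<and> (\<forall>a b. cbox a b \<subseteq> cbox a0 b0 \<longrightarrow>
       (LINT x:box a b|surf. (\<Sum>c\<in>C. indicator (fr c) x * w c x)) = (LINT x:box a b|lebesgue. h x))"
proof -
  define int where "int = (\<lambda>(K, q). interior ((+) q ` K) :: point set)"
  define U where "U = (\<lambda>(K, q) x. G K (x - q))"
  define f where "f = (\<lambda>x. \<Sum>c\<in>C. indicator (fr c) x * w c x)"
  \<comment> \<open>the density is the difference of the cell-wise and the weak divergence\<close>
  define h where "h = (\<lambda>x. \<Sum>c\<in>C. indicator (int c) x * (dvg (U c) x - g x))"
  have cell: "mesh_cell (fst c)" "fst c \<in> Cells M" "snd c \<in> Per M" if "c \<in> C" for c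
    using that C(2) fe_meshD(3)[OF M] by auto
  have gL2: "g \<in> L2 M" and weak: "\<And>\<phi>::sfield. test_function (Dom M) \<phi> \<Longrightarrow>
     (LINT x:Dom M|lebesgue. u x \<bullet> grad \<phi> x) = - (LINT x:Dom M|lebesgue. g x * \<phi> x)"
    using u unfolding weak_dvg_def by blast+
  have UC: "Ck 1 (U c)" if "c \<in> C" for c
    using Ck_shift[OF G(1)[OF cell(2)[OF that]], of "- snd c"] by (simp add: U_def case_prod_unfold)
  have uU: "u x = U c x" if c: "c \<in> C" and x: "x \<in> int c" for c x
  proof -
    obtain y where y: "y \<in> interior (fst c)" "x = snd c + y"
      using x unfolding int_def interior_plus case_prod_unfold by (elim imageE) blast
    have "u (y + snd c) = u y" using per cell(3)[OF c] unfolding periodic_def by blast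
    also have "u y = G (fst c) y" by (rule G(2)[OF cell(2)[OF c] y(1)])
    finally show ?thesis by (simp add: y(2) U_def case_prod_unfold add.commute)
  qed
  have si: "set_integrable surf (fr c) (\<lambda>x. v x \<bullet> normal (fst c) (x - snd c))"
    if "c \<in> C" "continuous_on UNIV v" for c and v :: vfield
    using surf_integrable[OF cell(1)[OF that(1)], of "fr c" "snd c" v] that(2)
    by (simp add: fr_def case_prod_unfold)
  have wU: "w c x = U c x \<bullet> normal (fst c) (x - snd c)" for c x
    by (simp add: w_def U_def case_prod_unfold)
  have fint: "integrable surf f"
    unfolding f_def
    by (intro Bochner_Integration.integrable_sum)
       (use si Ck_continuous[OF UC] in \<open>simp add: set_integrable_def wU\<close>)
  have ci: "set_integrable lebesgue (int c) k" if "c \<in> C" "continuous_on UNIV k"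
    for c and k :: sfield
    using continuous_translate_integrable[OF cell(1)[OF that(1)] that(2), of "snd c"]
    by (simp add: int_def case_prod_unfold)
  have gi: "set_integrable lebesgue (int c) g" if "c \<in> C" for c
    using L2_integrable_translate[OF gL2 M cell(2,3)[OF that]] by (simp add: int_def case_prod_unfold)
  have dgi: "set_integrable lebesgue (int c) (\<lambda>x. dvg (U c) x - g x)" if "c \<in> C" for c
    by (intro set_integral_diff(1) ci gi that continuous_dvg UC)
  have hint: "integrable lebesgue h"
    unfolding h_def
    by (intro Bochner_Integration.integrable_sum) (use dgi in \<open>simp add: set_integrable_def\<close>)
  have mint: "int c \<in> sets lebesgue" for c by (cases c) (simp add: int_def)
  have "(LINT x:box a b|surf. f x) = (LINT x:box a b|lebesgue. h x)" if ab: "cbox a b \<subseteq> cbox a0 b0" for a b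
  proof -
    have eq: "(LINT x|surf. bump a b n x * f x) = (LINT x|lebesgue. bump a b n x * h x)" for n
    proof -
      let ?\<phi> = "bump a b n"
      have phiC: "Ck (Suc 0) ?\<phi>" by (rule Ck_bump)
      have cphi: "continuous_on UNIV ?\<phi>" by (rule Ck_continuous[OF phiC])
      have phi_int: "set_integrable lebesgue (int c) (\<lambda>x. ?\<phi> x * k x)"
        if "set_integrable lebesgue (int c) k" for c and k :: sfield
      proof (rule set_integrable_bound[OF that])
        have "(\<lambda>x. ?\<phi> x * (indicator (int c) x *\<^sub>R k x)) \<in> borel_measurable lebesgue"
          using that unfolding set_integrable_def
          by (intro borel_measurable_times continuous_lebesgue_measurable cphi borel_measurable_integrable)
        then show "set_borel_measurable lebesgue (int c) (\<lambda>x. ?\<phi> x * k x)"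
          unfolding set_borel_measurable_def by (simp add: mult.left_commute)
        show "AE x in lebesgue. x \<in> int c \<longrightarrow> norm (?\<phi> x * k x) \<le> norm (k x)"
          using bump_nonneg[of a b n] bump_le_1[of a b n]
          by (auto simp: abs_mult intro!: mult_left_le_one_le)
      qed
      have cellid: "(LINT x:fr c|surf. ?\<phi> x * w c x) =
          (LINT x:int c|lebesgue. ?\<phi> x * (dvg (U c) x - g x)) +
          ((LINT x:int c|lebesgue. u x \<bullet> grad ?\<phi> x) + (LINT x:int c|lebesgue. g x * ?\<phi> x))"
        and ui: "set_integrable lebesgue (int c) (\<lambda>x. u x \<bullet> grad ?\<phi> x)"
        and gpi: "set_integrable lebesgue (int c) (\<lambda>x. g x * ?\<phi> x)" if c: "c \<in> C" for c
      proof -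
        have Ug: "set_integrable lebesgue (int c) (\<lambda>x. U c x \<bullet> grad ?\<phi> x)"
          using phiC by (intro ci[OF c] continuous_on_inner continuous_grad Ck_continuous[OF UC[OF c]]) simp
        show ui: "set_integrable lebesgue (int c) (\<lambda>x. u x \<bullet> grad ?\<phi> x)"
          using Ug uU[OF c] by (subst set_integrable_cong[OF refl refl]) auto
        show gpi: "set_integrable lebesgue (int c) (\<lambda>x. g x * ?\<phi> x)"
          using phi_int[OF gi[OF c]] by (simp add: mult.commute)
        have "(LINT x:fr c|surf. ?\<phi> x * w c x) =
              (LINT y:frontier ((+) (snd c) ` fst c)|surf. (?\<phi> y *\<^sub>R U c y) \<bullet> normal (fst c) (y - snd c))"
          by (simp add: wU fr_def case_prod_unfold)
        also have "\<dots> = (LINT y:interior ((+) (snd c) ` fst c)|lebesgue. dvg (\<lambda>y. ?\<phi> y *\<^sub>R U c y) y)"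
          using phiC UC[OF c] by (intro gauss_green[symmetric] cell(1)[OF c] Ck_scaleR) simp_all
        also have "\<dots> = (LINT x:int c|lebesgue. dvg (\<lambda>y. ?\<phi> y *\<^sub>R U c y) x)"
          by (simp add: int_def case_prod_unfold)
        also have "\<dots> = (LINT x:int c|lebesgue. ?\<phi> x * (dvg (U c) x - g x) + (u x \<bullet> grad ?\<phi> x + g x * ?\<phi> x))"
        proof (rule set_lebesgue_integral_cong[OF mint], intro allI impI)
          fix x assume "x \<in> int c"
          then have "u x = U c x" using uU[OF c] by blast
          moreover have "U c differentiable (at x)"
            using UC[OF c] Ck_differentiable[of 0 "U c"] by simp
          ultimately show "dvg (\<lambda>y. ?\<phi> y *\<^sub>R U c y) x = ?\<phi> x * (dvg (U c) x - g x) + (u x \<bullet> grad ?\<phi> x + g x * ?\<phi> x)"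
            by (subst dvg_scaleR[OF Ck_differentiable[OF phiC]]) (simp_all add: algebra_simps inner_commute)
        qed
        also have "\<dots> = (LINT x:int c|lebesgue. ?\<phi> x * (dvg (U c) x - g x)) +
          (LINT x:int c|lebesgue. u x \<bullet> grad ?\<phi> x + g x * ?\<phi> x)"
          by (rule set_integral_add(2)[OF phi_int[OF dgi[OF c]] set_integral_add(1)[OF ui gpi]])
        also have "(LINT x:int c|lebesgue. u x \<bullet> grad ?\<phi> x + g x * ?\<phi> x) =
          (LINT x:int c|lebesgue. u x \<bullet> grad ?\<phi> x) + (LINT x:int c|lebesgue. g x * ?\<phi> x)"
          by (rule set_integral_add(2)[OF ui gpi])
        finally show "(LINT x:fr c|surf. ?\<phi> x * w c x) =
          (LINT x:int c|lebesgue. ?\<phi> x * (dvg (U c) x - g x)) +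
          ((LINT x:int c|lebesgue. u x \<bullet> grad ?\<phi> x) + (LINT x:int c|lebesgue. g x * ?\<phi> x))" .
      qed
      have out: "?\<phi> x = 0" "grad ?\<phi> x = 0" if "x \<notin> cbox a0 b0" for x
        using that ab box_subset_cbox[of a b] bump_eq_0[of x a b n] grad_bump_eq_0[of x a b n] by blast+
      have Dom: "(LINT x:Dom M|lebesgue. k x) = (\<Sum>c\<in>C. LINT x:int c|lebesgue. k x)"
        if k: "\<And>c. c \<in> C \<Longrightarrow> set_integrable lebesgue (int c) k" "\<And>x. x \<notin> cbox a0 b0 \<Longrightarrow> k x = 0"
        for k :: sfield
      proof -
        have "set_integrable lebesgue (interior ((+) q ` K)) k" if "(K, q) \<in> C" for K q
          using k(1)[OF that] unfolding int_def by simp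
        from integral_Dom_translates[OF M C k(2) this] show ?thesis
          by (simp add: int_def case_prod_unfold)
      qed
      have "(LINT x:Dom M|lebesgue. u x \<bullet> grad ?\<phi> x) = (\<Sum>c\<in>C. LINT x:int c|lebesgue. u x \<bullet> grad ?\<phi> x)"
        by (intro Dom ui) (simp_all add: out)
      moreover have "(LINT x:Dom M|lebesgue. g x * ?\<phi> x) = (\<Sum>c\<in>C. LINT x:int c|lebesgue. g x * ?\<phi> x)"
        by (intro Dom gpi) (simp_all add: out)
      moreover have "test_function (Dom M) ?\<phi>"
        using test_function_bump[of a b "Dom M" n "1::real"] ab D by simp
      \<comment> \<open>the weak formula, in which the gradient of the bump cancels\<close>
      ultimately have zero: "(\<Sum>c\<in>C. LINT x:int c|lebesgue. u x \<bullet> grad ?\<phi> x) +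
          (\<Sum>c\<in>C. LINT x:int c|lebesgue. g x * ?\<phi> x) = 0"
        using weak[of ?\<phi>] by simp
      have "(LINT x|surf. ?\<phi> x * f x) = (LINT x|surf. (\<Sum>c\<in>C. indicator (fr c) x *\<^sub>R (?\<phi> x * w c x)))"
        by (simp add: f_def sum_distrib_left mult_ac)
      also have "\<dots> = (\<Sum>c\<in>C. LINT x:fr c|surf. ?\<phi> x * w c x)"
        unfolding set_lebesgue_integral_def
      proof (rule Bochner_Integration.integral_sum)
        fix c assume c: "c \<in> C"
        have "set_integrable surf (fr c) (\<lambda>x. (?\<phi> x *\<^sub>R U c x) \<bullet> normal (fst c) (x - snd c))"
          by (intro si[OF c] continuous_on_scaleR cphi Ck_continuous[OF UC[OF c]])
        then show "integrable surf (\<lambda>x. indicator (fr c) x *\<^sub>R (?\<phi> x * w c x))"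
          unfolding set_integrable_def by (simp add: wU)
      qed
      also have "\<dots> = (\<Sum>c\<in>C. LINT x:int c|lebesgue. ?\<phi> x * (dvg (U c) x - g x))"
        using cellid zero by (simp add: sum.distrib)
      also have "\<dots> = (LINT x|lebesgue. (\<Sum>c\<in>C. indicator (int c) x *\<^sub>R (?\<phi> x * (dvg (U c) x - g x))))"
        unfolding set_lebesgue_integral_def
        by (rule Bochner_Integration.integral_sum[symmetric])
           (use phi_int[OF dgi] in \<open>simp add: set_integrable_def\<close>)
      also have "\<dots> = (LINT x|lebesgue. ?\<phi> x * h x)"
        by (simp add: h_def sum_distrib_left mult_ac)
      finally show ?thesis .
    qed
    have lim: "(\<lambda>n. LINT x|N. bump a b n x * k x) \<longlonglongrightarrow> (LINT x:box a b|N. k x)"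
      if N: "sets borel \<subseteq> sets N" "space N = UNIV" and k: "integrable N k" for N and k :: sfield
      unfolding set_lebesgue_integral_def
    proof (rule integral_dominated_convergence[where w = "\<lambda>x. norm (k x)"])
      have bm: "bump a b n \<in> borel_measurable N" for n
      proof (rule measurableI)
        fix A :: "real set" assume "A \<in> sets borel"
        then have "bump a b n -` A \<inter> space borel \<in> sets borel"
          by (rule measurable_sets[OF borel_measurable_continuous_onI[OF Ck_continuous[OF Ck_bump[of 0 a b n]]]])
        then show "bump a b n -` A \<inter> space N \<in> sets N" using N by auto
      qed simp
      show "(\<lambda>x. indicator (box a b) x *\<^sub>R k x) \<in> borel_measurable N"
        by (intro borel_measurable_scaleR borel_measurable_indicator borel_measurable_integrable[OF k])
           (use N in auto)
      show "(\<lambda>x. bump a b n x * k x) \<in> borel_measurable N" for n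
        by (intro borel_measurable_times bm borel_measurable_integrable[OF k])
      show "integrable N (\<lambda>x. norm (k x))" using k by simp
      show "AE x in N. (\<lambda>n. bump a b n x * k x) \<longlonglongrightarrow> indicat_real (box a b) x *\<^sub>R k x"
        by (intro AE_I2) (simp add: bump_tendsto tendsto_mult_right)
      show "AE x in N. norm (bump a b n x * k x) \<le> norm (k x)" for n
        using bump_nonneg[of a b n] bump_le_1[of a b n]
        by (auto simp: abs_mult intro!: mult_left_le_one_le)
    qed
    have "(\<lambda>n. LINT x|surf. bump a b n x * f x) \<longlonglongrightarrow> (LINT x:box a b|surf. f x)"
      by (rule lim[OF _ _ fint]) simp_all
    moreover have "(\<lambda>n. LINT x|surf. bump a b n x * f x) \<longlonglongrightarrow> (LINT x:box a b|lebesgue. h x)"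
      unfolding eq by (rule lim[OF _ _ hint]) auto
    ultimately show ?thesis by (rule LIMSEQ_unique)
  qed
  then show "integrable surf (\<lambda>x. \<Sum>c\<in>C. indicator (fr c) x * w c x)"
    "\<exists>h. integrable lebesgue h \<and> (\<forall>a b. cbox a b \<subseteq> cbox a0 b0 \<longrightarrow>
       (LINT x:box a b|surf. (\<Sum>c\<in>C. indicator (fr c) x * w c x)) = (LINT x:box a b|lebesgue. h x))"
    using fint hint unfolding f_def by blast+
qed


section \<open>Continuity of normal traces across facets\<close>

lemma all_facetsD:
  assumes "(K, L, p) \<in> all_facets M"
  shows "K \<in> Cells M" "L \<in> Cells M" "p \<in> Per M" "(K, 0) \<noteq> (L, p)"
  using assms unfolding all_facets_def by auto

lemma overlap_subset_frontier:
  assumes M: "fe_mesh M" and K: "K \<in> Cells M" "L \<in> Cells M" "p \<in> Per M" "q \<in> Per M" "(K, p) \<noteq> (L, q)"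
  shows "(+) p ` K \<inter> (+) q ` L \<subseteq> frontier ((+) p ` K)"
proof
  fix x assume x: "x \<in> (+) p ` K \<inter> (+) q ` L"
  have "closure (interior ((+) q ` L)) = (+) q ` L"
    by (rule closure_interior_plus[OF mesh_cellD(2)[OF fe_meshD(3)[OF M K(2)]]])
  with x have xc: "x \<in> closure (interior ((+) q ` L))" by blast
  have "interior ((+) p ` K) \<inter> closure (interior ((+) q ` L)) = {}"
    using translates_disjoint[OF M K] open_Int_closure_eq_empty[OF open_interior] by blast
  with xc have "x \<notin> interior ((+) p ` K)" by blast
  then show "x \<in> frontier ((+) p ` K)"
    using x closure_subset[of "(+) p ` K"] unfolding frontier_def by blast
qed

lemma fset_frontier:
  assumes M: "fe_mesh M" and e: "(K, L, p) \<in> all_facets M"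
  shows "fset (K, L, p) \<subseteq> frontier K" "fset (K, L, p) \<subseteq> frontier ((+) p ` L)"
proof -
  note d = all_facetsD[OF e]
  show "fset (K, L, p) \<subseteq> frontier K"
    using overlap_subset_frontier[OF M d(1,2) fe_meshD(2)[OF M] d(3,4)] by simp
  have "(L, p) \<noteq> (K, 0)" using d(4) by auto
  from overlap_subset_frontier[OF M d(2,1,3) fe_meshD(2)[OF M] this]
  show "fset (K, L, p) \<subseteq> frontier ((+) p ` L)" by (simp add: Int_commute)
qed

lemma closed_cell_plus: "fe_mesh M \<Longrightarrow> K \<in> Cells M \<Longrightarrow> closed ((+) p ` K)"
  by (intro closed_translation mesh_cellD(4) fe_meshD(3))

lemma closed_fset: "fe_mesh M \<Longrightarrow> (K, L, p) \<in> all_facets M \<Longrightarrow> closed (fset (K, L, p))"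
  using closed_cell_plus[of M K 0] closed_cell_plus[of M L p] all_facetsD[of K L p M]
  by (simp add: closed_Int)

text \<open>A facet is a Lebesgue null set. So the signed measure of \<open>skeleton_flux_box\<close>, which has a Lebesgue
  density, vanishes on all its subsets. On the facet only its two sides contribute to this measure, because a
  third cell meets it in a null set; hence the sum of the two outward normal traces vanishes.\<close>

lemma normal_jump_local:
  fixes u :: vfield and G :: "point set \<Rightarrow> vfield"
  defines "j \<equiv> \<lambda>(K, L, p) x. G K x \<bullet> normal K x + G L (x - p) \<bullet> normal L (x - p)"
  assumes M: "fe_mesh M" and u: "weak_dvg M u g" and per: "periodic M u"
    and G: "\<And>K. K \<in> Cells M \<Longrightarrow> Ck 1 (G K)" "\<And>K x. K \<in> Cells M \<Longrightarrow> x \<in> interior K \<Longrightarrow> u x = G K x"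
    and D: "cbox lo hi \<subseteq> Dom M"
    and e: "(K, L, p) \<in> all_facets M"
  shows "AE x in surf. x \<in> fset (K, L, p) \<inter> box lo hi \<longrightarrow> j (K, L, p) x = 0"
proof -
  note ed = all_facetsD[OF e]
  define C where "C = insert (K, 0) (insert (L, p) (mesh_translates M (cbox lo hi)))"
  define fr where "fr = (\<lambda>(K, q). frontier ((+) q ` K) :: point set)"
  define w where "w = (\<lambda>(K, q) x. G K (x - q) \<bullet> normal K (x - q))"
  define A0 where "A0 = fset (K, L, p) \<inter> box lo hi"
  define f where "f = (\<lambda>x. \<Sum>c\<in>C. indicator (fr c) x * w c x)"
  have C: "finite C" "C \<subseteq> Cells M \<times> Per M" "mesh_translates M (cbox lo hi) \<subseteq> C"
    using finite_mesh_translates[OF M bounded_cbox] ed fe_meshD(2)[OF M]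
    unfolding C_def mesh_translates_def by auto
  have A0: "A0 \<in> sets borel" unfolding A0_def
    by (intro sets.Int borel_closed closed_fset[OF M e] borel_open open_box)
  have fint: "integrable surf f"
    unfolding f_def fr_def w_def by (rule skeleton_flux_box(1)[OF M u per G D C])
  have "\<exists>h. integrable lebesgue h \<and> (\<forall>a b. cbox a b \<subseteq> cbox lo hi \<longrightarrow>
       (LINT x:box a b|surf. f x) = (LINT x:box a b|lebesgue. h x))"
    unfolding f_def fr_def w_def by (rule skeleton_flux_box(2)[OF M u per G D C])
  then obtain h where hint: "integrable lebesgue h" and hbox: "\<forall>a b. cbox a b \<subseteq> cbox lo hi \<longrightarrow>
       (LINT x:box a b|surf. f x) = (LINT x:box a b|lebesgue. h x)"
    by (elim exE conjE)
  note h = hint hbox[rule_format]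
  have jw: "j (K, L, p) x = w (K, 0) x + w (L, p) x" for x by (simp add: j_def w_def)
  have AEf: "AE x in surf. x \<in> A0 \<longrightarrow> f x = j (K, L, p) x"
  proof -
    let ?N = "\<lambda>(K', q). K \<inter> (+) p ` L \<inter> (+) q ` K'"
    have "?N c \<in> null_sets surf" if "c \<in> C - {(K, 0), (L, p)}" for c
    proof -
      obtain K' q where c: "c = (K', q)" by (cases c)
      have K': "K' \<in> Cells M" "q \<in> Per M" using that C(2) c by auto
      have "emeasure surf (K \<inter> (+) p ` L \<inter> (+) q ` K') = 0"
        by (rule fe_mesh_triple[OF M ed(1,2) K'(1) ed(3) K'(2) ed(4)]) (use that c in auto)
      moreover have "K \<inter> (+) p ` L \<inter> (+) q ` K' \<in> sets borel"
        using closed_cell_plus[OF M ed(1), of 0]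
        by (intro borel_closed closed_Int closed_cell_plus[OF M ed(2)] closed_cell_plus[OF M K'(1)]) simp
      ultimately show ?thesis by (simp add: c null_setsI)
    qed
    then have "(\<Union>c\<in>C - {(K, 0), (L, p)}. ?N c) \<in> null_sets surf"
      using C(1) by (intro null_sets.finite_UN) auto
    from AE_not_in[OF this] show ?thesis
    proof eventually_elim
      case (elim x)
      show ?case
      proof
        assume x: "x \<in> A0"
        have "f x = (\<Sum>c\<in>{(K, 0), (L, p)}. indicator (fr c) x * w c x)"
          unfolding f_def
        proof (rule sum.mono_neutral_right[OF C(1)])
          show "{(K, 0), (L, p)} \<subseteq> C" unfolding C_def by blast
          show "\<forall>c\<in>C - {(K, 0), (L, p)}. indicator (fr c) x * w c x = 0"
          proof
            fix c assume c: "c \<in> C - {(K, 0), (L, p)}"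
            obtain K' q where cc: "c = (K', q)" by (cases c)
            have "K' \<in> Cells M" using c C(2) cc by auto
            then have "frontier ((+) q ` K') \<subseteq> (+) q ` K'" using closed_cell_plus[OF M, of K' q] frontier_subset_eq[of "(+) q ` K'"] by blast
            moreover have "x \<notin> ?N c" using elim c by blast
            ultimately have "x \<notin> fr c" using x unfolding cc fr_def A0_def by auto
            then show "indicator (fr c) x * w c x = 0" by simp
          qed
        qed
        moreover have "x \<in> fr (K, 0)" "x \<in> fr (L, p)"
          using fset_frontier[OF M e] x unfolding fr_def A0_def by (simp, blast)+
        moreover have "(\<Sum>c\<in>{(K, 0), (L, p)}. k c) = k (K, 0) + k (L, p)" for k :: "_ \<Rightarrow> real"
          using ed(4) by simp
        ultimately show "f x = j (K, L, p) x" unfolding jw by (simp only:) simp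
      qed
    qed
  qed
  have neg: "A \<in> null_sets lebesgue" if "A \<subseteq> A0" for A
  proof -
    have "negligible (frontier K)" using mesh_cellD(3)[OF fe_meshD(3)[OF M ed(1)]] .
    then have "negligible A"
      by (rule negligible_subset) (use that fset_frontier(1)[OF M e] A0_def in blast)
    then show ?thesis by (simp add: negligible_iff_null_sets)
  qed
  have bsub: "cbox a b \<subseteq> cbox lo hi" if "box a b \<noteq> {}" "box a b \<subseteq> box lo hi" for a b :: point
  proof -
    have "box lo hi \<noteq> {}" using that by blast
    then show ?thesis using closure_mono[OF that(2)] closure_box[OF that(1)] closure_box[of lo hi] by simp
  qed
  have fA: "(LINT x:A|surf. f x) = 0" if A: "A \<in> sets borel" "A \<subseteq> A0" for A
  proof -
    let ?f = "\<lambda>x. indicator (box lo hi) x *\<^sub>R f x" and ?h = "\<lambda>x. indicator (box lo hi) x *\<^sub>R h x"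
    have cut: "(LINT x:B|N. indicator (box lo hi) x *\<^sub>R k x) = (LINT x:B \<inter> box lo hi|N. k x)"
      for B N and k :: sfield
      unfolding set_lebesgue_integral_def by (simp add: indicator_inter_arith mult.assoc)
    have eqb: "(LINT x:B \<inter> box lo hi|surf. f x) = (LINT x:B \<inter> box lo hi|lebesgue. h x)"
      if B: "B \<inter> box lo hi = box a b" for B a b
    proof (cases "box a b = {}")
      case True
      then show ?thesis using B by (simp add: set_lebesgue_integral_def)
    next
      case False
      then show ?thesis unfolding B by (intro h(2) bsub) (use B in auto)
    qed
    have "(LINT x:A|surf. ?f x) = (LINT x:A|lebesgue. ?h x)"
    proof (rule signed_eq_on_borel[OF _ _ _ _ _ _ A(1)])
      show "integrable surf ?f" by (rule integrable_mult_indicator[OF _ fint]) simp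
      show "integrable lebesgue ?h" by (rule integrable_mult_indicator[OF _ h(1)]) simp
      show "(LINT x:box a b|surf. ?f x) = (LINT x:box a b|lebesgue. ?h x)" for a b
        unfolding cut by (rule eqb[OF box_Int_box])
      show "(LINT x:UNIV|surf. ?f x) = (LINT x:UNIV|lebesgue. ?h x)"
        unfolding cut by (rule eqb) simp
    qed auto
    moreover have "A \<inter> box lo hi = A" using A(2) unfolding A0_def by blast
    ultimately have "(LINT x:A|surf. f x) = (LINT x:A|lebesgue. h x)" unfolding cut by simp
    also have "\<dots> = 0"
    proof -
      have "AE x in lebesgue. x \<notin> A" by (rule AE_not_in[OF neg[OF A(2)]])
      then have "AE x in lebesgue. indicator A x *\<^sub>R h x = 0" by eventually_elim simp
      then show ?thesis unfolding set_lebesgue_integral_def by (rule integral_eq_zero_AE)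
    qed
    finally show ?thesis .
  qed
  have wm: "w (K', q) \<in> borel_measurable borel" if "K' \<in> Cells M" for K' q
  proof -
    have "(\<lambda>x. G K' (x - q)) \<in> borel_measurable borel"
      using Ck_continuous[OF Ck_shift[OF G(1)[OF that], of "- q"]]
      by (intro borel_measurable_continuous_onI) simp
    then show ?thesis unfolding w_def
      by (simp add: borel_measurable_inner normal_shift_measurable fe_meshD(3)[OF M that])
  qed
  define J where "J = j (K, L, p)"
  have Jm: "J \<in> borel_measurable borel"
  proof -
    have "J = (\<lambda>x. w (K, 0) x + w (L, p) x)" unfolding J_def using jw by (intro ext)
    then show ?thesis using wm[OF ed(1), of 0] wm[OF ed(2), of p] by simp
  qed
  \<comment> \<open>integrate the jump over the sets where it has a constant sign\<close>
  have one_sided: "AE x in surf. x \<in> A \<longrightarrow> J x = 0"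
    if A: "A \<in> sets borel" "A \<subseteq> A0" and s: "\<And>x. x \<in> A \<Longrightarrow> 0 \<le> s * J x" "s \<noteq> 0" for A and s :: real
  proof -
    have ae: "AE x in surf. indicator A x *\<^sub>R f x = indicator A x *\<^sub>R J x"
      using AEf by eventually_elim (use A in \<open>auto simp: J_def indicator_def\<close>)
    have fi: "integrable surf (\<lambda>x. indicator A x *\<^sub>R f x)"
      by (rule integrable_mult_indicator[OF _ fint]) (use A in simp)
    have m: "(\<lambda>x. indicator A x *\<^sub>R J x) \<in> borel_measurable surf"
      by (intro borel_measurable_surf borel_measurable_scaleR borel_measurable_indicator A Jm)
    have Ji: "integrable surf (\<lambda>x. indicator A x *\<^sub>R J x)"
      using integrable_cong_AE_imp[OF fi m] ae by (auto elim: eventually_mono)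
    have "(LINT x|surf. indicator A x *\<^sub>R J x) = (LINT x|surf. indicator A x *\<^sub>R f x)"
      using ae by (intro integral_cong_AE m borel_measurable_integrable[OF fi]) (auto elim: eventually_mono)
    also have "\<dots> = 0" using fA[OF A] unfolding set_lebesgue_integral_def .
    finally have "(LINT x|surf. s * (indicator A x *\<^sub>R J x)) = 0" by simp
    moreover have "integrable surf (\<lambda>x. s * (indicator A x *\<^sub>R J x))" using Ji by simp
    moreover have "AE x in surf. 0 \<le> s * (indicator A x *\<^sub>R J x)"
      using s(1) by (intro AE_I2) (simp add: indicator_def)
    ultimately have "AE x in surf. s * (indicator A x *\<^sub>R J x) = 0"
      using integral_nonneg_eq_0_iff_AE[of surf "\<lambda>x. s * (indicator A x *\<^sub>R J x)"] by blast
    then show ?thesis by eventually_elim (use s(2) in \<open>auto simp: indicator_def\<close>)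
  qed
  have P: "A0 \<inter> J -` {0..} \<in> sets borel" "A0 \<inter> J -` {..0} \<in> sets borel"
    using measurable_sets[OF Jm, of "{0..}"] measurable_sets[OF Jm, of "{..0}"] A0 by auto
  have "AE x in surf. x \<in> A0 \<inter> J -` {0..} \<longrightarrow> J x = 0"
    by (rule one_sided[OF P(1), of 1]) auto
  moreover have "AE x in surf. x \<in> A0 \<inter> J -` {..0} \<longrightarrow> J x = 0"
    by (rule one_sided[OF P(2), of "-1"]) auto
  ultimately show ?thesis
  proof eventually_elim
    case (elim x)
    show ?case
    proof
      assume "x \<in> fset (K, L, p) \<inter> box lo hi"
      then have "x \<in> A0" unfolding A0_def .
      moreover have "J x \<ge> 0 \<or> J x \<le> 0" by linarith
      ultimately show "j (K, L, p) x = 0" using elim unfolding J_def by blast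
    qed
  qed
qed

text \<open>The local statement holds on boxes inside the domain. By the Lindelof property countably many of them
  cover the domain, and the part of a facet that lies on the boundary of the domain is a null set.\<close>

lemma normal_jump:
  fixes u :: vfield and G :: "point set \<Rightarrow> vfield"
  assumes M: "fe_mesh M" and u: "weak_dvg M u g" and per: "periodic M u"
    and G: "\<And>K. K \<in> Cells M \<Longrightarrow> Ck 1 (G K)" "\<And>K x. K \<in> Cells M \<Longrightarrow> x \<in> interior K \<Longrightarrow> u x = G K x"
    and e: "(K, L, p) \<in> all_facets M"
  shows "AE x in surf. x \<in> fset (K, L, p) \<longrightarrow>
    G K x \<bullet> normal K x + G L (x - p) \<bullet> normal L (x - p) = 0"
proof -
  note ed = all_facetsD[OF e]
  let ?B = "{box a b |a b. cbox a b \<subseteq> Dom M}"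
  obtain B' where B': "B' \<subseteq> ?B" "countable B'" "\<Union>B' = \<Union>?B"
    using Lindelof[of ?B] open_box by blast
  have "AE x in surf. \<forall>B\<in>B'. x \<in> fset (K, L, p) \<inter> B \<longrightarrow> G K x \<bullet> normal K x + G L (x - p) \<bullet> normal L (x - p) = 0"
  proof (subst AE_ball_countable[OF B'(2)], rule ballI)
    fix B assume "B \<in> B'"
    then obtain a b where "B = box a b" "cbox a b \<subseteq> Dom M" using B'(1) by blast
    then show "AE x in surf. x \<in> fset (K, L, p) \<inter> B \<longrightarrow> G K x \<bullet> normal K x + G L (x - p) \<bullet> normal L (x - p) = 0"
      using normal_jump_local[OF M u per G _ e, where lo = a and hi = b] by simp
  qed
  moreover have "AE x in surf. x \<notin> K \<inter> (+) p ` L \<inter> frontier (Dom M)"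
  proof (rule AE_not_in)
    have "K \<inter> (+) p ` L \<inter> frontier (Dom M) \<in> sets borel"
      using closed_Int[OF closed_fset[OF M e] frontier_closed] by (intro borel_closed) simp
    then show "K \<inter> (+) p ` L \<inter> frontier (Dom M) \<in> null_sets surf"
      using fe_mesh_disjoint(2)[OF M ed] by (simp add: null_setsI)
  qed
  ultimately show ?thesis
  proof eventually_elim
    case (elim x)
    show ?case
    proof
      assume x: "x \<in> fset (K, L, p)"
      have "K \<subseteq> closure (Dom M)"
      proof -
        have "(+) 0 ` K \<subseteq> (\<Union>p\<in>Per M. \<Union>K\<in>Cells M. (+) p ` K)" using fe_meshD(2)[OF M] ed(1) by blast
        then show ?thesis unfolding fe_meshD(8)[OF M] by simp
      qed
      then have "x \<in> Dom M"
        using x elim(2) fe_meshD(6)[OF M] unfolding frontier_def by (auto simp: interior_open)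
      then obtain a b where "x \<in> box a b" "cbox a b \<subseteq> Dom M"
        using open_contains_cbox[OF fe_meshD(6)[OF M]] by metis
      then have "x \<in> \<Union>B'" unfolding B'(3) by blast
      then show "G K x \<bullet> normal K x + G L (x - p) \<bullet> normal L (x - p) = 0" using elim(1) x by blast
    qed
  qed
qed


section \<open>Pairing the two sides of the facets\<close>

lemma pw_smooth_extension:
  assumes "pw_smooth M f"
  obtains G where "\<And>K. K \<in> Cells M \<Longrightarrow> smooth (G K)"
    "\<And>K x. K \<in> Cells M \<Longrightarrow> x \<in> interior K \<Longrightarrow> f x = G K x"
proof -
  from bchoice[OF assms[unfolded pw_smooth_def]]
  obtain G where "\<forall>K\<in>Cells M. smooth (G K) \<and> (\<forall>x\<in>interior K. f x = G K x)" ..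
  then show ?thesis by (intro that[of G]) blast+
qed

lemma smooth_isCont: "smooth g \<Longrightarrow> isCont g x"
  using Ck_continuous[OF smooth_Ck, of g] by (simp add: continuous_on_eq_continuous_at)

lemma cell_trace_extension:
  assumes "fe_mesh M" "K \<in> Cells M" "x \<in> K" "isCont g x" "\<And>y. y \<in> interior K \<Longrightarrow> f y = g y"
  shows "cell_trace K f x = g x"
  using mesh_cellD(2)[OF fe_meshD(3)[OF assms(1,2)]] assms(3)
  by (intro cell_trace_eqI tendsto_trace assms(4,5)) simp_all

text \<open>The jump of \<open>f e\<^sub>i\<close> in normal direction is the jump of \<open>f\<close> times the \<open>i\<close>-th component of the normal, and the
  normal is a unit vector.\<close>

lemma H1_trace_continuous:
  assumes M: "fe_mesh M" and f: "f \<in> H1 M" "periodic M f"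
    and G: "\<And>K. K \<in> Cells M \<Longrightarrow> smooth (G K)" "\<And>K x. K \<in> Cells M \<Longrightarrow> x \<in> interior K \<Longrightarrow> f x = G K x"
    and e: "(K, L, p) \<in> Facets M"
  shows "AE x in surf. x \<in> fset (K, L, p) \<longrightarrow> G K x = G L (x - p)"
proof -
  have ea: "(K, L, p) \<in> all_facets M" using e fe_mesh_facets(1)[OF M] by blast
  note ed = all_facetsD[OF ea]
  have "AE x in surf. \<forall>i\<in>UNIV. x \<in> fset (K, L, p) \<longrightarrow>
    (G K x *\<^sub>R axis i 1) \<bullet> normal K x + (G L (x - p) *\<^sub>R axis i 1) \<bullet> normal L (x - p) = 0"
  proof (subst AE_ball_countable, simp, rule ballI)
    fix i :: 3
    obtain g where g: "weak_dvg M (\<lambda>x. f x *\<^sub>R axis i 1) g" using H1_weak_dvg[OF f(1)] by blast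
    have per: "periodic M (\<lambda>x. f x *\<^sub>R axis i 1 :: point)" using f(2) by (simp add: periodic_def)
    show "AE x in surf. x \<in> fset (K, L, p) \<longrightarrow>
      (G K x *\<^sub>R axis i 1) \<bullet> normal K x + (G L (x - p) *\<^sub>R axis i 1) \<bullet> normal L (x - p) = 0"
    proof (rule normal_jump[OF M g per _ _ ea, where G = "\<lambda>K x. G K x *\<^sub>R axis i 1"])
      show "Ck 1 (\<lambda>x. G K x *\<^sub>R axis i 1 :: point)" if "K \<in> Cells M" for K
        by (intro Ck_scaleR Ck_const smooth_Ck G(1) that)
    qed (simp add: G(2))
  qed
  moreover have "AE x in surf. x \<in> fset (K, L, p) \<longrightarrow> normal K x = - normal L (x - p)"
    using bspec[OF fe_mesh_facets(3)[OF M] e] by simp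
  ultimately show ?thesis
  proof eventually_elim
    case (elim x)
    show ?case
    proof
      assume x: "x \<in> fset (K, L, p)"
      have nL: "normal L (x - p) = - normal K x" using elim(2) x by simp
      have "(G K x - G L (x - p)) *\<^sub>R normal K x = 0"
      proof (rule vec_eq_iff[THEN iffD2], rule allI)
        fix i :: 3
        have "(G K x *\<^sub>R axis i 1) \<bullet> normal K x + (G L (x - p) *\<^sub>R axis i 1) \<bullet> normal L (x - p) = 0"
          using elim(1) x by blast
        then show "((G K x - G L (x - p)) *\<^sub>R normal K x) $ i = 0 $ i"
          unfolding nL by (simp add: inner_axis' algebra_simps)
      qed
      moreover have "norm (normal K x) = 1"
        using fset_frontier(1)[OF M ea] x by (intro normal_unit fe_meshD(3)[OF M ed(1)]) blast
      ultimately show "G K x = G L (x - p)" by auto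
    qed
  qed
qed

lemma cell_subset_closure_Dom: "fe_mesh M \<Longrightarrow> K \<in> Cells M \<Longrightarrow> K \<subseteq> closure (Dom M)"
proof -
  assume M: "fe_mesh M" and K: "K \<in> Cells M"
  have "(+) 0 ` K \<subseteq> (\<Union>p\<in>Per M. \<Union>K\<in>Cells M. (+) p ` K)" using fe_meshD(2)[OF M] K by blast
  then show ?thesis unfolding fe_meshD(8)[OF M] by simp
qed

text \<open>A point of the frontier inside the domain must lie in another cell: the cells near it form a finite
  family, the union of the others is closed, and if it missed the point, a neighbourhood would be covered by the
  cell itself.\<close>

lemma frontier_cell_cover:
  assumes M: "fe_mesh M" and K: "K \<in> Cells M"
  shows "frontier K = (K \<inter> frontier (Dom M)) \<union> (\<Union>(L, p)\<in>mesh_translates M K - {(K, 0)}. K \<inter> (+) p ` L)"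
    (is "_ = ?R")
proof
  note cK = mesh_cellD[OF fe_meshD(3)[OF M K]]
  show "frontier K \<subseteq> ?R"
  proof
    fix x assume x: "x \<in> frontier K"
    then have xK: "x \<in> K" using cK(6) by blast
    show "x \<in> ?R"
    proof (rule ccontr)
      assume n: "x \<notin> ?R"
      have xD: "x \<in> Dom M"
        using n xK cell_subset_closure_Dom[OF M K] fe_meshD(6)[OF M] unfolding frontier_def
        by (auto simp: interior_open)
      let ?T = "mesh_translates M (cball x 1) - {(K, 0)}"
      let ?S = "\<Union>c\<in>?T. (+) (snd c) ` fst c"
      have "closed ?S"
      proof (intro closed_UN ballI)
        show "finite ?T" using finite_mesh_translates[OF M bounded_cball] by blast
        show "closed ((+) (snd c) ` fst c)" if "c \<in> ?T" for c
          using that by (intro closed_cell_plus[OF M]) (auto simp: mesh_translates_def)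
      qed
      moreover have "x \<notin> ?S"
      proof
        assume "x \<in> ?S"
        then obtain c0 where c0: "c0 \<in> ?T" "x \<in> (+) (snd c0) ` fst c0" by (elim UN_E)
        obtain L q where "c0 = (L, q)" by (cases c0)
        with c0 have c: "(L, q) \<in> ?T" "x \<in> (+) q ` L" by simp_all
        then have "(L, q) \<in> mesh_translates M K - {(K, 0)}"
          using xK unfolding mesh_translates_def by blast
        with c(2) xK have "x \<in> ?R" by blast
        with n show False ..
      qed
      moreover have "ball x 1 \<inter> Dom M - ?S \<subseteq> K"
      proof
        fix y assume y: "y \<in> ball x 1 \<inter> Dom M - ?S"
        then have "y \<in> closure (Dom M)" using closure_subset by blast
        then obtain q L where L: "q \<in> Per M" "L \<in> Cells M" "y \<in> (+) q ` L"
          unfolding fe_meshD(8)[OF M] by (elim UN_E)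
        moreover have "y \<in> cball x 1" using y ball_subset_cball by blast
        ultimately have m: "(L, q) \<in> mesh_translates M (cball x 1)" unfolding mesh_translates_def by blast
        have "(L, q) = (K, 0)"
        proof (rule ccontr)
          assume "(L, q) \<noteq> (K, 0)"
          with m have "(L, q) \<in> ?T" by blast
          then have "y \<in> ?S" by (rule UN_I) (simp add: L(3))
          with y show False by blast
        qed
        with L(3) show "y \<in> K" by simp
      qed
      moreover have "open (ball x 1 \<inter> Dom M - ?S)" if "closed ?S"
        by (intro open_Diff open_Int open_ball fe_meshD(6)[OF M] that)
      ultimately have "x \<in> interior K"
        using xD by (intro interiorI[of "ball x 1 \<inter> Dom M - ?S"]) simp_all
      then show False using x unfolding frontier_def by blast
    qed
  qed
  have "K \<inter> frontier (Dom M) \<subseteq> frontier K"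
  proof
    fix x assume x: "x \<in> K \<inter> frontier (Dom M)"
    then have "x \<notin> Dom M" using fe_meshD(6)[OF M] by (simp add: frontier_def interior_open)
    then have "x \<notin> interior K" using fe_meshD(4)[OF M K] by blast
    then show "x \<in> frontier K" using x closure_subset[of K] unfolding frontier_def by blast
  qed
  moreover have "K \<inter> (+) p ` L \<subseteq> frontier K" if "(L, p) \<in> mesh_translates M K - {(K, 0)}" for L p
  proof -
    have "L \<in> Cells M" "p \<in> Per M" "(K, 0) \<noteq> (L, p)" using that unfolding mesh_translates_def by blast+
    from overlap_subset_frontier[OF M K this(1) fe_meshD(2)[OF M] this(2,3)] show ?thesis by simp
  qed
  ultimately show "?R \<subseteq> frontier K" by blast
qed

lemma all_facets_subset:
  "all_facets M \<subseteq> Sigma (Cells M) (\<lambda>K. mesh_translates M K - {(K, 0)})"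
proof
  fix e assume e: "e \<in> all_facets M"
  obtain K L p where k: "e = (K, L, p)" by (cases e)
  have "fset (K, L, p) \<noteq> {}" using e unfolding k all_facets_def by auto
  then show "e \<in> Sigma (Cells M) (\<lambda>K. mesh_translates M K - {(K, 0)})"
    using all_facetsD[of K L p M] e unfolding k mesh_translates_def by auto
qed

lemma finite_cell_translates:
  "fe_mesh M \<Longrightarrow> K \<in> Cells M \<Longrightarrow> finite (mesh_translates M K)"
  by (intro finite_mesh_translates compact_imp_bounded mesh_cellD(1) fe_meshD(3))

lemma fset_reverse: "fset (L, K, - p) = (+) (- p) ` fset (K, L, p)"
proof -
  have "(+) (- p) ` (K \<inter> (+) p ` L) = (+) (- p) ` K \<inter> L"
    by (subst image_Int) (simp_all add: inj_on_def image_image)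
  then show ?thesis by (simp add: Int_commute)
qed

text \<open>The pieces in the covering of the frontier overlap in null sets only, since three cells meet in null sets.\<close>

lemma frontier_cell_integral:
  assumes M: "fe_mesh M" and K: "K \<in> Cells M" and k: "set_integrable surf (frontier K) k"
  shows "(LINT x:frontier K|surf. k x) = (LINT x:K \<inter> bdry M|surf. k x) +
    (\<Sum>(L, p)\<in>mesh_translates M K - {(K, 0)}. LINT x:fset (K, L, p)|surf. (k x :: real))"
proof -
  let ?T = "mesh_translates M K - {(K, 0)}"
  let ?f = "\<lambda>c. fset (K, c)"
  let ?B = "K \<inter> frontier (Dom M)"
  note cK = mesh_cellD[OF fe_meshD(3)[OF M K]]
  have bd: "K \<inter> bdry M = ?B" using K unfolding bdry_def by blast
  have finT: "finite ?T" using finite_cell_translates[OF M K] by blast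
  have T: "fst c \<in> Cells M" "snd c \<in> Per M" "(K, 0) \<noteq> (fst c, snd c)" if "c \<in> ?T" for c
    using that unfolding mesh_translates_def by auto
  have f: "?f c = K \<inter> (+) (snd c) ` fst c" for c by (cases c) simp
  have fb: "?f c \<in> sets borel" if "c \<in> ?T" for c
    unfolding f by (intro borel_closed closed_Int cK(4) closed_cell_plus[OF M] T(1) that)
  have Bb: "?B \<in> sets borel" by (intro borel_closed closed_Int cK(4) frontier_closed)
  have cover: "frontier K = ?B \<union> (\<Union>c\<in>?T. ?f c)"
    unfolding frontier_cell_cover[OF M K] by (simp add: f case_prod_unfold)
  have si: "set_integrable surf A k" if "A \<in> sets borel" "A \<subseteq> frontier K" for A
    by (rule set_integrable_subset[OF k]) (use that in simp_all)
  have null1: "?B \<inter> ?f c \<in> null_sets surf" if "c \<in> ?T" for c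
  proof (rule null_setsI)
    have "emeasure surf (K \<inter> (+) (snd c) ` fst c \<inter> frontier (Dom M)) = 0"
      by (rule fe_mesh_disjoint(2)[OF M K T[OF that]])
    moreover have "?B \<inter> ?f c = K \<inter> (+) (snd c) ` fst c \<inter> frontier (Dom M)" unfolding f by blast
    ultimately show "emeasure surf (?B \<inter> ?f c) = 0" by simp
    show "?B \<inter> ?f c \<in> sets surf" using Bb fb[OF that] by auto
  qed
  have null2: "?f c \<inter> ?f d \<in> null_sets surf" if "c \<in> ?T" "d \<in> ?T" "c \<noteq> d" for c d
  proof (rule null_setsI)
    have "(fst c, snd c) \<noteq> (fst d, snd d)" using that(3) by simp
    from fe_mesh_triple[OF M K T(1)[OF that(1)] T(1)[OF that(2)] T(2)[OF that(1)] T(2)[OF that(2)]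
        T(3)[OF that(1)] T(3)[OF that(2)] this]
    have "emeasure surf (K \<inter> (+) (snd c) ` fst c \<inter> (+) (snd d) ` fst d) = 0" .
    moreover have "?f c \<inter> ?f d = K \<inter> (+) (snd c) ` fst c \<inter> (+) (snd d) ` fst d" unfolding f by blast
    ultimately show "emeasure surf (?f c \<inter> ?f d) = 0" by simp
    show "?f c \<inter> ?f d \<in> sets surf" using fb that by auto
  qed
  have sumT: "(LINT x:(\<Union>c\<in>S. ?f c)|surf. k x) = (\<Sum>c\<in>S. LINT x:?f c|surf. k x)" if "S \<subseteq> ?T" for S
    using finite_subset[OF that finT] that
  proof (induction S rule: finite_induct)
    case empty
    show ?case by (simp add: set_lebesgue_integral_def)
  next
    case (insert c S)
    have "(\<Union>d\<in>S. ?f c \<inter> ?f d) \<in> null_sets surf"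
      using insert by (intro null_sets.finite_UN null2) auto
    from AE_not_in[OF this] have ae: "AE x in surf. \<not> (x \<in> ?f c \<and> x \<in> (\<Union>d\<in>S. ?f d))"
      by eventually_elim blast
    have b: "(\<Union>d\<in>S. ?f d) \<in> sets borel" using insert fb by (intro sets.finite_UN) auto
    have "(\<Union>d\<in>insert c S. ?f d) \<subseteq> frontier K" using insert.prems unfolding cover by blast
    then have sub: "?f c \<subseteq> frontier K" "(\<Union>d\<in>S. ?f d) \<subseteq> frontier K" by blast+
    have "(LINT x:?f c \<union> (\<Union>d\<in>S. ?f d)|surf. k x) = (LINT x:?f c|surf. k x) + (LINT x:(\<Union>d\<in>S. ?f d)|surf. k x)"
      using insert.prems fb b sub by (intro set_integral_Un_AE ae si) simp_all
    then show ?case using insert by simp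
  qed
  have "(\<Union>c\<in>?T. ?B \<inter> ?f c) \<in> null_sets surf"
    using finT null1 by (intro null_sets.finite_UN) auto
  from AE_not_in[OF this] have ae: "AE x in surf. \<not> (x \<in> ?B \<and> x \<in> (\<Union>c\<in>?T. ?f c))"
    by eventually_elim blast
  have b: "(\<Union>c\<in>?T. ?f c) \<in> sets borel" using finT fb by (intro sets.finite_UN) auto
  have "(LINT x:?B \<union> (\<Union>c\<in>?T. ?f c)|surf. k x) = (LINT x:?B|surf. k x) + (LINT x:(\<Union>c\<in>?T. ?f c)|surf. k x)"
    using Bb b cover by (intro set_integral_Un_AE ae si) auto
  moreover have "(\<Sum>(L, p)\<in>?T. LINT x:fset (K, L, p)|surf. k x) = (\<Sum>c\<in>?T. LINT x:?f c|surf. k x)"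
    by (rule sum.cong[OF refl]) (simp only: split_paired_all prod.case)
  ultimately show ?thesis unfolding cover[symmetric] bd sumT[OF subset_refl] by simp
qed

text \<open>The sum over the frontiers of all cells runs over the boundary of the domain and over every facet twice,
  once from each side. The side of \<open>L\<close> is moved by the period \<open>p\<close> onto the facet, which requires the translation
  invariance of the surface measure.\<close>

lemma skeleton_integral:
  fixes k :: "point set \<Rightarrow> sfield"
  assumes M: "fe_mesh M" and k: "\<And>K. K \<in> Cells M \<Longrightarrow> set_integrable surf (frontier K) (k K)"
    and m: "\<And>K. K \<in> Cells M \<Longrightarrow> k K \<in> borel_measurable borel"
  shows "(\<Sum>K\<in>Cells M. LINT x:frontier K|surf. k K x) =
    (\<Sum>K\<in>Cells M. LINT x:K \<inter> bdry M|surf. k K x) +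
    (\<Sum>(K, L, p)\<in>Facets M. LINT x:fset (K, L, p)|surf. k K x + k L (x - p))"
proof -
  define I where "I = (\<lambda>(K, L, p). LINT x:fset (K, L, p)|surf. k K x)"
  define rev where "rev = (\<lambda>(K, L, p). (L, K, - p) :: facet)"
  let ?S = "Sigma (Cells M) (\<lambda>K. mesh_translates M K - {(K, 0)})"
  note sub = all_facets_subset[of M]
  have fS: "finite ?S" by (intro finite_SigmaI fe_meshD(1)[OF M] finite_Diff finite_cell_translates[OF M])
  \<comment> \<open>pairs of cells that meet in a null set are not facets and do not contribute\<close>
  have zero: "I e = 0" if e: "e \<in> ?S - all_facets M" for e
  proof -
    obtain K L p where ee: "e = (K, L, p)" by (cases e)
    have h: "K \<in> Cells M" "L \<in> Cells M" "p \<in> Per M" "(K, 0) \<noteq> (L, p)"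
      using e unfolding ee mesh_translates_def by auto
    then have "emeasure surf (fset (K, L, p)) = 0"
      using e unfolding ee all_facets_def by auto
    moreover have "fset (K, L, p) \<in> sets surf"
      using closed_Int[OF closed_cell_plus[OF M h(1), of 0] closed_cell_plus[OF M h(2), of p]] by simp
    ultimately have "fset (K, L, p) \<in> null_sets surf" by (intro null_setsI)
    from AE_not_in[OF this] have "AE x in surf. indicator (fset (K, L, p)) x *\<^sub>R k K x = 0"
      by eventually_elim simp
    then show ?thesis
      unfolding ee I_def prod.case set_lebesgue_integral_def by (rule integral_eq_zero_AE)
  qed
  have "(\<Sum>K\<in>Cells M. \<Sum>(L, p)\<in>mesh_translates M K - {(K, 0)}. LINT x:fset (K, L, p)|surf. k K x) = (\<Sum>e\<in>?S. I e)"
    by (subst sum.Sigma) (simp_all add: I_def case_prod_unfold fe_meshD(1)[OF M] finite_cell_translates[OF M])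
  also have "\<dots> = (\<Sum>e\<in>all_facets M. I e)"
    by (rule sum.mono_neutral_right[OF fS sub]) (use zero in blast)
  also have "all_facets M = Facets M \<union> rev ` Facets M"
  proof -
    have "rev e \<in> all_facets M" if e: "e \<in> all_facets M" for e
    proof -
      obtain K L p where ee: "e = (K, L, p)" by (cases e)
      note d = all_facetsD[OF e[unfolded ee]]
      note eq = fset_reverse[of L K p]
      have "emeasure surf (fset (L, K, - p)) = emeasure surf (fset (K, L, p))"
        unfolding eq by (intro emeasure_surf_plus borel_closed closed_fset[OF M e[unfolded ee]])
      moreover have "0 < emeasure surf (fset (K, L, p))" using e unfolding ee all_facets_def by blast
      moreover have "- p \<in> Per M" using fe_meshD(5)[OF M fe_meshD(2)[OF M] d(3)] by simp
      moreover have "(L, 0) \<noteq> (K, - p)" using d(4) by auto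
      ultimately show ?thesis using d(1,2) unfolding ee rev_def all_facets_def by simp
    qed
    moreover have "e \<in> Facets M \<or> e \<in> rev ` Facets M" if e: "e \<in> all_facets M" for e
    proof -
      obtain K L p where ee: "e = (K, L, p)" by (cases e)
      have "((K, L, p) \<in> Facets M) \<noteq> ((L, K, - p) \<in> Facets M)"
        using bspec[OF fe_mesh_facets(2)[OF M] e[unfolded ee]] by simp
      moreover have "e = rev (L, K, - p)" by (simp add: ee rev_def)
      ultimately show ?thesis unfolding ee by blast
    qed
    ultimately show ?thesis using fe_mesh_facets(1)[OF M] by blast
  qed
  also have "(\<Sum>e\<in>Facets M \<union> rev ` Facets M. I e) = (\<Sum>e\<in>Facets M. I e) + (\<Sum>e\<in>rev ` Facets M. I e)"
  proof (rule sum.union_disjoint)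
    show "finite (Facets M)" using finite_subset[OF subset_trans[OF fe_mesh_facets(1)[OF M] sub] fS] .
    then show "finite (rev ` Facets M)" by (rule finite_imageI)
    show "Facets M \<inter> rev ` Facets M = {}"
    proof (rule ccontr)
      assume "Facets M \<inter> rev ` Facets M \<noteq> {}"
      then obtain K L p where h: "(K, L, p) \<in> Facets M" "rev (K, L, p) \<in> Facets M" by auto
      then have "(K, L, p) \<in> all_facets M" using fe_mesh_facets(1)[OF M] by blast
      from bspec[OF fe_mesh_facets(2)[OF M] this] h show False by (simp add: rev_def)
    qed
  qed
  also have "(\<Sum>e\<in>rev ` Facets M. I e) = (\<Sum>e\<in>Facets M. I (rev e))"
    by (rule sum.reindex[unfolded o_def]) (auto simp: inj_on_def rev_def)
  also have "(\<Sum>e\<in>Facets M. I e) + (\<Sum>e\<in>Facets M. I (rev e)) =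
     (\<Sum>(K, L, p)\<in>Facets M. LINT x:fset (K, L, p)|surf. k K x + k L (x - p))"
    unfolding sum.distrib[symmetric]
  proof (rule sum.cong[OF refl])
    fix e assume eF: "e \<in> Facets M"
    obtain K L p where ee: "e = (K, L, p)" by (cases e)
    have ea: "(K, L, p) \<in> all_facets M" using eF fe_mesh_facets(1)[OF M] unfolding ee by blast
    note d = all_facetsD[OF ea]
    have b: "fset (K, L, p) \<in> sets borel" by (intro borel_closed closed_fset[OF M ea])
    note eq = fset_reverse[of L K p]
    have frL: "(+) (- p) ` fset (K, L, p) \<subseteq> frontier L"
    proof
      fix y assume "y \<in> (+) (- p) ` fset (K, L, p)"
      then obtain x where x: "x \<in> fset (K, L, p)" "y = - p + x" by blast
      then have "x \<in> (+) p ` frontier L" using fset_frontier(2)[OF M ea] unfolding frontier_plus by blast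
      then show "y \<in> frontier L" using x(2) by auto
    qed
    have r: "I (rev e) = (LINT x:fset (K, L, p)|surf. k L (x - p))"
      using set_integral_plus_surf[OF b m[OF d(2)], of "- p"]
      by (simp add: ee rev_def I_def eq[simplified])
    have "set_integrable surf ((+) (- p) ` fset (K, L, p)) (k L)"
      by (rule set_integrable_subset[OF k[OF d(2)] _ frL]) (use borel_plus[OF b, of "- p"] in simp)
    moreover have "(\<lambda>x. indicator ((+) (- p) ` fset (K, L, p)) x *\<^sub>R k L x) \<in> borel_measurable surf"
      by (intro borel_measurable_surf borel_measurable_scaleR borel_measurable_indicator borel_plus[OF b] m d)
    ultimately have i2: "set_integrable surf (fset (K, L, p)) (\<lambda>x. k L (x - p))"
      using set_integral_plus(2)[OF distr_surf_plus plus_measurable_surf, of "- p" "fset (K, L, p)" "k L"] by simp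
    have i1: "set_integrable surf (fset (K, L, p)) (k K)"
      by (rule set_integrable_subset[OF k[OF d(1)] _ fset_frontier(1)[OF M ea]]) (use b in simp)
    show "I e + I (rev e) = (case e of (K, L, p) \<Rightarrow> LINT x:fset (K, L, p)|surf. k K x + k L (x - p))"
      unfolding r unfolding ee I_def prod.case using set_integral_add(2)[OF i1 i2] by simp
  qed
  finally have inner: "(\<Sum>K\<in>Cells M. \<Sum>(L, p)\<in>mesh_translates M K - {(K, 0)}. LINT x:fset (K, L, p)|surf. k K x) =
     (\<Sum>(K, L, p)\<in>Facets M. LINT x:fset (K, L, p)|surf. k K x + k L (x - p))" .
  have "(\<Sum>K\<in>Cells M. LINT x:frontier K|surf. k K x) = (\<Sum>K\<in>Cells M. (LINT x:K \<inter> bdry M|surf. k K x) +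
    (\<Sum>(L, p)\<in>mesh_translates M K - {(K, 0)}. LINT x:fset (K, L, p)|surf. k K x))"
    by (intro sum.cong refl frontier_cell_integral[OF M] k)
  then show ?thesis unfolding sum.distrib inner .
qed


section \<open>Integration by parts on the mesh\<close>

text \<open>On each cell Gauss-Green applies to \<open>T F\<close>. On a facet \<open>T\<close> has equal traces because it is in \<open>H1\<close>, and the normal
  traces of \<open>F\<close> cancel because it is in \<open>Hdiv\<close>; on the boundary the normal trace of \<open>F\<close> vanishes.\<close>

lemma int_Dom_by_parts:
  fixes T :: sfield and F :: vfield
  assumes M: "fe_mesh M" and T: "T \<in> H1 M" "pw_smooth M T" "periodic M T"
    and F: "F \<in> Hdiv M" "pw_smooth M F" "periodic M F"
    and bc: "\<forall>K\<in>Cells M. AE x in surf. x \<in> K \<inter> bdry M \<longrightarrow> cell_trace K F x \<bullet> normal K x = 0"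
  shows "(LINT x:omega M|lebesgue. T x * dvg F x + F x \<bullet> grad T x) = 0"
proof -
  obtain GT where GT: "\<And>K. K \<in> Cells M \<Longrightarrow> smooth (GT K)"
    "\<And>K x. K \<in> Cells M \<Longrightarrow> x \<in> interior K \<Longrightarrow> T x = GT K x"
    using pw_smooth_extension[OF T(2)] by blast
  obtain GF where GF: "\<And>K. K \<in> Cells M \<Longrightarrow> smooth (GF K)"
    "\<And>K x. K \<in> Cells M \<Longrightarrow> x \<in> interior K \<Longrightarrow> F x = GF K x"
    using pw_smooth_extension[OF F(2)] by blast
  define k where "k = (\<lambda>K x. (GT K x *\<^sub>R GF K x) \<bullet> normal K x)"
  have C1: "Ck 1 (\<lambda>x. GT K x *\<^sub>R GF K x)" if "K \<in> Cells M" for K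
    by (intro Ck_scaleR smooth_Ck GT(1) GF(1) that)
  have cell: "(LINT x:interior K|lebesgue. T x * dvg F x + F x \<bullet> grad T x) = (LINT x:frontier K|surf. k K x)"
    if K: "K \<in> Cells M" for K
  proof -
    have "(LINT x:interior K|lebesgue. T x * dvg F x + F x \<bullet> grad T x) =
          (LINT x:interior K|lebesgue. dvg (\<lambda>x. GT K x *\<^sub>R GF K x) x)"
    proof (rule set_lebesgue_integral_cong)
      show "\<forall>x. x \<in> interior K \<longrightarrow> T x * dvg F x + F x \<bullet> grad T x = dvg (\<lambda>x. GT K x *\<^sub>R GF K x) x"
      proof (intro allI impI)
        fix x assume x: "x \<in> interior K"
        have "GT K differentiable (at x)" "GF K differentiable (at x)"
          using smooth_Ck[OF GT(1)[OF K], of "Suc 0"] smooth_Ck[OF GF(1)[OF K], of "Suc 0"]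
          by (blast intro: Ck_differentiable)+
        then have "dvg (\<lambda>x. GT K x *\<^sub>R GF K x) x = GT K x * dvg (GF K) x + grad (GT K) x \<bullet> GF K x"
          by (rule dvg_scaleR)
        moreover have "grad T x = grad (GT K) x" by (rule grad_cong_open[OF open_interior x GT(2)[OF K]])
        moreover have "dvg F x = dvg (GF K) x" by (rule dvg_cong_open[OF open_interior x GF(2)[OF K]])
        ultimately show "T x * dvg F x + F x \<bullet> grad T x = dvg (\<lambda>x. GT K x *\<^sub>R GF K x) x"
          using GT(2)[OF K x] GF(2)[OF K x] by (simp add: inner_commute)
      qed
    qed simp
    also have "\<dots> = (LINT x:frontier K|surf. (GT K x *\<^sub>R GF K x) \<bullet> normal K x)"
      using gauss_green[OF fe_meshD(3)[OF M K] C1[OF K], of 0] by simp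
    finally show ?thesis unfolding k_def .
  qed
  have km: "k K \<in> borel_measurable borel" if "K \<in> Cells M" for K
    unfolding k_def
    by (intro borel_measurable_inner borel_measurable_continuous_onI Ck_continuous[OF C1[OF that]]
        normal_measurable fe_meshD(3)[OF M that])
  have ki: "set_integrable surf (frontier K) (k K)" if "K \<in> Cells M" for K
    using surf_integrable[OF fe_meshD(3)[OF M that], of "frontier K" 0 "\<lambda>x. GT K x *\<^sub>R GF K x"]
      Ck_continuous[OF C1[OF that]]
    by (simp add: k_def)
  have zero: "(LINT x:A|surf. l x) = 0" if "AE x in surf. x \<in> A \<longrightarrow> l x = 0" for A and l :: sfield
    unfolding set_lebesgue_integral_def
  proof (rule integral_eq_zero_AE)
    show "AE x in surf. indicator A x *\<^sub>R l x = 0"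
      using that by eventually_elim (simp add: indicator_def)
  qed
  have "(LINT x:omega M|lebesgue. T x * dvg F x + F x \<bullet> grad T x) = (\<Sum>K\<in>Cells M. LINT x:frontier K|surf. k K x)"
    using pw_smooth_imp_pwc[OF T(2)] pw_smooth_imp_pwc[OF F(2)] pw_smooth_derivs(1)[OF T(2)] pw_smooth_derivs(2)[OF F(2)]
    by (subst integral_omega_cells[OF M]) (simp_all add: pwc_add pwc_mult pwc_inner cell)
  also have "\<dots> = (\<Sum>K\<in>Cells M. LINT x:K \<inter> bdry M|surf. k K x) +
    (\<Sum>(K, L, p)\<in>Facets M. LINT x:fset (K, L, p)|surf. k K x + k L (x - p))"
    by (rule skeleton_integral[OF M ki km])
  also have "(\<Sum>K\<in>Cells M. LINT x:K \<inter> bdry M|surf. k K x) = 0"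
  proof (intro sum.neutral ballI zero)
    fix K assume K: "K \<in> Cells M"
    from bspec[OF bc K] show "AE x in surf. x \<in> K \<inter> bdry M \<longrightarrow> k K x = 0"
    proof eventually_elim
      case (elim x)
      show ?case
      proof
        assume x: "x \<in> K \<inter> bdry M"
        then have "cell_trace K F x = GF K x"
          by (intro cell_trace_extension[OF M K] smooth_isCont GF K) simp_all
        then show "k K x = 0" using elim x by (simp add: k_def)
      qed
    qed
  qed
  also have "(\<Sum>(K, L, p)\<in>Facets M. LINT x:fset (K, L, p)|surf. k K x + k L (x - p)) = 0"
  proof (intro sum.neutral ballI)
    fix e assume eF: "e \<in> Facets M"
    obtain K L p where e: "e = (K, L, p)" by (cases e)
    have ea: "(K, L, p) \<in> all_facets M" using eF fe_mesh_facets(1)[OF M] unfolding e by blast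
    obtain g where g: "weak_dvg M F g" using Hdiv_weak_dvg[OF F(1)] by blast
    have "AE x in surf. x \<in> fset (K, L, p) \<longrightarrow> GT K x = GT L (x - p)"
      by (rule H1_trace_continuous[OF M T(1,3) GT eF[unfolded e]])
    moreover have "AE x in surf. x \<in> fset (K, L, p) \<longrightarrow>
        GF K x \<bullet> normal K x + GF L (x - p) \<bullet> normal L (x - p) = 0"
      by (rule normal_jump[OF M g F(3) smooth_Ck[OF GF(1)] GF(2) ea])
    ultimately have "AE x in surf. x \<in> fset (K, L, p) \<longrightarrow> k K x + k L (x - p) = 0"
    proof eventually_elim
      case (elim x)
      show ?case
      proof
        assume x: "x \<in> fset (K, L, p)"
        have "k K x + k L (x - p) = GT K x * (GF K x \<bullet> normal K x + GF L (x - p) \<bullet> normal L (x - p))"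
          using elim(1) x by (simp add: k_def algebra_simps)
        then show "k K x + k L (x - p) = 0" using elim(2) x by simp
      qed
    qed
    from zero[OF this]
    show "(case e of (K, L, p) \<Rightarrow> LINT x:fset (K, L, p)|surf. k K x + k L (x - p)) = 0" by (simp add: e)
  qed
  finally show ?thesis by simp
qed


section \<open>Symmetry of second derivatives\<close>

lemma DERIV_line:
  fixes f :: "point \<Rightarrow> real"
  assumes "\<And>y. f differentiable (at y)"
  shows "((\<lambda>t. f (y + t *\<^sub>R axis i 1)) has_real_derivative partial i f (y + t *\<^sub>R axis i 1)) (at t)"
proof -
  let ?D = "frechet_derivative f (at (y + t *\<^sub>R axis i 1))"
  have D: "(f has_derivative ?D) (at (y + t *\<^sub>R axis i 1))"
    using assms frechet_derivative_works by blast
  have "((\<lambda>t. y + t *\<^sub>R axis i 1) has_derivative (\<lambda>h. h *\<^sub>R axis i 1)) (at t)"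
    by (auto intro!: derivative_eq_intros)
  from has_derivative_compose[OF this D]
  have "((\<lambda>t. f (y + t *\<^sub>R axis i 1)) has_derivative (\<lambda>h. ?D (h *\<^sub>R axis i 1))) (at t)" .
  moreover have "?D (h *\<^sub>R axis i 1) = h * partial i f (y + t *\<^sub>R axis i 1)" for h
    using linear_scale[OF has_derivative_linear[OF D]] by (simp add: partial_def)
  ultimately show ?thesis by (simp add: has_field_derivative_def mult_commute_abs)
qed

text \<open>The mean value theorem, used first in direction \<open>i\<close> and then in direction \<open>j\<close>. The left side is symmetric in the
  two directions, the right side is close to a mixed derivative at \<open>x\<close>.\<close>

lemma second_difference:
  fixes f :: "point \<Rightarrow> real"
  assumes f: "Ck 2 f" and h: "0 < h"
  obtains \<xi> \<eta> where "0 < \<xi>" "\<xi> < h" "0 < \<eta>" "\<eta> < h"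
    "f (x + h *\<^sub>R axis i 1 + h *\<^sub>R axis j 1) - f (x + h *\<^sub>R axis i 1) - f (x + h *\<^sub>R axis j 1) + f x =
     h\<^sup>2 * partial j (partial i f) (x + \<xi> *\<^sub>R axis i 1 + \<eta> *\<^sub>R axis j 1)"
proof -
  have f2: "Ck (Suc (Suc 0)) f" using f by (simp add: numeral_2_eq_2)
  note d1 = Ck_differentiable[OF f2]
  note d2 = Ck_differentiable[OF Ck_partial[OF f2]]
  let ?\<phi> = "\<lambda>s. f (x + h *\<^sub>R axis j 1 + s *\<^sub>R axis i 1) - f (x + s *\<^sub>R axis i 1)"
  let ?\<phi>' = "\<lambda>s. partial i f (x + h *\<^sub>R axis j 1 + s *\<^sub>R axis i 1) - partial i f (x + s *\<^sub>R axis i 1)"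
  have "(?\<phi> has_real_derivative ?\<phi>' s) (at s)" for s
    by (intro DERIV_diff DERIV_line d1)
  then obtain \<xi> where \<xi>: "0 < \<xi>" "\<xi> < h" "?\<phi> h - ?\<phi> 0 = (h - 0) * ?\<phi>' \<xi>"
    using MVT2[OF h, of ?\<phi> ?\<phi>'] by blast
  let ?\<psi> = "\<lambda>r. partial i f (x + \<xi> *\<^sub>R axis i 1 + r *\<^sub>R axis j 1)"
  have "(?\<psi> has_real_derivative partial j (partial i f) (x + \<xi> *\<^sub>R axis i 1 + r *\<^sub>R axis j 1)) (at r)" for r
    by (intro DERIV_line d2)
  then obtain \<eta> where \<eta>: "0 < \<eta>" "\<eta> < h"
    "?\<psi> h - ?\<psi> 0 = (h - 0) * partial j (partial i f) (x + \<xi> *\<^sub>R axis i 1 + \<eta> *\<^sub>R axis j 1)"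
    using MVT2[OF h, of ?\<psi> "\<lambda>r. partial j (partial i f) (x + \<xi> *\<^sub>R axis i 1 + r *\<^sub>R axis j 1)"] by blast
  have "?\<phi>' \<xi> = ?\<psi> h - ?\<psi> 0" by (simp add: add_ac)
  then have "?\<phi> h - ?\<phi> 0 = h\<^sup>2 * partial j (partial i f) (x + \<xi> *\<^sub>R axis i 1 + \<eta> *\<^sub>R axis j 1)"
    using \<xi>(3) \<eta>(3) by (simp add: power2_eq_square)
  then show thesis by (intro that[OF \<xi>(1,2) \<eta>(1,2)]) (simp add: algebra_simps)
qed

lemma partial_commute:
  fixes f :: "point \<Rightarrow> real"
  assumes f: "Ck 2 f"
  shows "partial i (partial j f) x = partial j (partial i f) x"
proof (rule ccontr)
  assume ne: "partial i (partial j f) x \<noteq> partial j (partial i f) x"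
  have f2: "Ck (Suc (Suc 0)) f" using f by (simp add: numeral_2_eq_2)
  have cont: "isCont (partial a (partial b f)) x" for a b
    using Ck_continuous[OF Ck_partial[OF Ck_partial[OF f2]]] by (simp add: continuous_on_eq_continuous_at)
  define e where "e = \<bar>partial i (partial j f) x - partial j (partial i f) x\<bar> / 2"
  have e: "e > 0" using ne by (simp add: e_def)
  obtain d1 where d1: "d1 > 0" "\<And>y. dist y x < d1 \<Longrightarrow> dist (partial i (partial j f) y) (partial i (partial j f) x) < e"
    using cont[of i j] e unfolding continuous_at_eps_delta by blast
  obtain d2 where d2: "d2 > 0" "\<And>y. dist y x < d2 \<Longrightarrow> dist (partial j (partial i f) y) (partial j (partial i f) x) < e"
    using cont[of j i] e unfolding continuous_at_eps_delta by blast
  define h where "h = min d1 d2 / 2"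
  have h: "h > 0" "2 * h \<le> d1" "2 * h \<le> d2" using d1(1) d2(1) by (auto simp: h_def)
  have near: "dist (x + s *\<^sub>R axis a 1 + r *\<^sub>R axis b 1) x < 2 * h"
    if "0 < s" "s < h" "0 < r" "r < h" for a b :: 3 and s r
  proof -
    have "norm (s *\<^sub>R axis a 1 + r *\<^sub>R axis b 1 :: point) \<le> \<bar>s\<bar> + \<bar>r\<bar>"
      by (rule order_trans[OF norm_triangle_ineq]) simp
    then show ?thesis using that by (simp add: dist_norm add.assoc)
  qed
  obtain s r where sr: "0 < s" "s < h" "0 < r" "r < h"
    "f (x + h *\<^sub>R axis i 1 + h *\<^sub>R axis j 1) - f (x + h *\<^sub>R axis i 1) - f (x + h *\<^sub>R axis j 1) + f x =
     h\<^sup>2 * partial j (partial i f) (x + s *\<^sub>R axis i 1 + r *\<^sub>R axis j 1)"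
    by (rule second_difference[OF f h(1)])
  obtain s' r' where sr': "0 < s'" "s' < h" "0 < r'" "r' < h"
    "f (x + h *\<^sub>R axis j 1 + h *\<^sub>R axis i 1) - f (x + h *\<^sub>R axis j 1) - f (x + h *\<^sub>R axis i 1) + f x =
     h\<^sup>2 * partial i (partial j f) (x + s' *\<^sub>R axis j 1 + r' *\<^sub>R axis i 1)"
    by (rule second_difference[OF f h(1)])
  let ?y = "x + s *\<^sub>R axis i 1 + r *\<^sub>R axis j 1" and ?z = "x + s' *\<^sub>R axis j 1 + r' *\<^sub>R axis i 1"
  have sw: "x + h *\<^sub>R axis j 1 + h *\<^sub>R axis i 1 = x + h *\<^sub>R axis i 1 + h *\<^sub>R axis j 1" by (simp add: add_ac)
  have "h\<^sup>2 * partial j (partial i f) ?y = h\<^sup>2 * partial i (partial j f) ?z"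
    using sr(5) sr'(5)[unfolded sw] by linarith
  then have eq: "partial j (partial i f) ?y = partial i (partial j f) ?z" using h(1) by simp
  have "dist ?z x < d1" "dist ?y x < d2"
    using near[OF sr'(1-4), of j i] near[OF sr(1-4), of i j] h(2,3) by linarith+
  then have "\<bar>partial i (partial j f) ?z - partial i (partial j f) x\<bar> < e"
    "\<bar>partial j (partial i f) ?y - partial j (partial i f) x\<bar> < e"
    using d1(2) d2(2) by (simp_all add: dist_real_def)
  then have "\<bar>partial i (partial j f) ?z - partial i (partial j f) x\<bar> <
      \<bar>partial i (partial j f) x - partial j (partial i f) x\<bar> / 2"
    "\<bar>partial i (partial j f) ?z - partial j (partial i f) x\<bar> <
      \<bar>partial i (partial j f) x - partial j (partial i f) x\<bar> / 2"
    unfolding eq e_def .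
  moreover have "\<not> (\<bar>a - b\<bar> < \<bar>b - c\<bar> / 2 \<and> \<bar>a - c\<bar> < \<bar>b - c\<bar> / 2)" for a b c :: real
    by (auto simp: abs_if split: if_splits)
  ultimately show False by blast
qed

lemma Ck_vec:
  fixes u :: vfield
  assumes "\<And>i. Ck k (\<lambda>x. u x $ i)"
  shows "Ck k u"
proof -
  have "Ck k (\<lambda>x. \<Sum>i\<in>UNIV. u x $ i *\<^sub>R (axis i 1 :: point))"
    by (intro Ck_sum Ck_scaleR Ck_const assms finite)
  moreover have "(\<Sum>i\<in>UNIV. u x $ i *\<^sub>R (axis i 1 :: point)) = u x" for x
    using basis_expansion[of "u x"] by (simp add: scalar_mult_eq_scaleR)
  ultimately show ?thesis by simp
qed

lemma Ck_nth: "Ck k u \<Longrightarrow> Ck k (\<lambda>x. (u x :: point) $ i)"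
  by (rule Ck_bounded_linear[OF bounded_linear_vec_nth])

lemma curl_grad:
  assumes "Ck 2 f"
  shows "curl (grad f) x = 0"
proof -
  have f2: "Ck (Suc (Suc 0)) f" using assms by (simp add: numeral_2_eq_2)
  have "Ck (Suc 0) (grad f)"
    by (rule Ck_vec) (simp add: grad_def Ck_partial[OF f2])
  then have d: "grad f differentiable (at x)" by (rule Ck_differentiable)
  have p: "partial a (grad f) x $ b = partial a (partial b f) x" for a b
    unfolding partial_nth[OF d, symmetric] by (simp add: grad_def)
  show ?thesis
    by (simp add: curl_def p vec_eq_iff forall_3 partial_commute[OF assms, of 3 2]
        partial_commute[OF assms, of 3 1] partial_commute[OF assms, of 2 1])
qed

lemma dvg_curl:
  fixes u :: vfield
  assumes "Ck 2 u"
  shows "dvg (curl u) x = 0"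
proof -
  have u2: "Ck (Suc (Suc 0)) u" using assms by (simp add: numeral_2_eq_2)
  note d1 = Ck_differentiable[OF u2]
  note pu = Ck_partial[OF u2]
  have sw: "partial a (\<lambda>y. partial b u y $ c) x = partial a (partial b (\<lambda>y. u y $ c)) x" for a b c
  proof -
    have "(\<lambda>y. partial b u y $ c) = partial b (\<lambda>y. u y $ c)"
      by (rule ext) (rule partial_nth[OF d1, symmetric])
    then show ?thesis by simp
  qed
  have dp: "(\<lambda>y. partial b u y $ c) differentiable (at x)" for b c
    using Ck_differentiable[OF Ck_nth[OF pu]] .
  have comp: "curl u y $ 1 = partial 2 u y $ 3 - partial 3 u y $ 2"
    "curl u y $ 2 = partial 3 u y $ 1 - partial 1 u y $ 3"
    "curl u y $ 3 = partial 1 u y $ 2 - partial 2 u y $ 1" for y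
    by (simp_all add: curl_def)
  have "Ck (Suc 0) (curl u)"
  proof (rule Ck_vec)
    have diff: "Ck (Suc 0) (\<lambda>y. partial a u y $ b - partial c u y $ d)" for a b c d
      using Ck_add[OF Ck_nth[OF pu, of a b] Ck_scaleR[OF Ck_const[of _ "-1"] Ck_nth[OF pu, of c d]]] by simp
    show "Ck (Suc 0) (\<lambda>y. curl u y $ i)" for i
      using exhaust_3[of i] diff by (auto simp: comp)
  qed
  then have dc: "curl u differentiable (at x)" by (rule Ck_differentiable)
  have pc: "partial i (curl u) x $ i = partial i (\<lambda>y. curl u y $ i) x" for i
    by (rule partial_nth[OF dc, symmetric])
  note c2 = partial_commute[OF Ck_nth[OF assms]]
  show ?thesis
    unfolding dvg_def pc sum_3 comp
    by (simp add: partial_diff dp sw c2[of 3 2] c2[of 3 1] c2[of 2 1])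
qed


section \<open>The hydrodynamic energy balance\<close>

lemma de_rhamD:
  assumes "de_rham_spaces M S"
  shows "fe_space M (V0 S)" "fe_space M (V1 S)" "fe_space M (V2 S)" "fe_space M (V3 S)"
    "V0 S \<subseteq> H1 M" "V2 S \<subseteq> Hdiv M" "(\<lambda>_. 1) \<in> V0 S"
    "\<And>\<theta>. \<theta> \<in> V0 S \<Longrightarrow> \<exists>a\<in>V1 S. agree M a (grad \<theta>)"
  using assms unfolding de_rham_spaces_def by simp_all

lemma V2o_subset: "V2o M S \<subseteq> V2 S"
  unfolding V2o_def by blast

text \<open>Velocity derivatives are linear combinations of velocities, and they have to be admissible test
  functions in the equation of the mass flux.\<close>

lemma V2o_lincomb:
  assumes M: "fe_mesh M" and S: "fe_space M (V2 S)" and B: "finite B" "B \<subseteq> V2o M S"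
  shows "(\<lambda>x. \<Sum>b\<in>B. c b *\<^sub>R b x) \<in> V2o M S"
proof -
  have BV: "B \<subseteq> V2 S" using B(2) V2o_subset by blast
  have "AE x in surf. x \<in> K \<inter> bdry M \<longrightarrow> cell_trace K (\<lambda>x. \<Sum>b\<in>B. c b *\<^sub>R b x) x \<bullet> normal K x = 0"
    if K: "K \<in> Cells M" for K
  proof -
    have "AE x in surf. \<forall>b\<in>B. x \<in> K \<inter> bdry M \<longrightarrow> cell_trace K b x \<bullet> normal K x = 0"
      using B K unfolding V2o_def by (subst AE_finite_all[OF B(1)]) blast
    then show ?thesis
    proof eventually_elim
      case (elim x)
      show ?case
      proof
        assume x: "x \<in> K \<inter> bdry M"
        have cl: "x \<in> closure (interior K)" using x mesh_cellD(2)[OF fe_meshD(3)[OF M K]] by blast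
        have "(b \<longlongrightarrow> cell_trace K b x) (at x within interior K)" if b: "b \<in> B" for b
        proof -
          obtain G where G: "\<And>K. K \<in> Cells M \<Longrightarrow> smooth (G K)"
            "\<And>K x. K \<in> Cells M \<Longrightarrow> x \<in> interior K \<Longrightarrow> b x = G K x"
            using pw_smooth_extension[OF fe_space_member(1)[OF S subsetD[OF BV b]]] by blast
          have "(b \<longlongrightarrow> G K x) (at x within interior K)"
            by (rule tendsto_trace[OF G(2)[OF K] smooth_isCont[OF G(1)[OF K]]])
          then show ?thesis using cell_trace_eqI[OF cl] by metis
        qed
        then have "((\<lambda>x. \<Sum>b\<in>B. c b *\<^sub>R b x) \<longlongrightarrow> (\<Sum>b\<in>B. c b *\<^sub>R cell_trace K b x)) (at x within interior K)"
          by (intro tendsto_sum tendsto_scaleR tendsto_const)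
        then have "cell_trace K (\<lambda>x. \<Sum>b\<in>B. c b *\<^sub>R b x) x = (\<Sum>b\<in>B. c b *\<^sub>R cell_trace K b x)"
          by (rule cell_trace_eqI[OF cl])
        then show "cell_trace K (\<lambda>x. \<Sum>b\<in>B. c b *\<^sub>R b x) x \<bullet> normal K x = 0"
          using elim x by (simp add: inner_sum_left)
      qed
    qed
  qed
  then show ?thesis using fe_space_lincomb[OF S B(1) BV] unfolding V2o_def by blast
qed

lemma int_facets_cong:
  assumes M: "fe_mesh M" and eq: "\<And>e x. e \<in> Facets M \<Longrightarrow> x \<in> fset e \<Longrightarrow> g e x = g' e x"
  shows "int_facets M g = int_facets M g'"
  unfolding int_facets_def
proof (rule sum.cong[OF refl])
  fix e assume e: "e \<in> Facets M"
  obtain K L p where k: "e = (K, L, p)" by (cases e)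
  have "(K, L, p) \<in> all_facets M" using e fe_mesh_facets(1)[OF M] unfolding k by blast
  from borel_closed[OF closed_fset[OF M this]] have "fset e \<in> sets surf" unfolding k sets_surf .
  then show "(LINT x:fset e|surf. g e x) = (LINT x:fset e|surf. g' e x)"
    by (rule set_lebesgue_integral_cong) (use eq[OF e] in blast)
qed

lemma facet_in_closures:
  assumes M: "fe_mesh M" and e: "(K, L, p) \<in> Facets M" and x: "x \<in> fset (K, L, p)"
  shows "x \<in> closure (interior K)" "x \<in> closure (interior ((+) p ` L))"
proof -
  have "(K, L, p) \<in> all_facets M" using e fe_mesh_facets(1)[OF M] by blast
  note d = all_facetsD[OF this]
  have "closure (interior ((+) p ` L)) = (+) p ` L"
    by (rule closure_interior_plus[OF mesh_cellD(2)[OF fe_meshD(3)[OF M d(2)]]])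
  then show "x \<in> closure (interior K)" "x \<in> closure (interior ((+) p ` L))"
    using x mesh_cellD(2)[OF fe_meshD(3)[OF M d(1)]] by simp_all
qed

lemma trace_const:
  assumes M: "fe_mesh M" and e: "e \<in> Facets M" and x: "x \<in> fset e"
  shows "tr_plus e (\<lambda>_. c) x = c" "tr_minus e (\<lambda>_. c) x = c"
proof -
  obtain K L p where k: "e = (K, L, p)" by (cases e)
  note cl = facet_in_closures[OF M e[unfolded k] x[unfolded k]]
  show "tr_plus e (\<lambda>_. c) x = c" "tr_minus e (\<lambda>_. c) x = c"
    unfolding k tr_plus.simps tr_minus.simps by (intro cell_trace_eqI cl tendsto_const)+
qed

text \<open>Taking \<open>m\<close> out of a trace presupposes that the trace exists, because \<open>Lim\<close> is arbitrary otherwise. The lower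
  bound on the density makes the quotient converge.\<close>

lemma trace_quotient_scale:
  fixes F :: vfield and n :: sfield
  assumes M: "fe_mesh M" and F: "pw_smooth M F" "periodic M F" and n: "pw_smooth M n" "periodic M n"
    and pos: "c > 0" "\<And>x. x \<in> omega M \<Longrightarrow> c \<le> n x"
    and e: "e \<in> Facets M" and x: "x \<in> fset e"
  shows "tr_plus e (\<lambda>x. F x /\<^sub>R (m * n x)) x = tr_plus e (\<lambda>x. F x /\<^sub>R n x) x /\<^sub>R m"
    "tr_minus e (\<lambda>x. F x /\<^sub>R (m * n x)) x = tr_minus e (\<lambda>x. F x /\<^sub>R n x) x /\<^sub>R m"
proof -
  obtain K L p where k: "e = (K, L, p)" by (cases e)
  have "(K, L, p) \<in> all_facets M" using e fe_mesh_facets(1)[OF M] unfolding k by blast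
  note d = all_facetsD[OF this]
  note cl = facet_in_closures[OF M e[unfolded k] x[unfolded k]]
  obtain GF where GF: "\<And>K. K \<in> Cells M \<Longrightarrow> smooth (GF K)"
    "\<And>K x. K \<in> Cells M \<Longrightarrow> x \<in> interior K \<Longrightarrow> F x = GF K x"
    using pw_smooth_extension[OF F(1)] by blast
  obtain Gn where Gn: "\<And>K. K \<in> Cells M \<Longrightarrow> smooth (Gn K)"
    "\<And>K x. K \<in> Cells M \<Longrightarrow> x \<in> interior K \<Longrightarrow> n x = Gn K x"
    using pw_smooth_extension[OF n(1)] by blast
  have lim: "(F \<longlongrightarrow> GF K x) (at x within interior K)" "(n \<longlongrightarrow> Gn K x) (at x within interior K)"
    by (intro tendsto_trace GF(2)[OF d(1)] Gn(2)[OF d(1)] smooth_isCont GF(1)[OF d(1)] Gn(1)[OF d(1)]; assumption)+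
  have lim': "(F \<longlongrightarrow> GF L (x - p)) (at x within interior ((+) p ` L))"
    "(n \<longlongrightarrow> Gn L (x - p)) (at x within interior ((+) p ` L))"
    by (intro tendsto_trace_shift[OF F(2) d(3)] tendsto_trace_shift[OF n(2) d(3)]
        GF(2)[OF d(2)] Gn(2)[OF d(2)] smooth_isCont GF(1)[OF d(2)] Gn(1)[OF d(2)]; assumption)+
  have gen: "cell_trace A (\<lambda>x. F x /\<^sub>R (m * n x)) x = cell_trace A (\<lambda>x. F x /\<^sub>R n x) x /\<^sub>R m"
    if cl: "x \<in> closure (interior A)" and l: "(F \<longlongrightarrow> a) (at x within interior A)" "(n \<longlongrightarrow> b) (at x within interior A)"
      and ge: "\<And>y. y \<in> interior A \<Longrightarrow> c \<le> n y" for A a b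
  proof -
    have "c \<le> b"
      by (rule tendsto_lowerbound[OF l(2) _ trace_filter_nontrivial[OF cl]])
         (auto simp: eventually_at_filter ge)
    then have "b \<noteq> 0" using pos(1) by simp
    then have q: "((\<lambda>x. F x /\<^sub>R n x) \<longlongrightarrow> a /\<^sub>R b) (at x within interior A)"
      by (intro tendsto_scaleR tendsto_inverse l)
    have "((\<lambda>x. inverse m *\<^sub>R (F x /\<^sub>R n x)) \<longlongrightarrow> inverse m *\<^sub>R (a /\<^sub>R b)) (at x within interior A)"
      by (rule tendsto_scaleR[OF tendsto_const q])
    then have "cell_trace A (\<lambda>x. inverse m *\<^sub>R (F x /\<^sub>R n x)) x = inverse m *\<^sub>R (a /\<^sub>R b)"
      by (rule cell_trace_eqI[OF cl])
    then show ?thesis using cell_trace_eqI[OF cl q] by simp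
  qed
  have ge: "c \<le> n y" if "y \<in> interior K" for y
    using pos(2) that d(1) unfolding omega_def by blast
  have ge': "c \<le> n y" if y: "y \<in> interior ((+) p ` L)" for y
  proof -
    obtain z where z: "z \<in> interior L" "y = p + z" using y unfolding interior_plus by (elim imageE) blast
    have "n (z + p) = n z" using n(2) d(3) unfolding periodic_def by blast
    moreover have "c \<le> n z" using pos(2) z(1) d(2) unfolding omega_def by blast
    ultimately show ?thesis using z(2) by (simp add: add.commute)
  qed
  show "tr_plus e (\<lambda>x. F x /\<^sub>R (m * n x)) x = tr_plus e (\<lambda>x. F x /\<^sub>R n x) x /\<^sub>R m"
    unfolding k tr_plus.simps by (rule gen[OF cl(1) lim ge])
  show "tr_minus e (\<lambda>x. F x /\<^sub>R (m * n x)) x = tr_minus e (\<lambda>x. F x /\<^sub>R n x) x /\<^sub>R m"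
    unfolding k tr_minus.simps by (rule gen[OF cl(2) lim' ge'])
qed

lemma int_facets_cmult: "int_facets M (\<lambda>e x. c * g e x) = c * int_facets M g"
  unfolding int_facets_def by (simp add: sum_distrib_left)

lemma ip_scale_left: "ip M (\<lambda>x. c *\<^sub>R f x) g = c * ip M f g"
  and ip_scale_right: "ip M f (\<lambda>x. c *\<^sub>R g x) = c * ip M f g"
  unfolding ip_def by simp_all

lemma ip_minus_right: "ip M f (\<lambda>x. - g x) = - ip M f g"
  using ip_scale_right[of M f "-1" g] by simp

lemma ip_commute: "ip M f g = ip M g f"
  unfolding ip_def by (simp add: inner_commute)

text \<open>The mechanical and internal energy change by the heating minus the work of the Lorentz force. Test the
  momentum equation with \<open>F\<close>, where \<open>F \<times> F = 0\<close> removes the advection terms, and multiply by the ion mass; test the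
  temperature equation with \<open>1\<close>, where \<open>grad 1 = 0\<close> removes the stabilization. The pressure terms of both
  cancel, facet integrals included. The term with \<open>\<bar>V\<bar>\<^sup>2\<close> is matched by the continuity equation, and
  what is left is the integration by parts between \<open>T\<close> and \<open>F\<close>.\<close>

lemma hydro_power:
  assumes M: "fe_mesh M" and S: "de_rham_spaces M S" and m: "ion_mass p > 0"
    and n: "n \<in> V3 S" and V: "V \<in> V2o M S" "V' \<in> V2o M S" and T: "T \<in> V0 S" "T' \<in> V0 S"
    and pos: "c > 0" "\<And>x. x \<in> omega M \<Longrightarrow> c \<le> n x"
    and dens: "density_eq M n' F" and flux: "flux_eq M S n V F"
    and mom: "momentum_eq M S p n V V' T F j BL" and temp: "temperature_eq M S p n T T' F Q"
  shows "ion_mass p * ip M (\<lambda>x. (norm (V x))\<^sup>2 / 2) n' + ion_mass p * ip M V' (\<lambda>x. n x *\<^sub>R V x)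
      + ip M T n' / (adiabatic_index - 1) + ip M n T' / (adiabatic_index - 1)
    = Q (\<lambda>_. 1) - ip M j (\<lambda>x. (F x /\<^sub>R n x) \<times>\<^sub>v BL x)"
proof -
  let ?m = "ion_mass p" and ?a = "adiabatic_index - 1"
  let ?q = "\<lambda>x. F x /\<^sub>R n x"
  note D = de_rhamD[OF S]
  have FV: "F \<in> V2o M S" using flux unfolding flux_eq_def by blast
  then have F2: "F \<in> V2 S" using V2o_subset by blast
  note Fs = fe_space_member[OF D(3) F2] and ns = fe_space_member[OF D(4) n] and Ts = fe_space_member[OF D(1) T(1)]
  have Vs: "pw_smooth M V" "pw_smooth M V'"
    using fe_space_member(1)[OF D(3)] V V2o_subset by blast+
  define X where "X = ip M ?q (grad (\<lambda>x. n x * T x))"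
  define Y where "Y = int_facets M (\<lambda>e x. jump e (\<lambda>x. n x * T x) x * navg e ?q x)"
  define W where "W = ip M j (\<lambda>x. ?q x \<times>\<^sub>v BL x)"
  have sc: "F x /\<^sub>R (?m * n x) = inverse ?m *\<^sub>R ?q x" for x by simp
  have "ip M F V' + ip M (curl (\<lambda>x. F x \<times>\<^sub>v ?q x)) V
      - int_facets M (\<lambda>e x. cross_avg_ncross e (\<lambda>x. F x \<times>\<^sub>v ?q x) x \<bullet> upwind e V x)
      - ip M (\<lambda>x. (norm (V x))\<^sup>2 / 2) (dvg F)
      + ip M j (\<lambda>x. (F x /\<^sub>R (?m * n x)) \<times>\<^sub>v BL x)
      + ip M (\<lambda>x. F x /\<^sub>R (?m * n x)) (grad (\<lambda>x. n x * T x))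
      - int_facets M (\<lambda>e x. jump e (\<lambda>x. n x * T x) x * navg e (\<lambda>x. F x /\<^sub>R (?m * n x)) x) = 0"
    using mom FV unfolding momentum_eq_def by blast
  moreover have FF: "(\<lambda>x. F x \<times>\<^sub>v ?q x) = (\<lambda>_. 0)"
    by (simp add: fun_eq_iff cross_mult_right cross_refl)
  moreover have "ip M (curl (\<lambda>x. F x \<times>\<^sub>v ?q x)) V = 0" unfolding FF by (simp add: ip_def)
  moreover have "int_facets M (\<lambda>e x. cross_avg_ncross e (\<lambda>x. F x \<times>\<^sub>v ?q x) x \<bullet> upwind e V x) = 0"
  proof -
    have "int_facets M (\<lambda>e x. cross_avg_ncross e (\<lambda>x. F x \<times>\<^sub>v ?q x) x \<bullet> upwind e V x) = int_facets M (\<lambda>e x. 0)"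
      unfolding FF by (rule int_facets_cong[OF M]) (simp add: cross_avg_ncross_def trace_const[OF M])
    then show ?thesis by (simp add: int_facets_def)
  qed
  moreover have "ip M j (\<lambda>x. (F x /\<^sub>R (?m * n x)) \<times>\<^sub>v BL x) = W / ?m"
    unfolding sc cross_mult_left ip_scale_right W_def by (simp add: field_simps)
  moreover have "ip M (\<lambda>x. F x /\<^sub>R (?m * n x)) (grad (\<lambda>x. n x * T x)) = X / ?m"
    unfolding sc ip_scale_left X_def by (simp add: field_simps)
  moreover have "int_facets M (\<lambda>e x. jump e (\<lambda>x. n x * T x) x * navg e (\<lambda>x. F x /\<^sub>R (?m * n x)) x) = Y / ?m"
  proof -
    have "int_facets M (\<lambda>e x. jump e (\<lambda>x. n x * T x) x * navg e (\<lambda>x. F x /\<^sub>R (?m * n x)) x) =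
          int_facets M (\<lambda>e x. inverse ?m * (jump e (\<lambda>x. n x * T x) x * navg e ?q x))"
    proof (rule int_facets_cong[OF M])
      fix e x assume e: "e \<in> Facets M" "x \<in> fset e"
      note tr = trace_quotient_scale[OF M Fs ns pos e, of ?m]
      have "navg e (\<lambda>x. F x /\<^sub>R (?m * n x)) x = inverse ?m * navg e ?q x"
        by (simp only: navg_def tr) (simp add: navg_def inner_scaleR_left diff_divide_distrib right_diff_distrib)
      then show "jump e (\<lambda>x. n x * T x) x * navg e (\<lambda>x. F x /\<^sub>R (?m * n x)) x =
          inverse ?m * (jump e (\<lambda>x. n x * T x) x * navg e ?q x)" by simp
    qed
    then show ?thesis unfolding int_facets_cmult Y_def by (simp add: field_simps)
  qed
  ultimately have mom': "ip M F V' - ip M (\<lambda>x. (norm (V x))\<^sup>2 / 2) (dvg F) + W / ?m + X / ?m - Y / ?m = 0"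
    by simp
  have "ip M (\<lambda>x. n x * 1 / ?a) T'
      + ip M (\<lambda>x. (1 / ?a) *\<^sub>R F x) (grad T)
      + int_facets M (\<lambda>e x. (facet_area e)\<^sup>2 * kappa_T p / (?a * avg e n x)
            * jump e (\<lambda>x. F x \<bullet> grad (\<lambda>_. 1) x) x * jump e (\<lambda>x. F x \<bullet> grad T x) x)
      - ip M ?q (grad (\<lambda>x. 1 * n x * T x))
      + int_facets M (\<lambda>e x. jump e (\<lambda>x. 1 * n x * T x) x * navg e ?q x)
      = Q (\<lambda>_. 1)"
    using bspec[OF temp[unfolded temperature_eq_def] D(7)] .
  moreover have "int_facets M (\<lambda>e x. (facet_area e)\<^sup>2 * kappa_T p / (?a * avg e n x)
            * jump e (\<lambda>x. F x \<bullet> grad (\<lambda>_. 1) x) x * jump e (\<lambda>x. F x \<bullet> grad T x) x) = 0"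
  proof -
    have "int_facets M (\<lambda>e x. (facet_area e)\<^sup>2 * kappa_T p / (?a * avg e n x)
            * jump e (\<lambda>x. F x \<bullet> grad (\<lambda>_. 1) x) x * jump e (\<lambda>x. F x \<bullet> grad T x) x) = int_facets M (\<lambda>e x. 0)"
    proof (rule int_facets_cong[OF M])
      fix e x assume e: "e \<in> Facets M" "x \<in> fset e"
      have "jump e (\<lambda>x. F x \<bullet> grad (\<lambda>_. 1) x) x = 0"
        by (simp add: jump_def trace_const[OF M e])
      then show "(facet_area e)\<^sup>2 * kappa_T p / (?a * avg e n x)
            * jump e (\<lambda>x. F x \<bullet> grad (\<lambda>_. 1) x) x * jump e (\<lambda>x. F x \<bullet> grad T x) x = 0" by simp
    qed
    then show ?thesis by (simp add: int_facets_def)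
  qed
  moreover have "ip M (\<lambda>x. n x * 1 / ?a) T' = ip M n T' / ?a"
    using ip_scale_left[of M "inverse ?a" n T'] by (simp add: field_simps)
  moreover have "ip M (\<lambda>x. (1 / ?a) *\<^sub>R F x) (grad T) = ip M F (grad T) / ?a"
    by (subst ip_scale_left) simp
  ultimately have temp': "ip M n T' / ?a + ip M F (grad T) / ?a - X + Y = Q (\<lambda>_. 1)"
    unfolding X_def Y_def by simp
  have i: "set_integrable lebesgue (omega M) (\<lambda>x. V' x \<bullet> F x)"
    "set_integrable lebesgue (omega M) (\<lambda>x. V' x \<bullet> (n x *\<^sub>R V x))"
    by (intro pwc_integrable[OF M] pwc_inner pwc_scaleR pw_smooth_imp_pwc Fs(1) ns(1) Vs)+
  have "ip M V' (\<lambda>x. F x - n x *\<^sub>R V x) = 0" using flux V(2) unfolding flux_eq_def by blast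
  then have flux': "ip M F V' = ip M V' (\<lambda>x. n x *\<^sub>R V x)"
    using set_integral_diff(2)[OF i] ip_commute[of M F V'] unfolding ip_def inner_diff_right by simp
  have n': "n' x = - dvg F x" if "x \<in> omega M" for x
    using dens that unfolding density_eq_def agree_def by (simp add: add_eq_0_iff2)
  have kin: "ip M (\<lambda>x. (norm (V x))\<^sup>2 / 2) n' = - ip M (\<lambda>x. (norm (V x))\<^sup>2 / 2) (dvg F)"
    unfolding ip_minus_right[symmetric] by (rule ip_cong) (simp add: n')
  have Tn: "ip M T n' = - ip M T (dvg F)"
    unfolding ip_minus_right[symmetric] by (rule ip_cong) (simp add: n')
  have "(LINT x:omega M|lebesgue. T x * dvg F x + F x \<bullet> grad T x) = 0"
  proof (rule int_Dom_by_parts[OF M _ Ts _ Fs])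
    show "T \<in> H1 M" "F \<in> Hdiv M" using T(1) F2 D(5,6) by blast+
    show "\<forall>K\<in>Cells M. AE x in surf. x \<in> K \<inter> bdry M \<longrightarrow> cell_trace K F x \<bullet> normal K x = 0"
      using FV unfolding V2o_def by blast
  qed
  moreover have "set_integrable lebesgue (omega M) (\<lambda>x. T x * dvg F x)"
    "set_integrable lebesgue (omega M) (\<lambda>x. F x \<bullet> grad T x)"
    by (intro pwc_integrable[OF M] pwc_inner pwc_mult pw_smooth_imp_pwc[OF Ts(1)]
        pw_smooth_imp_pwc[OF Fs(1)] pw_smooth_derivs(1)[OF Ts(1)] pw_smooth_derivs(2)[OF Fs(1)])+
  ultimately have ibp: "ip M T (dvg F) + ip M F (grad T) = 0"
    using set_integral_add(2)[of lebesgue "omega M" "\<lambda>x. T x * dvg F x" "\<lambda>x. F x \<bullet> grad T x"]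
    unfolding ip_def inner_real_def by simp
  have "?m * (ip M F V' - ip M (\<lambda>x. (norm (V x))\<^sup>2 / 2) (dvg F)) = Y - X - W"
  proof -
    have "?m * (ip M F V' - ip M (\<lambda>x. (norm (V x))\<^sup>2 / 2) (dvg F) + W / ?m + X / ?m - Y / ?m) = 0"
      unfolding mom' by simp
    moreover have "?m * (W / ?m) = W" "?m * (X / ?m) = X" "?m * (Y / ?m) = Y" using m by simp_all
    ultimately show ?thesis unfolding right_diff_distrib distrib_left by linarith
  qed
  moreover have "ip M T (dvg F) / ?a = - (ip M F (grad T) / ?a)"
    using ibp by (simp add: add_eq_0_iff2)
  ultimately show ?thesis
    using temp' unfolding kin Tn flux'[symmetric] W_def[symmetric] by (simp add: algebra_simps)
qed


section \<open>Magnetic work and total energy\<close>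

lemma avg_one:
  assumes "fe_mesh M" "e \<in> Facets M" "x \<in> fset e"
  shows "avg e (\<lambda>_. 1) x = 1"
  by (simp add: avg_def trace_const[OF assms])

lemma subgrid_heating_one:
  assumes M: "fe_mesh M"
  shows "subgrid_heating M p j (\<lambda>_. 1) =
    int_facets M (\<lambda>e x. (facet_area e)\<^sup>2 * kappa_B p * (norm (jump e j x))\<^sup>2)"
  unfolding subgrid_heating_def by (rule int_facets_cong[OF M]) (simp add: avg_one[OF M])

lemma helicity_heating_one:
  assumes M: "fe_mesh M"
  shows "helicity_heating M p Bc j (\<lambda>_. 1) =
    int_facets M (\<lambda>e x. (facet_area e)\<^sup>2 * kappa_B p * (norm (jump e (\<lambda>y. Bc y \<times>\<^sub>v j y) x))\<^sup>2)"
  unfolding helicity_heating_def by (rule int_facets_cong[OF M]) (simp add: avg_one[OF M])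

lemma ip_minus_cross: "ip M j (\<lambda>x. (- (q x)) \<times>\<^sub>v b x) = - ip M j (\<lambda>x. q x \<times>\<^sub>v b x)"
  unfolding cross_minus_left ip_minus_right ..

text \<open>Testing the equation of the electric field with the current turns the stabilization into exactly the heating
  functional at \<open>1\<close>, and the transport term into the Lorentz work. The latter requires the same magnetic field in
  both equations, which fails for \<open>B\<^sub>L = B \<noteq> \<B>\<close>.\<close>

lemma electric_work:
  assumes M: "fe_mesh M" and E: "electric_eq M p W st n V F B B' Bc j E"
    and j: "j \<in> W" and Bc: "penalty_field_eq M S st B Bc" and st: "st \<noteq> HelicityPreserving"
  shows "ip M j E = heating M p st Bc j (\<lambda>_. 1)
      - ip M j (\<lambda>x. (F x /\<^sub>R n x) \<times>\<^sub>v lorentz_field M p st n V F B B' Bc x)"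
proof (cases st)
  case SUPG
  then have "ip M j E = ip M j (\<lambda>x. (- (F x /\<^sub>R n x)) \<times>\<^sub>v supg_field M p n V F B B' x)"
    using E j by (simp add: electric_eq_def is_L2_projection_def)
  then show ?thesis unfolding ip_minus_cross by (simp add: SUPG heating_def lorentz_field_def)
next
  case SubgridResistivity
  then have "ip M j E = ip M j (\<lambda>x. (- (F x /\<^sub>R n x)) \<times>\<^sub>v B x)
        + int_facets M (\<lambda>e x. (facet_area e)\<^sup>2 * kappa_B p * (jump e j x \<bullet> jump e j x))"
    using E j by (simp add: electric_eq_def subgrid_E_def)
  then show ?thesis unfolding ip_minus_cross power2_norm_eq_inner[symmetric]
    by (simp add: SubgridResistivity heating_def lorentz_field_def subgrid_heating_one[OF M])
next
  case HelicityNeutral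
  then have "ip M j E = ip M j (\<lambda>x. (- (F x /\<^sub>R n x)) \<times>\<^sub>v Bc x)
        + int_facets M (\<lambda>e x. (facet_area e)\<^sup>2 * kappa_B p *
            (jump e (\<lambda>y. Bc y \<times>\<^sub>v j y) x \<bullet> jump e (\<lambda>y. Bc y \<times>\<^sub>v j y) x))"
    using E j by (simp add: electric_eq_def helicity_E_def)
  moreover have "Bc = B" using Bc by (simp add: HelicityNeutral penalty_field_eq_def projected_def)
  ultimately show ?thesis unfolding ip_minus_cross power2_norm_eq_inner[symmetric]
    by (simp add: HelicityNeutral heating_def lorentz_field_def helicity_heating_one[OF M])
next
  case HelicityPreservingL
  then have "ip M j E = ip M j (\<lambda>x. (- (F x /\<^sub>R n x)) \<times>\<^sub>v Bc x)
        + int_facets M (\<lambda>e x. (facet_area e)\<^sup>2 * kappa_B p *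
            (jump e (\<lambda>y. Bc y \<times>\<^sub>v j y) x \<bullet> jump e (\<lambda>y. Bc y \<times>\<^sub>v j y) x))"
    using E j by (simp add: electric_eq_def helicity_E_def)
  then show ?thesis unfolding ip_minus_cross power2_norm_eq_inner[symmetric]
    by (simp add: HelicityPreservingL heating_def lorentz_field_def helicity_heating_one[OF M])
qed (use st in simp)

lemma electric_member: "electric_eq M p W st n V F B B' Bc j E \<Longrightarrow> E \<in> W"
  by (cases st) (simp_all add: electric_eq_def is_L2_projection_def subgrid_E_def helicity_E_def)

lemma magnetic_energy_deriv:
  assumes M: "fe_mesh M" and mu: "vac_perm p > 0"
    and B: "fe_curve I W B B'" "fe_space M W" and t: "t \<in> I"
  shows "((\<lambda>\<tau>. magnetic_energy M p (B \<tau>)) has_real_derivative ip M (B t) (B' t) / vac_perm p) (at t within I)"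
proof -
  have W: "pwc M w" if "w \<in> W" for w using fe_space_member(1)[OF B(2) that] by (rule pw_smooth_imp_pwc)
  have "fe_integrand M I (\<lambda>t x. inverse (2 * vac_perm p) * (B t x \<bullet> B t x))
      (\<lambda>t x. inverse (2 * vac_perm p) * (B' t x \<bullet> B t x + B t x \<bullet> B' t x))"
    by (rule fe_integrand_cmult[OF fe_integrand_inner[OF
        fe_curve_integrand_nth[OF B(1) W] fe_curve_integrand_nth[OF B(1) W]]])
  then have "fe_integrand M I (\<lambda>t x. (norm (B t x))\<^sup>2 / (2 * vac_perm p))
      (\<lambda>t x. inverse (vac_perm p) * (B t x \<bullet> B' t x))"
  proof (rule fe_integrand.cong, intro ballI conjI)
    fix t x
    show "inverse (2 * vac_perm p) * (B t x \<bullet> B t x) = (norm (B t x))\<^sup>2 / (2 * vac_perm p)"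
      unfolding power2_norm_eq_inner divide_inverse by (rule mult.commute)
    have "B' t x \<bullet> B t x = B t x \<bullet> B' t x" by (rule inner_commute)
    moreover have "inverse 2 * i * (y + y) = i * y" for i y :: real by simp
    ultimately show "inverse (2 * vac_perm p) * (B' t x \<bullet> B t x + B t x \<bullet> B' t x) = inverse (vac_perm p) * (B t x \<bullet> B' t x)"
      by (simp only: inverse_mult_distrib)
  qed
  from bspec[OF fe_integrand_integral[OF M this] t]
  have "((\<lambda>\<tau>. magnetic_energy M p (B \<tau>)) has_real_derivative
      (LINT x:omega M|lebesgue. inverse (vac_perm p) * (B t x \<bullet> B' t x))) (at t within I)"
    unfolding magnetic_energy_def by (elim conjE)
  moreover have "(LINT x:omega M|lebesgue. inverse (vac_perm p) * (B t x \<bullet> B' t x)) = ip M (B t) (B' t) / vac_perm p"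
    unfolding set_integral_mult_right ip_def divide_inverse[of _ "vac_perm p"] by (rule mult.commute)
  ultimately show ?thesis by (simp only:)
qed

lemma total_energy_deriv:
  assumes M: "fe_mesh M" and S: "de_rham_spaces M S" and mu: "vac_perm p > 0"
    and n: "fe_curve I (V3 S) n n'" and V: "fe_curve I (V2o M S) V V'" and T: "fe_curve I (V0 S) T T'"
    and B: "fe_curve I W B B'" "fe_space M W" and t: "t \<in> I"
  shows "((\<lambda>\<tau>. total_energy M p (n \<tau>) (V \<tau>) (T \<tau>) (B \<tau>)) has_real_derivative
      (ion_mass p * ip M (\<lambda>x. (norm (V t x))\<^sup>2 / 2) (n' t) + ion_mass p * ip M (V' t) (\<lambda>x. n t x *\<^sub>R V t x)
      + ip M (T t) (n' t) / (adiabatic_index - 1) + ip M (n t) (T' t) / (adiabatic_index - 1))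
      + ip M (B t) (B' t) / vac_perm p) (at t within I)"
proof -
  let ?m = "ion_mass p" and ?a = "adiabatic_index - 1"
  note D = de_rhamD[OF S]
  have p3: "pwc M w" if "w \<in> V3 S" for w using fe_space_member(1)[OF D(4) that] by (rule pw_smooth_imp_pwc)
  have p2: "pwc M w" if "w \<in> V2o M S" for w
    using fe_space_member(1)[OF D(3) subsetD[OF V2o_subset that]] by (rule pw_smooth_imp_pwc)
  have p0: "pwc M w" if "w \<in> V0 S" for w using fe_space_member(1)[OF D(1) that] by (rule pw_smooth_imp_pwc)
  let ?k = "\<lambda>t x. n t x * (V t x \<bullet> V t x)" and ?i = "\<lambda>t x. n t x * T t x"
  let ?k' = "\<lambda>t x. n' t x * (V t x \<bullet> V t x) + n t x * (V' t x \<bullet> V t x + V t x \<bullet> V' t x)"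
  let ?i' = "\<lambda>t x. n' t x * T t x + n t x * T' t x"
  have fi: "fe_integrand M I ?k ?k'" "fe_integrand M I ?i ?i'"
    by (intro fe_integrand_mult fe_integrand_inner fe_curve_integrand[OF n p3] fe_curve_integrand[OF T p0]
        fe_curve_integrand_nth[OF V p2]; assumption)+
  note i1 = fe_integrand_integral[OF M fi(1)] and i2 = fe_integrand_integral[OF M fi(2)]
  have mem: "n t \<in> V3 S" "n' t \<in> V3 S" "V t \<in> V2o M S" "V' t \<in> V2o M S" "T t \<in> V0 S" "T' t \<in> V0 S"
    using fe_curve_member[OF n fe_space_lincomb[OF D(4)] t] fe_curve_member[OF T fe_space_lincomb[OF D(1)] t]
      fe_curve_member[OF V V2o_lincomb[OF M D(3)] t] by simp_all
  note pw = p3[OF mem(1)] p3[OF mem(2)] p2[OF mem(3)] p2[OF mem(4)] p0[OF mem(5)] p0[OF mem(6)]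
  have "(LINT x:omega M|lebesgue. ?k' t x) =
        (LINT x:omega M|lebesgue. 2 * ((norm (V t x))\<^sup>2 / 2 * n' t x)) +
        (LINT x:omega M|lebesgue. 2 * (V' t x \<bullet> (n t x *\<^sub>R V t x)))"
  proof -
    have "(LINT x:omega M|lebesgue. ?k' t x) =
        (LINT x:omega M|lebesgue. 2 * ((norm (V t x))\<^sup>2 / 2 * n' t x) + 2 * (V' t x \<bullet> (n t x *\<^sub>R V t x)))"
      by (rule set_lebesgue_integral_cong[OF sets_omega])
         (simp add: power2_norm_eq_inner inner_commute algebra_simps)
    also have "\<dots> = (LINT x:omega M|lebesgue. 2 * ((norm (V t x))\<^sup>2 / 2 * n' t x)) +
        (LINT x:omega M|lebesgue. 2 * (V' t x \<bullet> (n t x *\<^sub>R V t x)))"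
      unfolding divide_inverse
      by (intro set_integral_add(2) pwc_integrable[OF M] pwc_mult pwc_inner pwc_scaleR pwc_norm2 pwc_const pw)
    finally show ?thesis .
  qed
  then have k: "(LINT x:omega M|lebesgue. ?k' t x) =
      2 * ip M (\<lambda>x. (norm (V t x))\<^sup>2 / 2) (n' t) + 2 * ip M (V' t) (\<lambda>x. n t x *\<^sub>R V t x)"
    unfolding ip_def inner_real_def set_integral_mult_right .
  have i: "(LINT x:omega M|lebesgue. ?i' t x) = ip M (T t) (n' t) + ip M (n t) (T' t)"
  proof -
    have "(LINT x:omega M|lebesgue. ?i' t x) =
        (LINT x:omega M|lebesgue. n' t x * T t x) + (LINT x:omega M|lebesgue. n t x * T' t x)"
      by (intro set_integral_add(2) pwc_integrable[OF M] pwc_mult pw)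
    then show ?thesis unfolding ip_def inner_real_def by (simp add: mult.commute)
  qed
  have E: "total_energy M p (n \<tau>) (V \<tau>) (T \<tau>) (B \<tau>) =
      ?m / 2 * (LINT x:omega M|lebesgue. ?k \<tau> x) + inverse ?a * (LINT x:omega M|lebesgue. ?i \<tau> x) + magnetic_energy M p (B \<tau>)"
    if \<tau>: "\<tau> \<in> I" for \<tau>
  proof -
    have Bp: "pwc M (B \<tau>)"
      by (rule pw_smooth_imp_pwc[OF fe_space_member(1)[OF B(2) fe_curve_member(1)[OF B(1) fe_space_lincomb[OF B(2)] \<tau>]]])
    have b: "set_integrable lebesgue (omega M) (\<lambda>x. (norm (B \<tau> x))\<^sup>2 / (2 * vac_perm p))"
      unfolding divide_inverse by (intro pwc_integrable[OF M] pwc_mult pwc_norm2 pwc_const Bp)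
    have kk: "set_integrable lebesgue (omega M) (\<lambda>x. ?m / 2 * ?k \<tau> x)"
      "set_integrable lebesgue (omega M) (\<lambda>x. inverse ?a * ?i \<tau> x)"
      by (rule set_integrable_mult_right[OF conjunct1[OF bspec[OF i1 \<tau>]]],
          rule set_integrable_mult_right[OF conjunct1[OF bspec[OF i2 \<tau>]]])
    have "total_energy M p (n \<tau>) (V \<tau>) (T \<tau>) (B \<tau>) =
       (LINT x:omega M|lebesgue. (?m / 2 * ?k \<tau> x + inverse ?a * ?i \<tau> x) + (norm (B \<tau> x))\<^sup>2 / (2 * vac_perm p))"
      unfolding total_energy_def energy_density_def
    proof (rule set_lebesgue_integral_cong[OF sets_omega], intro allI impI)
      have "a * b * c / 2 + b * d / e + f = (a / 2 * (b * c) + inverse e * (b * d)) + f" for a b c d e f :: real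
        unfolding divide_inverse_commute[of "b * d" e, symmetric] by simp
      then show "?m * n \<tau> x * (norm (V \<tau> x))\<^sup>2 / 2 + n \<tau> x * T \<tau> x / ?a + (norm (B \<tau> x))\<^sup>2 / (2 * vac_perm p) =
          (?m / 2 * ?k \<tau> x + inverse ?a * ?i \<tau> x) + (norm (B \<tau> x))\<^sup>2 / (2 * vac_perm p)" for x
        unfolding power2_norm_eq_inner[of "V \<tau> x"] .
    qed
    also have "\<dots> = ((LINT x:omega M|lebesgue. ?m / 2 * ?k \<tau> x) + (LINT x:omega M|lebesgue. inverse ?a * ?i \<tau> x))
        + (LINT x:omega M|lebesgue. (norm (B \<tau> x))\<^sup>2 / (2 * vac_perm p))"
      unfolding set_integral_add(2)[OF set_integral_add(1)[OF kk] b] set_integral_add(2)[OF kk] ..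
    finally show ?thesis unfolding magnetic_energy_def set_integral_mult_right .
  qed
  have d1: "((\<lambda>t. LINT x:omega M|lebesgue. ?k t x) has_real_derivative (LINT x:omega M|lebesgue. ?k' t x)) (at t within I)"
    and d2: "((\<lambda>t. LINT x:omega M|lebesgue. ?i t x) has_real_derivative (LINT x:omega M|lebesgue. ?i' t x)) (at t within I)"
    using bspec[OF i1 t] bspec[OF i2 t] by blast+
  have "((\<lambda>\<tau>. total_energy M p (n \<tau>) (V \<tau>) (T \<tau>) (B \<tau>)) has_real_derivative
      (?m / 2 * (LINT x:omega M|lebesgue. ?k' t x) + inverse ?a * (LINT x:omega M|lebesgue. ?i' t x)
       + ip M (B t) (B' t) / vac_perm p)) (at t within I)"
    by (rule deriv_cong_on[OF t E[symmetric]], assumption)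
      (intro DERIV_add DERIV_cmult d1 d2 magnetic_energy_deriv[OF M mu B t])
  moreover have "m / 2 * (2 * a + 2 * b) + inverse c * (d + e) + f = (m * a + m * b + d / c + e / c) + f"
    for m a b c d e f :: real
    unfolding divide_inverse_commute[of "d + e" c, symmetric] add_divide_distrib by (simp add: distrib_left)
  ultimately show ?thesis unfolding k i by (simp only:)
qed


section \<open>Boundary integrals and the weak divergence\<close>

lemma cell_trace_cong:
  assumes "\<And>y. y \<in> interior K \<Longrightarrow> f y = g y"
  shows "cell_trace K f x = cell_trace K g x"
proof -
  have "eventually (\<lambda>y. f y = g y) (at x within interior K)"
    using assms by (auto simp: eventually_at_filter)
  then show ?thesis unfolding cell_trace_def by (rule Lim_cong) (rule refl)
qed

lemma agree_interior:
  assumes "agree M f g" "K \<in> Cells M" "x \<in> interior K"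
  shows "f x = g x"
  using assms unfolding agree_def omega_def by blast

lemma int_bdry_cong:
  assumes "\<And>K x. K \<in> Cells M \<Longrightarrow> indicator (K \<inter> A) x *\<^sub>R g K x = indicator (K \<inter> B) x *\<^sub>R h K x"
  shows "int_bdry M A g = int_bdry M B h"
  unfolding int_bdry_def set_lebesgue_integral_def using assms by simp

lemma int_bdry_zero:
  assumes "\<And>K x. K \<in> Cells M \<Longrightarrow> x \<in> K \<inter> A \<Longrightarrow> g K x = 0"
  shows "int_bdry M A g = 0"
  using int_bdry_cong[of M A g A "\<lambda>_ _. 0"] assms by (auto simp: int_bdry_def indicator_def)

lemma curl_of_gradient_member:
  assumes \<theta>: "pw_smooth M \<theta>" and a: "agree M a (grad \<theta>)" and x: "x \<in> omega M"
  shows "curl a x = 0"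
proof -
  obtain K where K: "K \<in> Cells M" "x \<in> interior K" using x unfolding omega_def by blast
  obtain G where G: "\<And>K. K \<in> Cells M \<Longrightarrow> smooth (G K)"
    "\<And>K x. K \<in> Cells M \<Longrightarrow> x \<in> interior K \<Longrightarrow> \<theta> x = G K x"
    using pw_smooth_extension[OF \<theta>] by blast
  have "a y = grad (G K) y" if y: "y \<in> interior K" for y
    using agree_interior[OF a K(1) y] grad_cong_open[OF open_interior y, of \<theta> "G K"] G(2)[OF K(1)] by simp
  then have "curl a x = curl (grad (G K)) x" by (rule curl_cong_open[OF open_interior K(2)])
  then show ?thesis using curl_grad[OF smooth_Ck[OF G(1)[OF K(1)]]] by simp
qed

text \<open>The induction equation \<open>B' = - curl E\<close> holds pointwise in the cells, where \<open>E\<close> is smooth.\<close>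

lemma dvg_of_curl_member:
  assumes E: "pw_smooth M E" and B': "agree M (\<lambda>x. B' x + curl E x) (\<lambda>_. 0)" and x: "x \<in> omega M"
  shows "dvg B' x = 0"
proof -
  obtain K where K: "K \<in> Cells M" "x \<in> interior K" using x unfolding omega_def by blast
  obtain G where G: "\<And>K. K \<in> Cells M \<Longrightarrow> smooth (G K)"
    "\<And>K x. K \<in> Cells M \<Longrightarrow> x \<in> interior K \<Longrightarrow> E x = G K x"
    using pw_smooth_extension[OF E] by blast
  have sG: "smooth (\<lambda>y. (-1) *\<^sub>R G K y)"
    unfolding smooth_def by (intro allI Ck_scaleR Ck_const smooth_Ck G(1) K(1))
  have "B' y = curl (\<lambda>y. (-1) *\<^sub>R G K y) y" if y: "y \<in> interior K" for y
  proof -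
    have d: "G K differentiable (at y)"
      using Ck_differentiable[OF smooth_Ck[OF G(1)[OF K(1)], of "Suc 0"]] .
    have "B' y = - curl E y" using agree_interior[OF B' K(1) y] by (simp add: add_eq_0_iff2)
    also have "curl E y = curl (G K) y" by (rule curl_cong_open[OF open_interior y G(2)[OF K(1)]])
    also have "- curl (G K) y = curl (\<lambda>y. (-1) *\<^sub>R G K y) y"
      unfolding curl_def partial_cmult[OF d] by (simp add: vec_eq_iff forall_3)
    finally show ?thesis .
  qed
  then have "dvg B' x = dvg (curl (\<lambda>y. (-1) *\<^sub>R G K y)) x" by (rule dvg_cong_open[OF open_interior K(2)])
  then show ?thesis using dvg_curl[OF smooth_Ck[OF sG]] by simp
qed

lemma zero_deriv_constant:
  fixes f :: "real \<Rightarrow> real"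
  assumes "\<And>t. t \<in> {0..b} \<Longrightarrow> (f has_real_derivative 0) (at t within {0..b})" "t \<in> {0..b}"
  shows "f t = f 0"
proof -
  have "\<exists>c. \<forall>x\<in>{0..b}. f x = c"
    by (rule has_field_derivative_zero_constant[OF _ assms(1)]) auto
  then show ?thesis using assms(2) by fastforce
qed

lemma dvg_fe_curve_deriv:
  assumes B: "fe_curve I W B B'" and W: "fe_space M W" and x: "x \<in> omega M" and t: "t \<in> I"
  shows "((\<lambda>\<tau>. dvg (B \<tau>) x) has_real_derivative dvg (B' t) x) (at t within I)"
proof -
  from B obtain Q c c' where Q: "finite Q" "Q \<subseteq> W"
    "\<forall>b\<in>Q. \<forall>t\<in>I. (c b has_real_derivative c' b t) (at t within I)"
    "\<forall>t\<in>I. B t = (\<lambda>x. \<Sum>b\<in>Q. c b t *\<^sub>R b x) \<and> B' t = (\<lambda>x. \<Sum>b\<in>Q. c' b t *\<^sub>R b x)"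
    unfolding fe_curve_def by (elim exE conjE)
  have d: "b differentiable (at x)" if "b \<in> Q" for b
    by (rule pw_smooth_differentiable[OF fe_space_member(1)[OF W subsetD[OF Q(2) that]] x])
  have eq: "dvg (B \<tau>) x = (\<Sum>b\<in>Q. c b \<tau> * dvg b x)" "dvg (B' \<tau>) x = (\<Sum>b\<in>Q. c' b \<tau> * dvg b x)" if "\<tau> \<in> I" for \<tau>
    using bspec[OF Q(4) that] dvg_lincomb[of Q "\<lambda>b. b" x, OF d] by simp_all
  have "((\<lambda>\<tau>. \<Sum>b\<in>Q. c b \<tau> * dvg b x) has_real_derivative (\<Sum>b\<in>Q. c' b t * dvg b x)) (at t within I)"
    using Q(3) t by (intro DERIV_sum DERIV_cmult_right) blast
  then show ?thesis unfolding eq(2)[OF t] by (rule deriv_cong_on[OF t eq(1)[symmetric], rotated])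
qed

text \<open>Differentiation under a boundary integral by dominated convergence: the bound on the time derivative bounds
  the difference quotients, by the mean value inequality.\<close>

lemma boundary_integral_deriv:
  fixes g g' :: "real \<Rightarrow> sfield" and k :: sfield
  assumes A: "A \<in> sets borel" "emeasure surf A < \<infinity>" and k: "k \<in> borel_measurable borel" "\<And>x. x \<in> A \<Longrightarrow> \<bar>k x\<bar> \<le> R"
    and d: "\<And>t x. t \<in> I \<Longrightarrow> x \<in> A \<Longrightarrow> ((\<lambda>s. g s x) has_real_derivative g' t x) (at t within I)"
    and C: "\<And>t x. t \<in> I \<Longrightarrow> x \<in> A \<Longrightarrow> \<bar>g' t x\<bar> \<le> C"
    and int: "\<And>t. t \<in> I \<Longrightarrow> set_integrable surf A (g t)" "\<And>t. t \<in> I \<Longrightarrow> set_integrable surf A (g' t)"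
    and I: "convex I" and t: "t \<in> I"
  shows "((\<lambda>t. LINT x:A|surf. k x * g t x) has_real_derivative (LINT x:A|surf. k x * g' t x)) (at t within I)"
proof -
  have kint: "set_integrable surf A (\<lambda>x. k x * f x)" if f: "set_integrable surf A f" for f :: sfield
  proof -
    have m: "(\<lambda>x. k x * (indicator A x *\<^sub>R f x)) \<in> borel_measurable surf"
      using f unfolding set_integrable_def
      by (intro borel_measurable_times borel_measurable_surf k(1) borel_measurable_integrable)
    have "integrable surf (\<lambda>x. k x * (indicator A x *\<^sub>R f x))"
    proof (rule Bochner_Integration.integrable_bound[OF _ m])
      show "integrable surf (\<lambda>x. R * (indicator A x *\<^sub>R f x))"
        using f unfolding set_integrable_def by simp
      show "AE x in surf. norm (k x * (indicator A x *\<^sub>R f x)) \<le> norm (R * (indicator A x *\<^sub>R f x))"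
      proof (rule AE_I2)
        fix x
        show "norm (k x * (indicator A x *\<^sub>R f x)) \<le> norm (R * (indicator A x *\<^sub>R f x))"
        proof (cases "x \<in> A")
          case True
          then have "\<bar>k x\<bar> \<le> \<bar>R\<bar>" using k(2) by fastforce
          then show ?thesis using True by (simp add: abs_mult mult_right_mono)
        qed simp
      qed
    qed
    then show ?thesis unfolding set_integrable_def by (simp add: mult.left_commute)
  qed
  have "((\<lambda>s. ((LINT x:A|surf. k x * g s x) - (LINT x:A|surf. k x * g t x)) / (s - t)) \<longlongrightarrow>
      (LINT x:A|surf. k x * g' t x)) (at t within I)"
    unfolding tendsto_at_iff_sequentially
  proof (intro allI impI)
    fix X :: "nat \<Rightarrow> real" assume X: "\<forall>i. X i \<in> I - {t}" "X \<longlonglongrightarrow> t"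
    let ?q = "\<lambda>i x. k x * ((g (X i) x - g t x) / (X i - t))"
    have XI: "X i \<in> I" "X i \<noteq> t" for i using X(1) by auto
    have qi: "set_integrable surf A (\<lambda>x. (g (X i) x - g t x) / (X i - t))" for i
      unfolding divide_inverse
      by (intro set_integrable_mult_left set_integral_diff(1) int(1) XI t)
    have eq: "((LINT x:A|surf. k x * g (X i) x) - (LINT x:A|surf. k x * g t x)) / (X i - t) = (LINT x:A|surf. ?q i x)" for i
    proof -
      have "(LINT x:A|surf. k x * g (X i) x) - (LINT x:A|surf. k x * g t x) = (LINT x:A|surf. k x * g (X i) x - k x * g t x)"
        by (rule set_integral_diff(2)[OF kint[OF int(1)[OF XI(1)]] kint[OF int(1)[OF t]], symmetric])
      moreover have "?q i = (\<lambda>x. inverse (X i - t) * (k x * g (X i) x - k x * g t x))"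
        by (simp add: fun_eq_iff divide_inverse algebra_simps)
      ultimately show ?thesis unfolding divide_inverse_commute[of _ "X i - t"] by simp
    qed
    have "(\<lambda>i. LINT x|surf. indicator A x *\<^sub>R ?q i x) \<longlonglongrightarrow> (LINT x|surf. indicator A x *\<^sub>R (k x * g' t x))"
    proof (rule integral_dominated_convergence[where w = "\<lambda>x. indicator A x *\<^sub>R (\<bar>R\<bar> * \<bar>C\<bar>)"])
      show "(\<lambda>x. indicator A x *\<^sub>R (k x * g' t x)) \<in> borel_measurable surf"
        using kint[OF int(2)[OF t]] unfolding set_integrable_def by (rule borel_measurable_integrable)
      show "(\<lambda>x. indicator A x *\<^sub>R ?q i x) \<in> borel_measurable surf" for i
        using kint[OF qi[of i]] unfolding set_integrable_def by (rule borel_measurable_integrable)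
      show "integrable surf (\<lambda>x. indicator A x *\<^sub>R (\<bar>R\<bar> * \<bar>C\<bar>))"
        by (rule integrableI_bounded_set_indicator[OF _ _ A(2), of _ "\<bar>R\<bar> * \<bar>C\<bar>"]) (use A in simp_all)
      show "AE x in surf. (\<lambda>i. indicator A x *\<^sub>R ?q i x) \<longlonglongrightarrow> indicator A x *\<^sub>R (k x * g' t x)"
      proof (rule AE_I2)
        fix x
        show "(\<lambda>i. indicator A x *\<^sub>R ?q i x) \<longlonglongrightarrow> indicator A x *\<^sub>R (k x * g' t x)"
        proof (cases "x \<in> A")
          case True
          have "((\<lambda>s. (g s x - g t x) / (s - t)) \<longlongrightarrow> g' t x) (at t within I)"
            using d[OF t True] unfolding has_field_derivative_iff .
          then have "((\<lambda>s. (g s x - g t x) / (s - t)) \<circ> X) \<longlonglongrightarrow> g' t x"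
            using X unfolding tendsto_at_iff_sequentially by blast
          then have "(\<lambda>i. k x * ((g (X i) x - g t x) / (X i - t))) \<longlonglongrightarrow> k x * g' t x"
            unfolding o_def by (rule tendsto_mult[OF tendsto_const])
          then show ?thesis using True by (simp only: indicator_simps scaleR_one)
        qed simp
      qed
      show "AE x in surf. norm (indicator A x *\<^sub>R ?q i x) \<le> indicator A x *\<^sub>R (\<bar>R\<bar> * \<bar>C\<bar>)" for i
      proof (rule AE_I2)
        fix x
        show "norm (indicator A x *\<^sub>R ?q i x) \<le> indicator A x *\<^sub>R (\<bar>R\<bar> * \<bar>C\<bar>)"
        proof (cases "x \<in> A")
          case True
          have "norm (g (X i) x - g t x) \<le> \<bar>C\<bar> * norm (X i - t)"
          proof (rule field_differentiable_bound[OF I, where f' = "\<lambda>t. g' t x"])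
            show "((\<lambda>s. g s x) has_field_derivative g' z x) (at z within I)" if "z \<in> I" for z
              by (rule d[OF that True])
            show "norm (g' z x) \<le> \<bar>C\<bar>" if "z \<in> I" for z using C[OF that True] by simp
          qed (use XI t in auto)
          then have "\<bar>(g (X i) x - g t x) / (X i - t)\<bar> \<le> \<bar>C\<bar>"
            using XI(2)[of i] by (simp add: abs_divide divide_le_eq)
          moreover have "\<bar>k x\<bar> \<le> \<bar>R\<bar>" using k(2)[OF True] by simp
          ultimately have "\<bar>k x\<bar> * \<bar>(g (X i) x - g t x) / (X i - t)\<bar> \<le> \<bar>R\<bar> * \<bar>C\<bar>"
            by (intro mult_mono) simp_all
          then show ?thesis using True by (simp add: abs_mult)
        qed simp
      qed
    qed
    then show "((\<lambda>s. ((LINT x:A|surf. k x * g s x) - (LINT x:A|surf. k x * g t x)) / (s - t)) \<circ> X) \<longlonglongrightarrow>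
      (LINT x:A|surf. k x * g' t x)"
      unfolding o_def eq unfolding set_lebesgue_integral_def .
  qed
  then show ?thesis unfolding has_field_derivative_iff .
qed

lemma int_bdry_deriv:
  assumes M: "fe_mesh M" and \<theta>: "pw_smooth M \<theta>" and I: "convex I" and t: "t \<in> I"
    and d: "\<forall>t\<in>I. \<forall>x\<in>bdry M. ((\<lambda>s. g s x) has_real_derivative g' t x) (at t within I)"
    and C: "\<forall>t\<in>I. \<forall>x\<in>bdry M. \<bar>g' t x\<bar> \<le> C"
    and int: "\<forall>t\<in>I. bdry_integrable M (bdry M) (g t)" "\<forall>t\<in>I. bdry_integrable M (bdry M) (g' t)"
  shows "((\<lambda>t. int_bdry M (bdry M) (\<lambda>K x. cell_trace K \<theta> x * g t x)) has_real_derivative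
      int_bdry M (bdry M) (\<lambda>K x. cell_trace K \<theta> x * g' t x)) (at t within I)"
proof -
  obtain G where G: "\<And>K. K \<in> Cells M \<Longrightarrow> smooth (G K)"
    "\<And>K x. K \<in> Cells M \<Longrightarrow> x \<in> interior K \<Longrightarrow> \<theta> x = G K x"
    using pw_smooth_extension[OF \<theta>] by blast
  have eq: "int_bdry M (bdry M) (\<lambda>K x. cell_trace K \<theta> x * f x) = (\<Sum>K\<in>Cells M. LINT x:K \<inter> bdry M|surf. G K x * f x)" for f
    unfolding int_bdry_def set_lebesgue_integral_def
  proof (intro sum.cong refl Bochner_Integration.integral_cong)
    fix K x assume K: "K \<in> Cells M"
    show "indicator (K \<inter> bdry M) x *\<^sub>R (cell_trace K \<theta> x * f x) = indicator (K \<inter> bdry M) x *\<^sub>R (G K x * f x)"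
    proof (cases "x \<in> K \<inter> bdry M")
      case True
      then have "cell_trace K \<theta> x = G K x"
        by (intro cell_trace_extension[OF M K] smooth_isCont G K) simp_all
      then show ?thesis by simp
    qed simp
  qed
  show ?thesis unfolding eq
  proof (rule DERIV_sum)
    fix K assume K: "K \<in> Cells M"
    note cK = mesh_cellD[OF fe_meshD(3)[OF M K]]
    have b: "K \<inter> bdry M = K \<inter> frontier (Dom M)" using K unfolding bdry_def by blast
    have Gc: "continuous_on UNIV (G K)" by (rule Ck_continuous[OF smooth_Ck[OF G(1)[OF K], of 0]])
    then have "bounded (G K ` K)"
      by (intro compact_imp_bounded compact_continuous_image[OF continuous_on_subset[OF Gc subset_UNIV] cK(1)])
    then obtain R where R: "\<And>x. x \<in> K \<Longrightarrow> \<bar>G K x\<bar> \<le> R" unfolding bounded_iff by auto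
    show "((\<lambda>t. LINT x:K \<inter> bdry M|surf. G K x * g t x) has_real_derivative
        (LINT x:K \<inter> bdry M|surf. G K x * g' t x)) (at t within I)"
    proof (rule boundary_integral_deriv[OF _ _ _ _ _ _ _ _ I t])
      show "K \<inter> bdry M \<in> sets borel"
        unfolding b by (intro borel_closed closed_Int cK(4) frontier_closed)
      have "K \<inter> bdry M \<subseteq> frontier K" unfolding b frontier_cell_cover[OF M K] by blast
      then have "emeasure surf (K \<inter> bdry M) \<le> emeasure surf (frontier K)"
        by (intro emeasure_mono) simp_all
      also have "\<dots> < \<infinity>" by (rule cK(7))
      finally show "emeasure surf (K \<inter> bdry M) < \<infinity>" .
      show "G K \<in> borel_measurable borel" by (rule borel_measurable_continuous_onI[OF Gc])
      show "\<bar>G K x\<bar> \<le> R" if "x \<in> K \<inter> bdry M" for x using R that by blast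
      show "((\<lambda>s. g s x) has_real_derivative g' t x) (at t within I)" if "t \<in> I" "x \<in> K \<inter> bdry M" for t x
        using d that by blast
      show "\<bar>g' t x\<bar> \<le> C" if "t \<in> I" "x \<in> K \<inter> bdry M" for t x using C that by blast
      show "set_integrable surf (K \<inter> bdry M) (g t)" "set_integrable surf (K \<inter> bdry M) (g' t)" if "t \<in> I" for t
        using int K that unfolding bdry_integrable_def by blast+
    qed
  qed
qed

text \<open>A continuous function that vanishes almost everywhere on an open set vanishes there.\<close>

lemma ip_self_zero:
  fixes f :: sfield
  assumes M: "fe_mesh M" and f: "pw_smooth M f" and z: "ip M f f = 0"
  shows "agree M f (\<lambda>_. 0)"
  unfolding agree_def
proof
  fix x assume x: "x \<in> omega M"
  then obtain K where K: "K \<in> Cells M" "x \<in> interior K" unfolding omega_def by blast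
  obtain G where G: "\<And>K. K \<in> Cells M \<Longrightarrow> smooth (G K)"
    "\<And>K x. K \<in> Cells M \<Longrightarrow> x \<in> interior K \<Longrightarrow> f x = G K x"
    using pw_smooth_extension[OF f] by blast
  have "set_integrable lebesgue (omega M) (\<lambda>x. f x \<bullet> f x)"
    by (intro pwc_integrable[OF M] pwc_inner pw_smooth_imp_pwc f)
  then have i: "integrable lebesgue (\<lambda>x. indicator (omega M) x *\<^sub>R (f x \<bullet> f x))"
    unfolding set_integrable_def .
  have ae: "AE x in lebesgue. indicator (omega M) x *\<^sub>R (f x \<bullet> f x) = 0"
  proof (rule integral_nonneg_eq_0_iff_AE[OF i, THEN iffD1])
    show "AE x in lebesgue. 0 \<le> indicator (omega M) x *\<^sub>R (f x \<bullet> f x)"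
      by (intro AE_I2 scaleR_nonneg_nonneg indicator_pos_le inner_ge_zero)
  qed (use z in \<open>unfold ip_def set_lebesgue_integral_def\<close>)
  let ?U = "interior K \<inter> {y. G K y \<noteq> 0}"
  have oU: "open ?U"
  proof (rule open_Int[OF open_interior])
    have "open (G K -` (- {0}))"
      by (rule open_vimage[OF open_Compl[OF closed_singleton] Ck_continuous[OF smooth_Ck[OF G(1)[OF K(1)], of 0]]])
    then show "open {y. G K y \<noteq> 0}" by (simp add: vimage_def)
  qed
  have "negligible ?U"
  proof -
    have "AE x in lebesgue. x \<notin> ?U"
      using ae
    proof eventually_elim
      case (elim y)
      show ?case
      proof
        assume y: "y \<in> ?U"
        then have yK: "y \<in> interior K" "G K y \<noteq> 0" by blast+
        have "y \<in> omega M" using K(1) yK(1) unfolding omega_def by blast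
        moreover have "f y = G K y" by (rule G(2)[OF K(1) yK(1)])
        ultimately show False using elim yK(2) by simp
      qed
    qed
    then have "?U \<in> null_sets lebesgue"
      by (intro completion.null_sets_iff_AE[THEN iffD2] conjI) (assumption, simp)
    then show ?thesis unfolding negligible_iff_null_sets .
  qed
  then have "?U = {}" using open_not_negligible[OF oU] by blast
  then have "G K x = 0" using K(2) by blast
  then show "f x = 0" using G(2)[OF K] by simp
qed


section \<open>Conservation laws\<close>

lemma total_energy_power:
  assumes M: "fe_mesh M" and S: "de_rham_spaces M S" and v: "valid_params M p"
    and h: "hydro_system M S p st I s" and B: "fe_curve I W (s_B s) (s_Bt s)" "fe_space M W" and t: "t \<in> I"
  shows "((\<lambda>\<tau>. total_energy M p (s_n s \<tau>) (s_V s \<tau>) (s_T s \<tau>) (s_B s \<tau>)) has_real_derivative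
      heating M p st (s_Bc s t) (s_j s t) (\<lambda>_. 1)
      - ip M (s_j s t) (\<lambda>x. (s_F s t x /\<^sub>R s_n s t x) \<times>\<^sub>v
          lorentz_field M p st (s_n s t) (s_V s t) (s_F s t) (s_B s t) (s_Bt s t) (s_Bc s t) x)
      + ip M (s_B s t) (s_Bt s t) / vac_perm p) (at t within I)"
proof -
  note D = de_rhamD[OF S]
  have mu: "vac_perm p > 0" "ion_mass p > 0" using v unfolding valid_params_def by blast+
  have n: "fe_curve I (V3 S) (s_n s) (s_nt s)" and V: "fe_curve I (V2o M S) (s_V s) (s_Vt s)"
    and T: "fe_curve I (V0 S) (s_T s) (s_Tt s)"
    using h unfolding hydro_system_def by blast+
  have pos: "\<exists>c>0. \<forall>x\<in>omega M. c \<le> s_n s t x"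
    and eqs: "density_eq M (s_nt s t) (s_F s t)" "flux_eq M S (s_n s t) (s_V s t) (s_F s t)"
      "momentum_eq M S p (s_n s t) (s_V s t) (s_Vt s t) (s_T s t) (s_F s t) (s_j s t)
          (lorentz_field M p st (s_n s t) (s_V s t) (s_F s t) (s_B s t) (s_Bt s t) (s_Bc s t))"
      "temperature_eq M S p (s_n s t) (s_T s t) (s_Tt s t) (s_F s t)
          (heating M p st (s_Bc s t) (s_j s t))"
    using h t unfolding hydro_system_def by blast+
  obtain c where c: "c > 0" "\<And>x. x \<in> omega M \<Longrightarrow> c \<le> s_n s t x" using pos by blast
  have mem: "s_n s t \<in> V3 S" "s_V s t \<in> V2o M S" "s_Vt s t \<in> V2o M S" "s_T s t \<in> V0 S" "s_Tt s t \<in> V0 S"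
    using fe_curve_member[OF n fe_space_lincomb[OF D(4)] t] fe_curve_member[OF T fe_space_lincomb[OF D(1)] t]
      fe_curve_member[OF V V2o_lincomb[OF M D(3)] t] by simp_all
  have "ion_mass p * ip M (\<lambda>x. (norm (s_V s t x))\<^sup>2 / 2) (s_nt s t)
      + ion_mass p * ip M (s_Vt s t) (\<lambda>x. s_n s t x *\<^sub>R s_V s t x)
      + ip M (s_T s t) (s_nt s t) / (adiabatic_index - 1) + ip M (s_n s t) (s_Tt s t) / (adiabatic_index - 1)
    = heating M p st (s_Bc s t) (s_j s t) (\<lambda>_. 1)
      - ip M (s_j s t) (\<lambda>x. (s_F s t x /\<^sub>R s_n s t x) \<times>\<^sub>v
          lorentz_field M p st (s_n s t) (s_V s t) (s_F s t) (s_B s t) (s_Bt s t) (s_Bc s t) x)"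
    by (rule hydro_power[OF M S mu(2) mem c eqs])
  with total_energy_deriv[OF M S mu(1) n V T B t] show ?thesis by (simp only:)
qed

lemma mhd_div_conformingD:
  assumes h: "mhd_div_conforming M S p st I b1 b2 bc g2 s" and t: "t \<in> I"
  shows "electric_eq M p (V1 S) st (s_n s t) (s_V s t) (s_F s t) (s_B s t) (s_Bt s t) (s_Bc s t) (s_j s t) (s_E s t)"
    "s_j s t \<in> V1 S" "penalty_field_eq M S st (s_B s t) (s_Bc s t)"
    "agree M (\<lambda>x. s_Bt s t x + curl (s_E s t) x) (\<lambda>_. 0)"
    "hydro_system M S p st I s" "fe_curve I (V2 S) (s_B s) (s_Bt s)"
    "\<forall>\<sigma>\<in>V1 S. ip M \<sigma> (s_j s t) = ip M (curl \<sigma>) (\<lambda>x. s_B s t x /\<^sub>R vac_perm p)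
           + int_bdry M b2 (\<lambda>K x. g2 t x \<bullet> cell_trace K \<sigma> x)"
  using h t unfolding mhd_div_conforming_def by blast+

lemma mhd_curl_conformingD:
  assumes h: "mhd_curl_conforming M S p st I b1 b2 h1 g2 s" and t: "t \<in> I"
  shows "electric_eq M p (V2 S) st (s_n s t) (s_V s t) (s_F s t) (s_B s t) (s_Bt s t) (s_Bc s t) (s_j s t) (s_E s t)"
    "s_j s t \<in> V2 S" "penalty_field_eq M S st (s_B s t) (s_Bc s t)"
    "\<forall>\<sigma>\<in>V1 S. ip M \<sigma> (s_Bt s t) + ip M (curl \<sigma>) (s_E s t)
           + int_bdry M b1 (\<lambda>K x. cell_trace K \<sigma> x \<bullet> h1 t x) = 0"
    "hydro_system M S p st I s" "fe_curve I (V1 S) (s_B s) (s_Bt s)" "\<not> projected st"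
    "agree M (s_j s t) (\<lambda>x. curl (s_B s t) x /\<^sub>R vac_perm p)"
  using h t unfolding mhd_curl_conforming_def by blast+

text \<open>The discrete current is the adjoint curl of \<open>B\<close>: testing its equation with \<open>E\<close> gives \<open>\<langle>curl E, B\<rangle>\<close>, and
  \<open>B' = - curl E\<close>.\<close>

lemma magnetic_power_div:
  assumes h: "mhd_div_conforming M S p st I b1 b2 bc g2 s" and t: "t \<in> I"
  shows "ip M (s_B s t) (s_Bt s t) / vac_perm p = - ip M (s_j s t) (s_E s t)
    + int_bdry M b2 (\<lambda>K x. g2 t x \<bullet> cell_trace K (s_E s t) x)"
proof -
  let ?E = "s_E s t"
  note e = mhd_div_conformingD[OF h t]
  have "ip M ?E (s_j s t) = inverse (vac_perm p) * ip M (curl ?E) (s_B s t)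
           + int_bdry M b2 (\<lambda>K x. g2 t x \<bullet> cell_trace K ?E x)"
    using bspec[OF e(7) electric_member[OF e(1)]] unfolding ip_scale_right .
  moreover have "ip M (s_B s t) (s_Bt s t) = - ip M (s_B s t) (curl ?E)"
    unfolding ip_minus_right[symmetric]
    by (rule ip_cong) (use e(4) in \<open>simp add: agree_def add_eq_0_iff2\<close>)
  ultimately show ?thesis
    unfolding divide_inverse ip_commute[of M "s_j s t"] ip_commute[of M "s_B s t" "curl ?E"]
    by (simp add: mult.commute)
qed

text \<open>Here the induction equation is the weak one; it is tested with \<open>B\<close>, and \<open>curl B\<close> is the current up to a constant.\<close>

lemma magnetic_power_curl:
  assumes b: "boundary_split M b1 b2" and S: "fe_space M (V1 S)"
    and h: "mhd_curl_conforming M S p st I b1 b2 h1 g2 s"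
    and h1: "\<forall>t\<in>I. \<forall>x\<in>bdry M. h1 t x = 0" and t: "t \<in> I"
  shows "ip M (s_B s t) (s_Bt s t) / vac_perm p = - ip M (s_j s t) (s_E s t)"
proof -
  note e = mhd_curl_conformingD[OF h t]
  have "b1 \<subseteq> bdry M" using b unfolding boundary_split_def by blast
  then have "int_bdry M b1 (\<lambda>K x. cell_trace K (s_B s t) x \<bullet> h1 t x) = 0"
    by (intro int_bdry_zero) (use h1 t in auto)
  then have "ip M (s_B s t) (s_Bt s t) + ip M (curl (s_B s t)) (s_E s t) = 0"
    using bspec[OF e(4) fe_curve_member(1)[OF e(6) fe_space_lincomb[OF S] t]] by simp
  moreover have "ip M (s_j s t) (s_E s t) = inverse (vac_perm p) * ip M (curl (s_B s t)) (s_E s t)"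
    unfolding ip_scale_left[symmetric] by (rule ip_cong) (use e(8) in \<open>simp add: agree_def\<close>)
  ultimately show ?thesis unfolding divide_inverse by (simp add: add_eq_0_iff2)
qed

lemma energy_div:
  assumes M: "fe_mesh M" and S: "de_rham_spaces M S" and v: "valid_params M p"
    and b: "boundary_split M (bdry M) b2"
    and h: "mhd_div_conforming M S p st {0..tend} (bdry M) b2 bc g2 s" and st: "st \<noteq> HelicityPreserving"
    and t: "t \<in> {0..tend}"
  shows "total_energy M p (s_n s t) (s_V s t) (s_T s t) (s_B s t)
       = total_energy M p (s_n s 0) (s_V s 0) (s_T s 0) (s_B s 0)"
proof (rule zero_deriv_constant[OF _ t])
  fix t assume t: "t \<in> {0..tend}"
  note e = mhd_div_conformingD[OF h t]
  have "b2 = {}" using b unfolding boundary_split_def by blast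
  then have "int_bdry M b2 k = 0" for k by (intro int_bdry_zero) simp
  then have m: "ip M (s_B s t) (s_Bt s t) / vac_perm p = - ip M (s_j s t) (s_E s t)"
    using magnetic_power_div[OF h t] by simp
  show "((\<lambda>t. total_energy M p (s_n s t) (s_V s t) (s_T s t) (s_B s t)) has_real_derivative 0) (at t within {0..tend})"
    using total_energy_power[OF M S v e(5,6) de_rhamD(3)[OF S] t]
    unfolding m electric_work[OF M e(1,2,3) st] by simp
qed

lemma energy_curl:
  assumes M: "fe_mesh M" and S: "de_rham_spaces M S" and v: "valid_params M p"
    and b: "boundary_split M b1 b2"
    and h: "mhd_curl_conforming M S p st {0..tend} b1 b2 h1 g2 s"
    and h1: "\<forall>t\<in>{0..tend}. \<forall>x\<in>bdry M. h1 t x = 0"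
    and t: "t \<in> {0..tend}"
  shows "total_energy M p (s_n s t) (s_V s t) (s_T s t) (s_B s t)
       = total_energy M p (s_n s 0) (s_V s 0) (s_T s 0) (s_B s 0)"
proof (rule zero_deriv_constant[OF _ t])
  fix t assume t: "t \<in> {0..tend}"
  note e = mhd_curl_conformingD[OF h t]
  have st: "st \<noteq> HelicityPreserving" using e(7) unfolding projected_def by blast
  note m = magnetic_power_curl[OF b de_rhamD(2)[OF S] h h1 t]
  show "((\<lambda>t. total_energy M p (s_n s t) (s_V s t) (s_T s t) (s_B s t)) has_real_derivative 0) (at t within {0..tend})"
    using total_energy_power[OF M S v e(5,6) de_rhamD(2)[OF S] t]
    unfolding m electric_work[OF M e(1,2,3) st] by simp
qed

lemma divergence_div:
  assumes S: "de_rham_spaces M S" and h: "mhd_div_conforming M S p st {0..tend} b1 b2 bc g2 s"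
    and z: "agree M (dvg (s_B s 0)) (\<lambda>_. 0)" and t: "t \<in> {0..tend}"
  shows "agree M (dvg (s_B s t)) (\<lambda>_. 0)"
  unfolding agree_def
proof
  fix x assume x: "x \<in> omega M"
  have "dvg (s_B s t) x = dvg (s_B s 0) x"
  proof (rule zero_deriv_constant[OF _ t])
    fix t assume t: "t \<in> {0..tend}"
    note e = mhd_div_conformingD[OF h t]
    have "pw_smooth M (s_E s t)" using fe_space_member(1)[OF de_rhamD(2)[OF S] electric_member[OF e(1)]] .
    from dvg_of_curl_member[OF this e(4) x]
    show "((\<lambda>t. dvg (s_B s t) x) has_real_derivative 0) (at t within {0..tend})"
      using dvg_fe_curve_deriv[OF e(6) de_rhamD(3)[OF S] x t] by simp
  qed
  then show "dvg (s_B s t) x = 0" using z x unfolding agree_def by simp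
qed

text \<open>For every test function \<open>\<theta>\<close> the product \<open>\<langle>\<theta>, \<delta>\<rangle>\<close> has zero time derivative. Since \<open>grad \<theta>\<close> is an
  admissible test function with \<open>curl grad \<theta> = 0\<close>, the induction equation leaves only a boundary term with \<open>h\<^sub>1\<close>,
  which the surface divergence \<open>\<partial>g\<^sub>1/\<partial>t\<close> of \<open>h\<^sub>1\<close> compensates. Finally \<open>\<theta> = \<delta>\<close> itself is a test function.\<close>

lemma divergence_curl:
  assumes M: "fe_mesh M" and S: "de_rham_spaces M S" and b: "boundary_split M b1 b2" and tend: "0 < tend"
    and h: "mhd_curl_conforming M S p st {0..tend} b1 b2 h1 g2 s"
    and h1: "\<forall>t\<in>{0..tend}. \<forall>x\<in>b2. h1 t x = 0" and g1: "compatible_g1 M {0..tend} g1 h1"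
    and \<delta>: "\<forall>t\<in>{0..tend}. weak_divergence M S (s_B s t) (g1 t) (\<delta> t)"
    and z: "agree M (\<delta> 0) (\<lambda>_. 0)" and t: "t \<in> {0..tend}"
  shows "agree M (\<delta> t) (\<lambda>_. 0)"
proof -
  let ?I = "{0..tend}"
  note D = de_rhamD[OF S]
  from g1 obtain g1' C where d: "\<forall>t\<in>?I. \<forall>x\<in>bdry M. ((\<lambda>s. g1 s x) has_real_derivative g1' t x) (at t within ?I)"
    and C: "\<forall>t\<in>?I. \<forall>x\<in>bdry M. \<bar>g1' t x\<bar> \<le> C"
    and int: "\<forall>t\<in>?I. bdry_integrable M (bdry M) (g1 t)"
    and sd: "\<forall>t\<in>?I. surface_divergence M (h1 t) (g1' t)"
    unfolding compatible_g1_def by (elim exE conjE)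
  have int': "\<forall>t\<in>?I. bdry_integrable M (bdry M) (g1' t)"
    using sd unfolding surface_divergence_def by blast
  have weak: "ip M \<theta> (\<delta> t) = - ip M (grad \<theta>) (s_B s t) + int_bdry M (bdry M) (\<lambda>K x. cell_trace K \<theta> x * g1 t x)"
    if "t \<in> ?I" "\<theta> \<in> V0 S" for t \<theta>
    using bspec[OF \<delta> that(1)] that(2) unfolding weak_divergence_def by blast
  have const: "ip M \<theta> (\<delta> t) = ip M \<theta> (\<delta> 0)" if \<theta>: "\<theta> \<in> V0 S" and t: "t \<in> ?I" for \<theta> t
  proof (rule zero_deriv_constant[OF _ t])
    fix t assume t: "t \<in> ?I"
    note e = mhd_curl_conformingD[OF h t]
    have \<theta>s: "pw_smooth M \<theta>" by (rule fe_space_member(1)[OF D(1) \<theta>])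
    obtain a where a: "a \<in> V1 S" "agree M a (grad \<theta>)" using D(8)[OF \<theta>] by blast
    have p1: "pwc M w" if "w \<in> V1 S" for w using fe_space_member(1)[OF D(2) that] by (rule pw_smooth_imp_pwc)
    have "fe_integrand M ?I (\<lambda>t x. grad \<theta> x \<bullet> s_B s t x) (\<lambda>t x. 0 \<bullet> s_B s t x + grad \<theta> x \<bullet> s_Bt s t x)"
    proof (rule fe_integrand_inner)
      show "fe_integrand M ?I (\<lambda>t x. grad \<theta> x $ i) (\<lambda>t x. 0 $ i)" for i
        using fe_integrand_const[OF pwc_nth[OF pw_smooth_derivs(1)[OF \<theta>s]], of ?I i] by simp
      show "fe_integrand M ?I (\<lambda>t x. s_B s t x $ i) (\<lambda>t x. s_Bt s t x $ i)" for i
        by (rule fe_curve_integrand_nth[OF e(6) p1])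
    qed
    from bspec[OF fe_integrand_integral[OF M this] t]
    have vol: "((\<lambda>t. ip M (grad \<theta>) (s_B s t)) has_real_derivative ip M (grad \<theta>) (s_Bt s t)) (at t within ?I)"
      unfolding ip_def by simp
    have "((\<lambda>t. - ip M (grad \<theta>) (s_B s t) + int_bdry M (bdry M) (\<lambda>K x. cell_trace K \<theta> x * g1 t x))
      has_real_derivative - ip M (grad \<theta>) (s_Bt s t) + int_bdry M (bdry M) (\<lambda>K x. cell_trace K \<theta> x * g1' t x))
      (at t within ?I)"
      by (intro DERIV_add DERIV_minus vol int_bdry_deriv[OF M \<theta>s _ t d C int int']) simp
    moreover have "- ip M (grad \<theta>) (s_Bt s t) + int_bdry M (bdry M) (\<lambda>K x. cell_trace K \<theta> x * g1' t x) = 0"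
    proof -
      have "\<forall>\<phi>\<in>H1 M. pw_smooth M \<phi> \<longrightarrow> int_bdry M (bdry M) (\<lambda>K x. cell_trace K \<phi> x * g1' t x) =
          - int_bdry M (bdry M) (\<lambda>K x. cell_trace K (grad \<phi>) x \<bullet> h1 t x)"
        using bspec[OF sd t] unfolding surface_divergence_def by (elim conjE)
      then have "int_bdry M (bdry M) (\<lambda>K x. cell_trace K \<theta> x * g1' t x) =
          - int_bdry M (bdry M) (\<lambda>K x. cell_trace K (grad \<theta>) x \<bullet> h1 t x)"
        using subsetD[OF D(5) \<theta>] \<theta>s by blast
      moreover have "int_bdry M (bdry M) (\<lambda>K x. cell_trace K (grad \<theta>) x \<bullet> h1 t x) =
          int_bdry M b1 (\<lambda>K x. cell_trace K a x \<bullet> h1 t x)"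
      proof (rule int_bdry_cong)
        fix K x assume K: "K \<in> Cells M"
        have "cell_trace K (grad \<theta>) x = cell_trace K a x"
          by (rule cell_trace_cong) (rule agree_interior[OF a(2) K, symmetric])
        moreover have "x \<in> bdry M \<longleftrightarrow> x \<in> b1 \<or> x \<in> b2" using b unfolding boundary_split_def by blast
        moreover have "h1 t x = 0" if "x \<in> b2" using h1 t that by blast
        ultimately show "indicator (K \<inter> bdry M) x *\<^sub>R (cell_trace K (grad \<theta>) x \<bullet> h1 t x) =
          indicator (K \<inter> b1) x *\<^sub>R (cell_trace K a x \<bullet> h1 t x)"
          by (cases "x \<in> b2") (simp_all add: indicator_def)
      qed
      moreover have "ip M a (s_Bt s t) = ip M (grad \<theta>) (s_Bt s t)"
        by (rule ip_cong) (use a(2) in \<open>simp add: agree_def\<close>)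
      moreover have "ip M (curl a) (s_E s t) = 0"
      proof -
        have "ip M (curl a) (s_E s t) = ip M (\<lambda>_. 0) (s_E s t)"
          by (rule ip_cong) (simp add: curl_of_gradient_member[OF \<theta>s a(2)])
        then show ?thesis by (simp add: ip_def)
      qed
      ultimately show ?thesis using bspec[OF e(4) a(1)] by simp
    qed
    ultimately have "((\<lambda>t. - ip M (grad \<theta>) (s_B s t) + int_bdry M (bdry M) (\<lambda>K x. cell_trace K \<theta> x * g1 t x))
      has_real_derivative 0) (at t within ?I)" by (simp only:)
    then show "((\<lambda>t. ip M \<theta> (\<delta> t)) has_real_derivative 0) (at t within ?I)"
      by (rule deriv_cong_on[OF t weak[OF _ \<theta>, symmetric], rotated])
  qed
  have mem: "\<delta> t \<in> V0 S" using bspec[OF \<delta> t] unfolding weak_divergence_def by blast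
  have "ip M (\<delta> t) (\<delta> 0) = ip M (\<delta> t) (\<lambda>_. 0)"
    by (rule ip_cong) (use z in \<open>simp add: agree_def\<close>)
  then have "ip M (\<delta> t) (\<delta> t) = 0" using const[OF mem t] by (simp add: ip_def)
  then show ?thesis by (rule ip_self_zero[OF M fe_space_member(1)[OF D(1) mem]])
qed

lemma subgrid_magnetic_power:
  assumes M: "fe_mesh M" and v: "valid_params M p" and B: "fe_curve I W (s_B s) (s_Bt s)" "fe_space M W" and t: "t \<in> I"
    and E: "electric_eq M p X SubgridResistivity (s_n s t) (s_V s t) (s_F s t) (s_B s t) (s_Bt s t) (s_Bc s t) (s_j s t) (s_E s t)"
    and j: "s_j s t \<in> X" and Bc: "penalty_field_eq M S SubgridResistivity (s_B s t) (s_Bc s t)"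
    and m: "ip M (s_B s t) (s_Bt s t) / vac_perm p = - ip M (s_j s t) (s_E s t) + r"
  shows "((\<lambda>\<tau>. magnetic_energy M p (s_B s \<tau>)) has_real_derivative
            ip M (s_j s t) (\<lambda>x. (s_F s t x /\<^sub>R s_n s t x) \<times>\<^sub>v s_B s t x)
          - int_facets M (\<lambda>e x. (facet_area e)\<^sup>2 * kappa_B p * (norm (jump e (s_j s t) x))\<^sup>2) + r)
          (at t within I)"
proof -
  have mu: "vac_perm p > 0" using v unfolding valid_params_def by blast
  have w: "ip M (s_j s t) (s_E s t) = int_facets M (\<lambda>e x. (facet_area e)\<^sup>2 * kappa_B p * (norm (jump e (s_j s t) x))\<^sup>2)
      - ip M (s_j s t) (\<lambda>x. (s_F s t x /\<^sub>R s_n s t x) \<times>\<^sub>v s_B s t x)"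
    using electric_work[OF M E j Bc] by (simp add: heating_def lorentz_field_def subgrid_heating_one[OF M])
  show ?thesis using magnetic_energy_deriv[OF M mu B t] unfolding m w by simp
qed

theorem mainTheorem6:
  fixes M :: mesh and S :: spaces and p :: params and tend :: real
    and b1 b2 :: "point set" and I :: "real set"
  assumes "I = {0..tend}" and "fe_mesh M" and "de_rham_spaces M S" and "valid_params M p" and "0 < tend"
    and "boundary_split M b1 b2"
  shows
    \<comment> \<open>(i) energy, div-conforming\<close>
    "(\<forall>st bc g2 s.
        mhd_div_conforming M S p st I b1 b2 bc g2 s \<and>
        b1 = bdry M \<and> homogeneous_bc M I bc \<and> st \<noteq> HelicityPreserving \<longrightarrow>
        (\<forall>t\<in>I. total_energy M p (s_n s t) (s_V s t) (s_T s t) (s_B s t)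
              = total_energy M p (s_n s 0) (s_V s 0) (s_T s 0) (s_B s 0))) \<and>
    \<comment> \<open>(i) energy, curl-conforming\<close>
     (\<forall>st h1 g2 s.
        mhd_curl_conforming M S p st I b1 b2 h1 g2 s \<and>
        (\<forall>t\<in>I. \<forall>x\<in>bdry M. h1 t x = 0) \<longrightarrow>
        (\<forall>t\<in>I. total_energy M p (s_n s t) (s_V s t) (s_T s t) (s_B s t)
              = total_energy M p (s_n s 0) (s_V s 0) (s_T s 0) (s_B s 0))) \<and>
    \<comment> \<open>(ii) divergence, div-conforming\<close>
     (\<forall>st bc g2 s.
        mhd_div_conforming M S p st I b1 b2 bc g2 s \<and>
        agree M (dvg (s_B s 0)) (\<lambda>_. 0) \<longrightarrow>
        (\<forall>t\<in>I. agree M (dvg (s_B s t)) (\<lambda>_. 0))) \<and>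
    \<comment> \<open>(ii) weak divergence, curl-conforming; \<open>h1\<close> is extended by zero to \<open>b2\<close>\<close>
     (\<forall>st h1 g2 s g1 \<delta>.
        mhd_curl_conforming M S p st I b1 b2 h1 g2 s \<and>
        (\<forall>t\<in>I. \<forall>x\<in>b2. h1 t x = 0) \<and>
        compatible_g1 M I g1 h1 \<and>
        (\<forall>t\<in>I. weak_divergence M S (s_B s t) (g1 t) (\<delta> t)) \<and>
        agree M (\<delta> 0) (\<lambda>_. 0) \<longrightarrow>
        (\<forall>t\<in>I. agree M (\<delta> t) (\<lambda>_. 0))) \<and>
    \<comment> \<open>(iii) magnetic energy, sub-grid resistivity, curl-conforming\<close>
     (\<forall>h1 g2 s.
        mhd_curl_conforming M S p SubgridResistivity I b1 b2 h1 g2 s \<and>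
        (\<forall>t\<in>I. \<forall>x\<in>bdry M. h1 t x = 0) \<longrightarrow>
        (\<forall>t\<in>I. ((\<lambda>\<tau>. magnetic_energy M p (s_B s \<tau>)) has_real_derivative
            ip M (s_j s t) (\<lambda>x. (s_F s t x /\<^sub>R s_n s t x) \<times>\<^sub>v s_B s t x)
          - int_facets M (\<lambda>e x. (facet_area e)\<^sup>2 * kappa_B p * (norm (jump e (s_j s t) x))\<^sup>2))
          (at t within I))) \<and>
    \<comment> \<open>(iii) magnetic energy, sub-grid resistivity, div-conforming\<close>
     (\<forall>bc g2 s.
        mhd_div_conforming M S p SubgridResistivity I b1 b2 bc g2 s \<longrightarrow>
        (\<forall>t\<in>I. ((\<lambda>\<tau>. magnetic_energy M p (s_B s \<tau>)) has_real_derivative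
            ip M (s_j s t) (\<lambda>x. (s_F s t x /\<^sub>R s_n s t x) \<times>\<^sub>v s_B s t x)
          - int_facets M (\<lambda>e x. (facet_area e)\<^sup>2 * kappa_B p * (norm (jump e (s_j s t) x))\<^sup>2)
          + int_bdry M b2 (\<lambda>K x. g2 t x \<bullet> cell_trace K (s_E s t) x))
          (at t within I)))"
proof (intro conjI allI impI ballI; (elim conjE)?)
  note I = assms(1) and M = assms(2) and S = assms(3) and v = assms(4) and tend = assms(5) and b = assms(6)
  note D = de_rhamD[OF S]
  fix t assume t: "t \<in> I"
  {
    fix st bc g2 s assume "mhd_div_conforming M S p st I b1 b2 bc g2 s" "b1 = bdry M" "st \<noteq> HelicityPreserving"
    then show "total_energy M p (s_n s t) (s_V s t) (s_T s t) (s_B s t)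
       = total_energy M p (s_n s 0) (s_V s 0) (s_T s 0) (s_B s 0)"
      using energy_div[OF M S v] b t unfolding I by blast
  next
    fix st h1 g2 s assume "mhd_curl_conforming M S p st I b1 b2 h1 g2 s" "\<forall>t\<in>I. \<forall>x\<in>bdry M. h1 t x = 0"
    then show "total_energy M p (s_n s t) (s_V s t) (s_T s t) (s_B s t)
       = total_energy M p (s_n s 0) (s_V s 0) (s_T s 0) (s_B s 0)"
      using energy_curl[OF M S v b] t unfolding I by blast
  next
    fix st bc g2 s assume "mhd_div_conforming M S p st I b1 b2 bc g2 s" "agree M (dvg (s_B s 0)) (\<lambda>_. 0)"
    then show "agree M (dvg (s_B s t)) (\<lambda>_. 0)"
      using divergence_div[OF S] t unfolding I by blast
  next
    fix st h1 g2 s g1 \<delta>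
    assume "mhd_curl_conforming M S p st I b1 b2 h1 g2 s" "\<forall>t\<in>I. \<forall>x\<in>b2. h1 t x = 0" "compatible_g1 M I g1 h1"
      "\<forall>t\<in>I. weak_divergence M S (s_B s t) (g1 t) (\<delta> t)" "agree M (\<delta> 0) (\<lambda>_. 0)"
    from divergence_curl[OF M S b tend this[unfolded I] t[unfolded I]] show "agree M (\<delta> t) (\<lambda>_. 0)" .
  next
    fix h1 g2 s
    assume h: "mhd_curl_conforming M S p SubgridResistivity I b1 b2 h1 g2 s" "\<forall>t\<in>I. \<forall>x\<in>bdry M. h1 t x = 0"
    note e = mhd_curl_conformingD[OF h(1) t]
    have "ip M (s_B s t) (s_Bt s t) / vac_perm p = - ip M (s_j s t) (s_E s t) + 0"
      using magnetic_power_curl[OF b D(2) h t] by simp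
    from subgrid_magnetic_power[OF M v e(6) D(2) t e(1,2,3) this]
    show "((\<lambda>\<tau>. magnetic_energy M p (s_B s \<tau>)) has_real_derivative
            ip M (s_j s t) (\<lambda>x. (s_F s t x /\<^sub>R s_n s t x) \<times>\<^sub>v s_B s t x)
          - int_facets M (\<lambda>e x. (facet_area e)\<^sup>2 * kappa_B p * (norm (jump e (s_j s t) x))\<^sup>2))
          (at t within I)" by simp
  next
    fix bc g2 s
    assume h: "mhd_div_conforming M S p SubgridResistivity I b1 b2 bc g2 s"
    note e = mhd_div_conformingD[OF h t]
    show "((\<lambda>\<tau>. magnetic_energy M p (s_B s \<tau>)) has_real_derivative
            ip M (s_j s t) (\<lambda>x. (s_F s t x /\<^sub>R s_n s t x) \<times>\<^sub>v s_B s t x)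
          - int_facets M (\<lambda>e x. (facet_area e)\<^sup>2 * kappa_B p * (norm (jump e (s_j s t) x))\<^sup>2)
          + int_bdry M b2 (\<lambda>K x. g2 t x \<bullet> cell_trace K (s_E s t) x))
          (at t within I)"
      by (rule subgrid_magnetic_power[OF M v e(6) D(3) t e(1,2,3) magnetic_power_div[OF h t]])
  }
qed

end
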